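(* Suppose $\operatorname*{ess\,sup}_{a,b\in\mathcal E} D(a,b)<\infty$. Then there exists $C>0$ such that $$\|\chi_\lambda\|_p\ \ge\ C(\lambda_T-\lambda)^{-1}$$ for all $0\le\lambda<\lambda_T$ and all $p\in[1,\infty]$.
   Context: Marked random connection model (MRCM): let $d\ge1$ be an integer, $\mathcal E$ a Polish space with its Borel $\sigma$-algebra and a probability measure $\mathcal P$. Put $\mathbb X=\mathbb R^d\times\mathcal E$ and $\nu=\mathrm{Leb}\otimes\mathcal P$. The adjacency function $\varphi:\mathbb X^2\to[0,1]$ is measurable, symmetric ($\varphi(x,y)=\varphi(y,x)$), and depends only on the spatial displacement and the marks: $\varphi((\bar x,a),(\bar y,b))=\varphi(\bar x-\bar y;a,b)$. For intensity $\lambda\ge0$, the vertex set $\eta$ is a Poisson point process on $\mathbb X$ with intensity measure $\lambda\nu$; given $\eta$, each pair $\{x,y\}$ of distinct points of $\eta$ forms an edge independently with probability $\varphi(x,y)$. The resulting random graph is $\xi$, with law $\mathbb P_\lambda$ and expectation $\mathbb E_\lambda$. For $x_1,\dots,x_m\in\mathbb X$, $\xi^{x_1,\dots,x_m}$ is the graph obtained from $\xi$ by adding the vertices $x_1,\dots,x_m$ and, independently of everything else, connecting each added vertex to every other vertex with probability given by $\varphi$. Write $o_a=(\bar 0,a)$ for $a\in\mathcal E$ (with $\bar 0$ the origin of $\mathbb R^d$), and let $\mathscr C(o_a)$ be the set of vertices of $\xi^{o_a}$ joined to $o_a$ by a finite path in $\xi^{o_a}$ (including $o_a$ itself). Susceptibility: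 $\chi_\lambda(a)=\mathbb E_\lambda[|\mathscr C(o_a)|]\in[0,\infty]$. $\|\cdot\|_p$ is the $L^p(\mathcal E,\mathcal P)$ norm, and essential suprema over marks are with respect to $\mathcal P$ (or its products). $D(a,b)=\int_{\mathbb R^d}\varphi(\bar x;a,b)\,d\bar x$. Critical intensities: $\lambda_T^{(p)}=\inf\{\lambda\ge0:\|\chi_\lambda\|_p=\infty\}$ for $p\in[1,\infty]$, with $\inf\emptyset=\infty$. When $\operatorname*{ess\,sup}_{a,b}D(a,b)<\infty$ it is known that $\lambda_T^{(p)}$ does not depend on $p$, and $\lambda_T$ denotes the common value. Convention: $(\lambda_T-\lambda)^{-1}=0$ if $\lambda_T=\infty$. *)

theory Defs
  imports "HOL-Probability.Probability"
begin

text \<open>Number of points of the set \<open>S\<close> in \<open>B\<close>, with value \<open>\<infinity>\<close> if infinite.\<close>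

definition num_points :: "'x set \<Rightarrow> 'x set \<Rightarrow> ennreal" where
  "num_points S B = emeasure (count_space UNIV) (S \<inter> B)"

text \<open>Poisson point process \<open>\<eta>\<close> with intensity measure \<open>\<mu>\<close>, realised on the probability space
  \<open>M\<close>. A realisation is the set of its points; no multiplicities are needed as long as \<open>\<mu>\<close> does
  not charge points. The Poisson weights are written out because \<open>poisson_pmf\<close> is specified for
  strictly positive rates only.\<close>

definition poisson_process :: "'w measure \<Rightarrow> 'x measure \<Rightarrow> ('w \<Rightarrow> 'x set) \<Rightarrow> bool" where
  "poisson_process M \<mu> \<eta> \<longleftrightarrow>
     prob_space M \<and>
     (\<forall>B\<in>sets \<mu>. (\<lambda>\<omega>. num_points (\<eta> \<omega>) B) \<in> borel_measurable M) \<and>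
     (\<forall>B\<in>sets \<mu>. emeasure \<mu> B < \<infinity> \<longrightarrow>
        (\<forall>k::nat. measure M {\<omega>\<in>space M. num_points (\<eta> \<omega>) B = of_nat k} =
           measure \<mu> B ^ k / fact k * exp (- measure \<mu> B))) \<and>
     (\<forall>B\<in>sets \<mu>. emeasure \<mu> B = \<infinity> \<longrightarrow> (AE \<omega> in M. num_points (\<eta> \<omega>) B = \<infinity>)) \<and>
     (\<forall>(B :: nat \<Rightarrow> 'x set) n.
        (\<forall>i<n. B i \<in> sets \<mu>) \<and> disjoint_family_on B {..<n} \<longrightarrow>
        prob_space.indep_vars M (\<lambda>_. borel) (\<lambda>i \<omega>. num_points (\<eta> \<omega>) (B i)) {..<n})"

text \<open>Admissible adjacency functions on \<open>\<real>\<^sup>d \<times> \<E>\<close>. The last conjunct says that \<open>\<phi>\<close> depends on the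
  spatial coordinates through their difference only.\<close>

definition adjacency_function ::
  "((real ^ 'd) \<times> 'e::polish_space \<Rightarrow> (real ^ 'd) \<times> 'e \<Rightarrow> real) \<Rightarrow> bool" where
  "adjacency_function \<phi> \<longleftrightarrow>
     (\<lambda>(x, y). \<phi> x y) \<in> borel_measurable ((borel \<Otimes>\<^sub>M borel) \<Otimes>\<^sub>M (borel \<Otimes>\<^sub>M borel)) \<and>
     (\<forall>x y. 0 \<le> \<phi> x y \<and> \<phi> x y \<le> 1) \<and>
     (\<forall>x y. \<phi> x y = \<phi> y x) \<and>
     (\<forall>x y x' y' a b. x - y = x' - y' \<longrightarrow> \<phi> (x, a) (y, b) = \<phi> (x', a) (y', b))"

definition integrated_adjacency ::
  "((real ^ 'd) \<times> 'e \<Rightarrow> (real ^ 'd) \<times> 'e \<Rightarrow> real) \<Rightarrow> 'e \<Rightarrow> 'e \<Rightarrow> ennreal" where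
  "integrated_adjacency \<phi> a b = (\<integral>\<^sup>+ x. ennreal (\<phi> (x, a) (0, b)) \<partial>lborel)"

text \<open>Edges are two-element sets of vertices; an edge configuration assigns to every pair of
  vertices whether it is an edge.\<close>

definition vertex_pairs :: "'x set \<Rightarrow> 'x set set" where
  "vertex_pairs S = {{x, y} | x y. x \<in> S \<and> y \<in> S \<and> x \<noteq> y}"

text \<open>\<open>\<phi> x y\<close> as a function of the unordered pair; well-defined for symmetric \<open>\<phi>\<close>.\<close>

definition edge_probability :: "('x \<Rightarrow> 'x \<Rightarrow> real) \<Rightarrow> 'x set \<Rightarrow> real" where
  "edge_probability \<phi> e = (THE p. \<forall>x y. e = {x, y} \<longrightarrow> p = \<phi> x y)"

definition edge_law :: "('x \<Rightarrow> 'x \<Rightarrow> real) \<Rightarrow> 'x set \<Rightarrow> ('x set \<Rightarrow> bool) measure" where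
  "edge_law \<phi> S =
     (\<Pi>\<^sub>M e\<in>vertex_pairs S. measure_pmf (bernoulli_pmf (edge_probability \<phi> e)))"

text \<open>The expectation of a nonnegative functional \<open>F\<close> (of vertex set and edge configuration) of the
  random graph obtained from the random connection model on the points of \<open>\<eta>\<close> by adding the
  vertices in \<open>A\<close>: first \<open>\<eta>\<close> is sampled, and given \<open>\<eta>\<close> all pairs of distinct points of
  \<open>\<eta> \<union> A\<close> are connected independently with probability \<open>\<phi>\<close>.\<close>

definition rcm_expectation ::
  "('x \<Rightarrow> 'x \<Rightarrow> real) \<Rightarrow> 'w measure \<Rightarrow> ('w \<Rightarrow> 'x set) \<Rightarrow> 'x set
     \<Rightarrow> ('x set \<Rightarrow> ('x set \<Rightarrow> bool) \<Rightarrow> ennreal) \<Rightarrow> ennreal" where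
  "rcm_expectation \<phi> M \<eta> A F =
     (\<integral>\<^sup>+ \<omega>. (\<integral>\<^sup>+ c. F (\<eta> \<omega> \<union> A) c \<partial>edge_law \<phi> (\<eta> \<omega> \<union> A)) \<partial>M)"

definition cluster :: "'x set \<Rightarrow> ('x set \<Rightarrow> bool) \<Rightarrow> 'x \<Rightarrow> 'x set" where
  "cluster S c x =
     {y \<in> S. (\<lambda>u v. u \<in> S \<and> v \<in> S \<and> u \<noteq> v \<and> c {u, v})\<^sup>*\<^sup>* x y}"

definition susceptibility ::
  "((real ^ 'd) \<times> 'e \<Rightarrow> (real ^ 'd) \<times> 'e \<Rightarrow> real) \<Rightarrow> 'w measure
     \<Rightarrow> ('w \<Rightarrow> ((real ^ 'd) \<times> 'e) set) \<Rightarrow> 'e \<Rightarrow> ennreal" where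
  "susceptibility \<phi> M \<eta> a =
     rcm_expectation \<phi> M \<eta> {(0, a)}
       (\<lambda>S c. emeasure (count_space UNIV) (cluster S c (0, a)))"

text \<open>\<open>x\<close> to the power \<open>r\<close> on \<open>[0, \<infinity>]\<close>, for \<open>r > 0\<close>.\<close>

definition ennreal_powr :: "ennreal \<Rightarrow> real \<Rightarrow> ennreal" where
  "ennreal_powr x r = (if x = \<infinity> then \<infinity> else ennreal (enn2real x powr r))"

text \<open>The \<open>L\<^sup>p\<close> norm of a \<open>[0, \<infinity>]\<close>-valued function, for \<open>p \<in> [1, \<infinity>]\<close>.\<close>

definition Lp_norm :: "'e measure \<Rightarrow> ennreal \<Rightarrow> ('e \<Rightarrow> ennreal) \<Rightarrow> ennreal" where
  "Lp_norm P p f =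
     (if p = \<infinity> then esssup P f
      else ennreal_powr (\<integral>\<^sup>+ a. ennreal_powr (f a) (enn2real p) \<partial>P) (1 / enn2real p))"

text \<open>\<open>Inf {} = \<infinity>\<close> in \<^typ>\<open>ennreal\<close>.\<close>

definition critical_intensity_p ::
  "'e measure \<Rightarrow> (real \<Rightarrow> 'e \<Rightarrow> ennreal) \<Rightarrow> ennreal \<Rightarrow> ennreal" where
  "critical_intensity_p P chi p = Inf {ennreal l | l. 0 \<le> l \<and> Lp_norm P p (chi l) = \<infinity>}"

text \<open>The common value of the critical intensities for all \<open>p \<in> [1, \<infinity>]\<close>; meaningful only if they
  coincide, as they do for bounded \<open>D\<close>.\<close>

definition critical_intensity :: "'e measure \<Rightarrow> (real \<Rightarrow> 'e \<Rightarrow> ennreal) \<Rightarrow> ennreal" where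
  "critical_intensity P chi = (THE l. \<forall>p\<ge>1. critical_intensity_p P chi p = l)"

end

theory Submission
  imports Defs
begin

text \<open>If the process of intensity \<open>l\<close> is enlarged by independent points of intensity \<open>\<epsilon>\<close>, explore
  first the cluster of the root among the old points. Conditionally on it, the remaining old points
  form a thinned process, and every new point adjacent to the explored cluster starts a cluster that
  is, on average, at most as large as a full cluster at intensity \<open>l + \<epsilon>\<close>. In a bounded window, where
  all means are finite, the supremum \<open>B\<close> of the mean cluster size at intensity \<open>l + \<epsilon>\<close> thus satisfies
  \<open>B \<le> (1 + \<epsilon> K B) X\<close>, where \<open>K\<close> bounds \<open>D\<close> and \<open>X\<close> bounds the susceptibility at \<open>l\<close>; hence \<open>B\<close> is
  bounded uniformly in the window as long as \<open>\<epsilon> K X < 1\<close>. The case of no old points gives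
  \<open>\<chi> \<le> 1 + l K N\<close> with \<open>N\<close> the \<open>L\<^sup>1\<close> norm of \<open>\<chi>\<close>, so one may take \<open>X = 1 + l K N\<close>; it also shows that all
  \<open>L\<^sup>p\<close> norms become infinite at the same intensity, and that the distance from \<open>l\<close> to this intensity is
  at least \<open>1 / (K (1 + l K N))\<close>.\<close>

section \<open>Finite random graphs\<close>

text \<open>Three obstacles shape the proof. The inequality for \<open>B\<close> says nothing when
  \<open>B\<close> is infinite, so it is solved in a bounded window, where a crude volume bound
  makes \<open>B\<close> finite; the solution no longer refers to the window. Windows are not
  translation invariant; therefore \<open>B\<close> is a supremum over all positions of the root,
  and the mean size in a window, for a root at any position, is compared with \<chi> by shifting the
  whole process. Finally, the processes at different intensities live on unrelated probability
  spaces and are known only through their counts. The law of the points in a window is recovered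
  from the counts, and old and new points are superposed for this explicit law, without coupling the
  given processes.

  The remaining old points are conditioned to avoid the explored cluster. That this can only lower
  the mean size of a further cluster is a correlation inequality for Poisson configurations, proved
  by thinning. The bound on \<open>D\<close> holds only up to null sets of marks; suprema are taken
  outside an exceptional null set, which no norm sees and which configurations almost surely
  avoid.\<close>

definition edge_weight :: "('v set \<Rightarrow> real) \<Rightarrow> 'v set set \<Rightarrow> 'v set set \<Rightarrow> real" where
  "edge_weight r F E = (\<Prod>e\<in>F. if e \<in> E then r e else 1 - r e)"

text \<open>A finite sum over edge sets instead of an integral over the product measure: no
  measurability conditions arise, and independence of disjoint edge sets becomes a factorisation of
  weights. The link to \<open>edge_law\<close> is
  \<open>nn_integral_edge_law_finite\<close>.\<close>

definition edge_expectation ::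
  "('v set \<Rightarrow> real) \<Rightarrow> 'v set set \<Rightarrow> ('v set set \<Rightarrow> ennreal) \<Rightarrow> ennreal" where
  "edge_expectation r F h = (\<Sum>E\<in>Pow F. ennreal (edge_weight r F E) * h E)"

lemma edge_expectation_cong:
  assumes "\<And>E. E \<subseteq> F \<Longrightarrow> h E = h' E"
  shows "edge_expectation r F h = edge_expectation r F h'"
  unfolding edge_expectation_def using assms by (intro sum.cong) auto

lemma edge_expectation_mono:
  assumes "\<And>E. E \<subseteq> F \<Longrightarrow> h E \<le> h' E"
  shows "edge_expectation r F h \<le> edge_expectation r F h'"
  unfolding edge_expectation_def using assms by (intro sum_mono mult_left_mono) auto

lemma edge_expectation_add:
  "edge_expectation r F (\<lambda>E. h E + h' E) = edge_expectation r F h + edge_expectation r F h'"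
  unfolding edge_expectation_def by (simp add: distrib_left sum.distrib)

lemma edge_expectation_cmult:
  "edge_expectation r F (\<lambda>E. c * h E) = c * edge_expectation r F h"
  unfolding edge_expectation_def by (simp add: sum_distrib_left mult.left_commute)

lemma edge_expectation_sum:
  "edge_expectation r F (\<lambda>E. \<Sum>i\<in>I. h i E) = (\<Sum>i\<in>I. edge_expectation r F (h i))"
  unfolding edge_expectation_def by (simp add: sum_distrib_left sum.swap[of _ I])

text \<open>The weight of \<open>E1 \<union> E2\<close> is the product of the two weights, and
  splitting an edge set into its traces on \<open>F1\<close> and \<open>F2\<close> is a bijection.
  This is the Fubini theorem behind all later independence arguments on finite graphs.\<close>

lemma edge_expectation_union:
  assumes "finite F1" "finite F2" "F1 \<inter> F2 = {}" and r: "\<And>e. 0 \<le> r e \<and> r e \<le> 1"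
  shows "edge_expectation r (F1 \<union> F2) h =
    edge_expectation r F1 (\<lambda>E1. edge_expectation r F2 (\<lambda>E2. h (E1 \<union> E2)))"
proof -
  have w: "edge_weight r (F1 \<union> F2) (E1 \<union> E2) = edge_weight r F1 E1 * edge_weight r F2 E2"
    if "E1 \<subseteq> F1" "E2 \<subseteq> F2" for E1 E2
  proof -
    have "(\<Prod>e\<in>F1. if e \<in> E1 \<union> E2 then r e else 1 - r e) = edge_weight r F1 E1"
      unfolding edge_weight_def using that assms by (intro prod.cong) auto
    moreover have "(\<Prod>e\<in>F2. if e \<in> E1 \<union> E2 then r e else 1 - r e) = edge_weight r F2 E2"
      unfolding edge_weight_def using that assms by (intro prod.cong) auto
    ultimately show ?thesis
      unfolding edge_weight_def using assms by (subst prod.union_disjoint) auto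
  qed
  have nn: "0 \<le> edge_weight r F E" for F E
    unfolding edge_weight_def using r by (intro prod_nonneg) auto
  have inj: "bij_betw (\<lambda>(E1, E2). E1 \<union> E2) (Pow F1 \<times> Pow F2) (Pow (F1 \<union> F2))"
    by (rule bij_betw_byWitness[where f' = "\<lambda>E. (E \<inter> F1, E \<inter> F2)"]) (use assms in auto)
  have "edge_expectation r (F1 \<union> F2) h =
      (\<Sum>(E1, E2)\<in>Pow F1 \<times> Pow F2. ennreal (edge_weight r (F1 \<union> F2) (E1 \<union> E2)) * h (E1 \<union> E2))"
    unfolding edge_expectation_def
    by (subst sum.reindex_bij_betw[OF inj, symmetric]) (auto intro!: sum.cong)
  also have "\<dots> = (\<Sum>(E1, E2)\<in>Pow F1 \<times> Pow F2.
      ennreal (edge_weight r F1 E1) * (ennreal (edge_weight r F2 E2) * h (E1 \<union> E2)))"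
    by (intro sum.cong) (auto simp: w nn ennreal_mult mult.assoc)
  also have "\<dots> = edge_expectation r F1 (\<lambda>E1. edge_expectation r F2 (\<lambda>E2. h (E1 \<union> E2)))"
    unfolding edge_expectation_def by (simp add: sum.cartesian_product sum_distrib_left)
  finally show ?thesis .
qed

text \<open>The weights sum to one: peel off single edges, each contributing
  \<open>(1 - r e) + r e\<close>.\<close>

lemma edge_expectation_const:
  assumes "finite F" and r: "\<And>e. 0 \<le> r e \<and> r e \<le> 1"
  shows "edge_expectation r F (\<lambda>_. c) = c"
  using assms(1)
proof induction
  case (insert e F)
  have one: "edge_expectation r {e} (\<lambda>_. c) = c"
  proof -
    have "Pow {e} = {{}, {e}}" by auto
    then have "edge_expectation r {e} (\<lambda>_. c) = ennreal (1 - r e) * c + ennreal (r e) * c"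
      by (simp add: edge_expectation_def edge_weight_def)
    also have "\<dots> = (ennreal (1 - r e) + ennreal (r e)) * c"
      by (simp add: distrib_right)
    also have "ennreal (1 - r e) + ennreal (r e) = 1"
      using r[of e] by (simp flip: ennreal_plus)
    finally show ?thesis by simp
  qed
  show ?case
    using edge_expectation_union[of "{e}" F r "\<lambda>_. c"] insert r one by simp
qed (simp add: edge_expectation_def edge_weight_def)

text \<open>Edges outside \<open>F1\<close> integrate to one. This allows graphs on different vertex
  sets to be compared on a common set of edges.\<close>

lemma edge_expectation_restrict:
  assumes "finite F" "F1 \<subseteq> F" and r: "\<And>e. 0 \<le> r e \<and> r e \<le> 1"
    and h: "\<And>E. E \<subseteq> F \<Longrightarrow> h E = h (E \<inter> F1)"
  shows "edge_expectation r F h = edge_expectation r F1 h"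
proof -
  have "edge_expectation r (F1 \<union> (F - F1)) h =
      edge_expectation r F1 (\<lambda>E1. edge_expectation r (F - F1) (\<lambda>E2. h (E1 \<union> E2)))"
    using assms by (intro edge_expectation_union) (auto intro: finite_subset)
  also have "\<dots> = edge_expectation r F1 (\<lambda>E1. edge_expectation r (F - F1) (\<lambda>E2. h E1))"
  proof (intro edge_expectation_cong)
    fix E1 E2 assume *: "E1 \<subseteq> F1" "E2 \<subseteq> F - F1"
    then have "h (E1 \<union> E2) = h ((E1 \<union> E2) \<inter> F1)"
      using assms(2) by (intro h) auto
    also have "(E1 \<union> E2) \<inter> F1 = E1" using * by auto
    finally show "h (E1 \<union> E2) = h E1" .
  qed
  also have "\<dots> = edge_expectation r F1 h"
    using assms(1) by (intro edge_expectation_cong edge_expectation_const r) auto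
  finally show ?thesis using assms(2) by (simp add: Un_absorb1)
qed

text \<open>Independence: once the expectation is restricted to \<open>F1 \<union> F2\<close>, the
  inner expectation over \<open>F2\<close> does not see \<open>h1\<close>, so the iterated
  expectation factorises.\<close>

lemma edge_expectation_mult:
  assumes "finite F" "F1 \<subseteq> F" "F2 \<subseteq> F" "F1 \<inter> F2 = {}" and r: "\<And>e. 0 \<le> r e \<and> r e \<le> 1"
    and h1: "\<And>E. E \<subseteq> F \<Longrightarrow> h1 E = h1 (E \<inter> F1)" and h2: "\<And>E. E \<subseteq> F \<Longrightarrow> h2 E = h2 (E \<inter> F2)"
  shows "edge_expectation r F (\<lambda>E. h1 E * h2 E) = edge_expectation r F h1 * edge_expectation r F h2"
proof -
  have fin: "finite F1" "finite F2" using assms(1-3) by (auto intro: finite_subset)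
  have i1: "h1 (E1 \<union> E2) = h1 E1" if "E1 \<subseteq> F1" "E2 \<subseteq> F2" for E1 E2
  proof -
    have "h1 (E1 \<union> E2) = h1 ((E1 \<union> E2) \<inter> F1)"
      using assms that by (intro h1) auto
    also have "(E1 \<union> E2) \<inter> F1 = E1" using that assms by auto
    finally show ?thesis .
  qed
  have i2: "h2 (E1 \<union> E2) = h2 E2" if "E1 \<subseteq> F1" "E2 \<subseteq> F2" for E1 E2
  proof -
    have "h2 (E1 \<union> E2) = h2 ((E1 \<union> E2) \<inter> F2)"
      using assms that by (intro h2) auto
    also have "(E1 \<union> E2) \<inter> F2 = E2" using that assms by auto
    finally show ?thesis .
  qed
  have "edge_expectation r F (\<lambda>E. h1 E * h2 E) = edge_expectation r (F1 \<union> F2) (\<lambda>E. h1 E * h2 E)"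
  proof (intro edge_expectation_restrict assms(1) r)
    show "F1 \<union> F2 \<subseteq> F" using assms by auto
    fix E assume E: "E \<subseteq> F"
    have "h1 E = h1 (E \<inter> (F1 \<union> F2))"
    proof -
      have "E \<inter> (F1 \<union> F2) \<inter> F1 = E \<inter> F1" by auto
      then show ?thesis using h1[OF E] h1[of "E \<inter> (F1 \<union> F2)"] E by (metis le_infI1)
    qed
    moreover have "h2 E = h2 (E \<inter> (F1 \<union> F2))"
    proof -
      have "E \<inter> (F1 \<union> F2) \<inter> F2 = E \<inter> F2" by auto
      then show ?thesis using h2[OF E] h2[of "E \<inter> (F1 \<union> F2)"] E by (metis le_infI1)
    qed
    ultimately show "h1 E * h2 E = h1 (E \<inter> (F1 \<union> F2)) * h2 (E \<inter> (F1 \<union> F2))" by simp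
  qed
  also have "\<dots> = edge_expectation r F1 (\<lambda>E1. edge_expectation r F2 (\<lambda>E2. h1 (E1 \<union> E2) * h2 (E1 \<union> E2)))"
    using assms fin by (intro edge_expectation_union) auto
  also have "\<dots> = edge_expectation r F1 (\<lambda>E1. h1 E1 * edge_expectation r F2 h2)"
    by (intro edge_expectation_cong) (auto simp: edge_expectation_cmult[symmetric] i1 i2 intro!: edge_expectation_cong)
  also have "\<dots> = edge_expectation r F1 h1 * edge_expectation r F2 h2"
    using edge_expectation_cmult[of r F1 "edge_expectation r F2 h2" h1] by (simp add: mult.commute)
  also have "edge_expectation r F1 h1 = edge_expectation r F h1"
    using assms by (intro edge_expectation_restrict[symmetric]) auto
  also have "edge_expectation r F2 h2 = edge_expectation r F h2"
    using assms by (intro edge_expectation_restrict[symmetric]) auto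
  finally show ?thesis .
qed

lemma edge_expectation_edge:
  assumes "finite F" "e \<in> F" and r: "\<And>e. 0 \<le> r e \<and> r e \<le> 1"
  shows "edge_expectation r F (\<lambda>E. of_bool (e \<in> E)) = r e"
proof -
  have "Pow {e} = {{}, {e}}" by auto
  then have "edge_expectation r {e} (\<lambda>E. of_bool (e \<in> E)) = r e"
    by (simp add: edge_expectation_def edge_weight_def)
  moreover have "edge_expectation r F (\<lambda>E. of_bool (e \<in> E)) = edge_expectation r {e} (\<lambda>E. of_bool (e \<in> E))"
    using assms by (intro edge_expectation_restrict) auto
  ultimately show ?thesis by simp
qed

lemma edge_expectation_no_edges:
  assumes "finite F" "F1 \<subseteq> F" and r: "\<And>e. 0 \<le> r e \<and> r e \<le> 1"
  shows "edge_expectation r F (\<lambda>E. of_bool (E \<inter> F1 = {})) = ennreal (\<Prod>e\<in>F1. 1 - r e)"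
proof -
  have fin: "finite F1" using assms finite_subset by auto
  have "edge_expectation r F (\<lambda>E. of_bool (E \<inter> F1 = {})) = edge_expectation r F1 (\<lambda>E. of_bool (E \<inter> F1 = {}))"
    using assms by (intro edge_expectation_restrict) auto
  also have "\<dots> = (\<Sum>E\<in>Pow F1. if E = {} then ennreal (edge_weight r F1 E) else 0)"
    unfolding edge_expectation_def by (intro sum.cong) auto
  also have "\<dots> = ennreal (\<Prod>e\<in>F1. 1 - r e)"
    using fin by (simp add: sum.delta edge_weight_def)
  finally show ?thesis .
qed

section \<open>Clusters determined by a set of edges\<close>

abbreviation edge_cluster :: "'v set \<Rightarrow> 'v set set \<Rightarrow> 'v \<Rightarrow> 'v set" where
  "edge_cluster S E \<equiv> cluster S (\<lambda>e. e \<in> E)"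

lemma vertex_pairs_mono: "S \<subseteq> T \<Longrightarrow> vertex_pairs S \<subseteq> vertex_pairs T"
  unfolding vertex_pairs_def by blast

lemma vertex_pairs_subset_Pow: "vertex_pairs S \<subseteq> Pow S"
  unfolding vertex_pairs_def by auto

lemma finite_vertex_pairs: "finite S \<Longrightarrow> finite (vertex_pairs S)"
  using vertex_pairs_subset_Pow by (metis finite_Pow_iff finite_subset)

lemma cluster_subset: "cluster S c x \<subseteq> S"
  unfolding cluster_def by auto

lemma cluster_self: "x \<in> S \<Longrightarrow> x \<in> cluster S c x"
  unfolding cluster_def by auto

lemma cluster_step:
  "u \<in> cluster S c x \<Longrightarrow> v \<in> S \<Longrightarrow> u \<noteq> v \<Longrightarrow> c {u, v} \<Longrightarrow> v \<in> cluster S c x"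
  unfolding cluster_def by (auto intro: rtranclp.rtrancl_into_rtrancl)

text \<open>The induction principle for clusters: it replaces explicit paths by sets that are closed
  under the edges.\<close>

lemma cluster_least:
  assumes "x \<in> T" and step: "\<And>u v. u \<in> T \<Longrightarrow> u \<in> S \<Longrightarrow> v \<in> S \<Longrightarrow> u \<noteq> v \<Longrightarrow> c {u, v} \<Longrightarrow> v \<in> T"
  shows "cluster S c x \<subseteq> T"
proof
  fix y assume "y \<in> cluster S c x"
  then have "(\<lambda>u v. u \<in> S \<and> v \<in> S \<and> u \<noteq> v \<and> c {u, v})\<^sup>*\<^sup>* x y" by (simp add: cluster_def)
  then show "y \<in> T" by induction (use assms in auto)
qed

lemma cluster_mono:
  assumes "S \<subseteq> T"
  shows "cluster S c x \<subseteq> cluster T c x"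
proof
  fix y assume y: "y \<in> cluster S c x"
  have "(\<lambda>u v. u \<in> T \<and> v \<in> T \<and> u \<noteq> v \<and> c {u, v})\<^sup>*\<^sup>* x y"
    by (rule rtranclp_mono[THEN predicate2D, of "\<lambda>u v. u \<in> S \<and> v \<in> S \<and> u \<noteq> v \<and> c {u, v}"])
      (use y assms in \<open>auto simp: cluster_def\<close>)
  then show "y \<in> cluster T c x" using y assms by (auto simp: cluster_def)
qed

lemma cluster_cong:
  assumes "\<And>e. e \<in> vertex_pairs S \<Longrightarrow> c e = c' e"
  shows "cluster S c x = cluster S c' x"
proof -
  have "(\<lambda>u v. u \<in> S \<and> v \<in> S \<and> u \<noteq> v \<and> c {u, v}) = (\<lambda>u v. u \<in> S \<and> v \<in> S \<and> u \<noteq> v \<and> c' {u, v})"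
    using assms by (auto simp: fun_eq_iff vertex_pairs_def)
  then show ?thesis unfolding cluster_def by simp
qed

lemma edge_cluster_Int:
  "vertex_pairs S \<subseteq> F \<Longrightarrow> cluster S (\<lambda>e. e \<in> E \<and> e \<in> F) x = edge_cluster S E x"
  by (intro cluster_cong) auto

definition crossing_pairs :: "'v set \<Rightarrow> 'v set \<Rightarrow> 'v set set" where
  "crossing_pairs A R = {{a, b} | a b. a \<in> A \<and> b \<in> R}"

text \<open>The two events on the right concern disjoint sets of edges, which are also disjoint from the
  edges inside \<open>R\<close>.\<close>

lemma edge_cluster_eq_iff:
  assumes "x \<in> B" "B \<inter> R = {}"
  shows "edge_cluster (B \<union> R) E x = B \<longleftrightarrow> edge_cluster B E x = B \<and> E \<inter> crossing_pairs B R = {}"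
proof safe
  assume *: "edge_cluster (B \<union> R) E x = B"
  have "B \<subseteq> edge_cluster B E x"
  proof -
    have "edge_cluster (B \<union> R) E x \<subseteq> edge_cluster B E x"
    proof (rule cluster_least)
      fix u v assume u: "u \<in> edge_cluster B E x" and v: "v \<in> B \<union> R" "u \<noteq> v" "{u, v} \<in> E"
      then have "u \<in> edge_cluster (B \<union> R) E x" using cluster_mono[of B "B \<union> R"] by auto
      then have "v \<in> B" using * v cluster_step by fastforce
      then show "v \<in> edge_cluster B E x" using u v cluster_step by fastforce
    next
      show "x \<in> edge_cluster B E x" using assms by (intro cluster_self)
    qed
    then show ?thesis using * by simp
  qed
  then show "v \<in> edge_cluster B E x" if "v \<in> B" for v using that by auto
  show "v \<in> B" if "v \<in> edge_cluster B E x" for v using that cluster_subset by fastforce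
  fix e assume e: "e \<in> E" "e \<in> crossing_pairs B R"
  then obtain a b where "a \<in> B" "b \<in> R" "e = {a, b}" by (auto simp: crossing_pairs_def)
  then have "b \<in> B" using * e assms cluster_step[of a "B \<union> R" "\<lambda>e. e \<in> E" x b] by auto
  then show "e \<in> {}" using \<open>b \<in> R\<close> assms by auto
next
  assume *: "edge_cluster B E x = B" "E \<inter> crossing_pairs B R = {}"
  have "edge_cluster (B \<union> R) E x \<subseteq> B"
    by (rule cluster_least) (use * assms in \<open>auto simp: crossing_pairs_def\<close>)
  then show "v \<in> B" if "v \<in> edge_cluster (B \<union> R) E x" for v using that by auto
  show "v \<in> edge_cluster (B \<union> R) E x" if "v \<in> B" for v
    using that * cluster_mono[of B "B \<union> R"] by fastforce
qed

text \<open>After its last visit to \<open>B\<close>, a path from \<open>x\<close> continues with some \<open>z \<in> Z\<close>, since no edge joins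
  \<open>B\<close> to \<open>R\<close>.\<close>

lemma edge_cluster_exploration:
  assumes "x \<in> B" "edge_cluster (B \<union> R) E x = B" "B \<inter> R = {}"
  shows "edge_cluster (B \<union> R \<union> Z) E x \<subseteq>
    B \<union> (\<Union>z\<in>{z\<in>Z. \<exists>y\<in>B. {y, z} \<in> E}. edge_cluster (R \<union> Z) E z)"
proof (rule cluster_least)
  fix u v
  assume u: "u \<in> B \<union> (\<Union>z\<in>{z\<in>Z. \<exists>y\<in>B. {y, z} \<in> E}. edge_cluster (R \<union> Z) E z)"
    and v: "v \<in> B \<union> R \<union> Z" "u \<noteq> v" "{u, v} \<in> E"
  show "v \<in> B \<union> (\<Union>z\<in>{z\<in>Z. \<exists>y\<in>B. {y, z} \<in> E}. edge_cluster (R \<union> Z) E z)"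
  proof (cases "u \<in> B")
    case True
    show ?thesis
    proof (cases "v \<in> Z")
      case True
      then show ?thesis using \<open>u \<in> B\<close> v cluster_self[of v "R \<union> Z"] by auto
    next
      case False
      then have "v \<in> edge_cluster (B \<union> R) E x"
        using v True assms(2) cluster_step[of u "B \<union> R" "\<lambda>e. e \<in> E" x v] by auto
      then show ?thesis using assms by auto
    qed
  next
    case False
    then obtain z where z: "z \<in> Z" "\<exists>y\<in>B. {y, z} \<in> E" "u \<in> edge_cluster (R \<union> Z) E z"
      using u by auto
    show ?thesis
    proof (cases "v \<in> B")
      case False
      then have "v \<in> edge_cluster (R \<union> Z) E z" using v z cluster_step by fastforce
      then show ?thesis using z by auto
    qed auto
  qed
qed (use assms in auto)

section \<open>Finite random graphs with a symmetric connection kernel\<close>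

locale edge_kernel =
  fixes \<phi> :: "'v \<Rightarrow> 'v \<Rightarrow> real"
  assumes kernel_sym: "\<phi> x y = \<phi> y x"
    and kernel_nonneg: "0 \<le> \<phi> x y" and kernel_le_1: "\<phi> x y \<le> 1"
begin

lemma edge_probability_eq: "edge_probability \<phi> {x, y} = \<phi> x y"
  unfolding edge_probability_def
  by (rule the_equality) (use kernel_sym in \<open>auto simp: doubleton_eq_iff\<close>)

text \<open>\<^const>\<open>edge_probability\<close> is unspecified on sets that are not pairs, hence the truncation.\<close>

definition pair_prob :: "'v set \<Rightarrow> real" where
  "pair_prob e = max 0 (min 1 (edge_probability \<phi> e))"

lemma pair_prob_bounds: "0 \<le> pair_prob e \<and> pair_prob e \<le> 1"
  unfolding pair_prob_def by auto

lemma pair_prob_eq [simp]: "pair_prob {x, y} = \<phi> x y"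
  unfolding pair_prob_def using edge_probability_eq kernel_nonneg kernel_le_1 by auto

text \<open>The common form of mean cluster sizes and connection probabilities, for which invariance under
  relabelling and measurability are proved once.\<close>

definition cluster_mean :: "(nat \<Rightarrow> nat \<Rightarrow> ennreal) \<Rightarrow> 'v set \<Rightarrow> 'v \<Rightarrow> ennreal" where
  "cluster_mean \<psi> S x =
     edge_expectation pair_prob (vertex_pairs S) (\<lambda>E. \<psi> (card S) (card (edge_cluster S E x)))"

definition mean_size :: "'v set \<Rightarrow> 'v \<Rightarrow> ennreal" where
  "mean_size = cluster_mean (\<lambda>n k. of_nat k)"

text \<open>The probability that the graph on a finite \<open>S\<close> containing \<open>x\<close>
  is connected: the cluster of \<open>x\<close> has \<open>card S\<close> elements only if it is all
  of \<open>S\<close>. Stated with cardinalities to fit \<open>cluster_mean\<close>.\<close>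

definition conn_prob :: "'v set \<Rightarrow> 'v \<Rightarrow> ennreal" where
  "conn_prob = cluster_mean (\<lambda>n k. of_bool (k = n))"

text \<open>The probability that \<open>z\<close> is adjacent to no vertex of the finite set
  \<open>B\<close>.\<close>

definition isolation :: "'v set \<Rightarrow> 'v \<Rightarrow> ennreal" where
  "isolation B z = (\<Prod>y\<in>B. ennreal (1 - \<phi> y z))"

lemma isolation_le_1: "isolation B z \<le> 1"
  unfolding isolation_def using kernel_nonneg kernel_le_1
  by (intro prod_le_1) (auto simp: ennreal_le_1)

lemma mean_size_eq:
  "mean_size S x =
    edge_expectation pair_prob (vertex_pairs S) (\<lambda>E. of_nat (card (edge_cluster S E x)))"
  by (simp add: mean_size_def cluster_mean_def)

text \<open>Clusters of subgraphs are placed on the edges of the larger set \<open>T\<close>, so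
  that mean sizes can be compared pointwise in \<open>E\<close>.\<close>

lemma mean_size_superset:
  assumes "finite T" "S \<subseteq> T"
  shows "mean_size S x =
    edge_expectation pair_prob (vertex_pairs T) (\<lambda>E. of_nat (card (edge_cluster S E x)))"
  unfolding mean_size_eq
  by (rule edge_expectation_restrict[symmetric])
    (auto simp: finite_vertex_pairs assms vertex_pairs_mono pair_prob_bounds edge_cluster_Int)

lemma mean_size_mono:
  assumes "finite T" "S \<subseteq> T"
  shows "mean_size S x \<le> mean_size T x"
  unfolding mean_size_superset[OF assms] mean_size_superset[OF assms(1) order.refl]
  by (intro edge_expectation_mono of_nat_mono card_mono cluster_mono assms
      finite_subset[OF cluster_subset])

lemma mean_size_le_card:
  assumes "finite S"
  shows "mean_size S x \<le> of_nat (card S)"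
proof -
  have "mean_size S x \<le> edge_expectation pair_prob (vertex_pairs S) (\<lambda>E. of_nat (card S))"
    unfolding mean_size_eq by (intro edge_expectation_mono of_nat_mono card_mono cluster_subset assms)
  then show ?thesis
    by (simp add: edge_expectation_const finite_vertex_pairs assms pair_prob_bounds)
qed

lemma mean_size_ge_1:
  assumes "finite S" "x \<in> S"
  shows "1 \<le> mean_size S x"
proof -
  have "1 \<le> (of_nat (card (edge_cluster S E x)) :: ennreal)" for E
  proof -
    have "card {x} \<le> card (edge_cluster S E x)"
      using assms cluster_self by (intro card_mono finite_subset[OF cluster_subset]) auto
    then show ?thesis using of_nat_mono[of 1 "card (edge_cluster S E x)"] by simp
  qed
  then have "edge_expectation pair_prob (vertex_pairs S) (\<lambda>E. 1) \<le> mean_size S x"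
    unfolding mean_size_eq by (intro edge_expectation_mono)
  then show ?thesis
    by (simp add: edge_expectation_const finite_vertex_pairs assms pair_prob_bounds)
qed

lemma conn_prob_superset:
  assumes "finite T" "B \<subseteq> T"
  shows "conn_prob B x = edge_expectation pair_prob (vertex_pairs T) (\<lambda>E. of_bool (edge_cluster B E x = B))"
proof -
  have fin: "finite B" using assms finite_subset by auto
  have "card (edge_cluster B E x) = card B \<longleftrightarrow> edge_cluster B E x = B" for E
    using card_subset_eq[OF fin cluster_subset] by auto
  then have "conn_prob B x = edge_expectation pair_prob (vertex_pairs B) (\<lambda>E. of_bool (edge_cluster B E x = B))"
    by (simp add: conn_prob_def cluster_mean_def)
  also have "\<dots> = edge_expectation pair_prob (vertex_pairs T) (\<lambda>E. of_bool (edge_cluster B E x = B))"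
    by (rule edge_expectation_restrict[symmetric])
      (auto simp: finite_vertex_pairs assms vertex_pairs_mono pair_prob_bounds edge_cluster_Int)
  finally show ?thesis .
qed

lemma prod_crossing_pairs:
  assumes "finite B" "finite R" "B \<inter> R = {}"
  shows "ennreal (\<Prod>e\<in>crossing_pairs B R. 1 - pair_prob e) = (\<Prod>z\<in>R. isolation B z)"
proof -
  have inj: "bij_betw (\<lambda>(z, y). {y, z}) (R \<times> B) (crossing_pairs B R)"
    unfolding bij_betw_def inj_on_def crossing_pairs_def using assms(3)
    by (auto simp: doubleton_eq_iff image_iff)
  have "(\<Prod>e\<in>crossing_pairs B R. 1 - pair_prob e) = (\<Prod>(z, y)\<in>R \<times> B. 1 - \<phi> y z)"
    by (subst prod.reindex_bij_betw[OF inj, symmetric]) (auto intro!: prod.cong)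
  also have "\<dots> = (\<Prod>z\<in>R. \<Prod>y\<in>B. 1 - \<phi> y z)"
    by (simp add: prod.cartesian_product)
  finally show ?thesis
    unfolding isolation_def using kernel_le_1
    by (simp add: prod_ennreal prod_nonneg)
qed

text \<open>The event says that \<open>B\<close> is connected by its own edges and that no edge
  joins it to \<open>R\<close>. These two sets of edges are disjoint, hence the product.\<close>

lemma edge_expectation_cluster_eq:
  assumes "finite B" "finite R" "B \<inter> R = {}" "x \<in> B" "finite T" "B \<union> R \<subseteq> T"
  shows "edge_expectation pair_prob (vertex_pairs T) (\<lambda>E. of_bool (edge_cluster (B \<union> R) E x = B))
    = conn_prob B x * (\<Prod>z\<in>R. isolation B z)"
proof -
  have c: "crossing_pairs B R \<subseteq> vertex_pairs T"
    using assms unfolding crossing_pairs_def vertex_pairs_def by blast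
  have d: "vertex_pairs B \<inter> crossing_pairs B R = {}"
    using assms unfolding crossing_pairs_def vertex_pairs_def by (auto simp: doubleton_eq_iff)
  have "edge_expectation pair_prob (vertex_pairs T) (\<lambda>E. of_bool (edge_cluster (B \<union> R) E x = B))
    = edge_expectation pair_prob (vertex_pairs T)
        (\<lambda>E. of_bool (edge_cluster B E x = B) * of_bool (E \<inter> crossing_pairs B R = {}))"
    by (simp add: edge_cluster_eq_iff assms of_bool_conj)
  also have "\<dots> = edge_expectation pair_prob (vertex_pairs T) (\<lambda>E. of_bool (edge_cluster B E x = B)) *
      edge_expectation pair_prob (vertex_pairs T) (\<lambda>E. of_bool (E \<inter> crossing_pairs B R = {}))"
    by (rule edge_expectation_mult[OF _ _ c d])
      (use assms in \<open>auto simp: finite_vertex_pairs vertex_pairs_mono pair_prob_bounds edge_cluster_Int\<close>)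
  also have "edge_expectation pair_prob (vertex_pairs T) (\<lambda>E. of_bool (edge_cluster B E x = B)) = conn_prob B x"
    using assms by (intro conn_prob_superset[symmetric]) auto
  also have "edge_expectation pair_prob (vertex_pairs T) (\<lambda>E. of_bool (E \<inter> crossing_pairs B R = {}))
      = (\<Prod>z\<in>R. isolation B z)"
    using assms c by (simp add: edge_expectation_no_edges finite_vertex_pairs pair_prob_bounds prod_crossing_pairs)
  finally show ?thesis .
qed

text \<open>Three independent pieces of information: the edges inside \<open>B\<close> and between
  \<open>B\<close> and \<open>R\<close> decide the explored cluster, the pair \<open>{y, z}\<close>
  is a single edge between \<open>B\<close> and \<open>Z\<close>, and the second cluster uses only
  edges inside \<open>R \<union> Z\<close>.\<close>

lemma edge_expectation_exploration:
  assumes "finite B" "finite R" "finite Z" "B \<inter> R = {}" "B \<inter> Z = {}" "R \<inter> Z = {}" "x \<in> B"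
    and "y \<in> B" "z \<in> Z"
  shows "edge_expectation pair_prob (vertex_pairs (B \<union> R \<union> Z))
      (\<lambda>E. of_bool (edge_cluster (B \<union> R) E x = B) * (of_bool ({y, z} \<in> E) * of_nat (card (edge_cluster (R \<union> Z) E z))))
    = conn_prob B x * (\<Prod>z\<in>R. isolation B z) * (ennreal (\<phi> y z) * mean_size (R \<union> Z) z)"
proof -
  let ?T = "B \<union> R \<union> Z"
  let ?X = "edge_expectation pair_prob (vertex_pairs ?T)"
  have finT: "finite ?T" using assms by auto
  have d1: "{{y, z}} \<inter> vertex_pairs (R \<union> Z) = {}"
    using assms unfolding vertex_pairs_def by (auto simp: doubleton_eq_iff)
  have yz: "{y, z} \<in> vertex_pairs ?T"
    using assms unfolding vertex_pairs_def by blast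
  have c: "crossing_pairs B R \<subseteq> vertex_pairs ?T"
    using assms unfolding crossing_pairs_def vertex_pairs_def by blast
  have d2: "(vertex_pairs B \<union> crossing_pairs B R) \<inter> ({{y, z}} \<union> vertex_pairs (R \<union> Z)) = {}"
    using assms unfolding vertex_pairs_def crossing_pairs_def by (auto simp: doubleton_eq_iff)
  have B: "vertex_pairs B \<subseteq> vertex_pairs ?T" and RZ: "vertex_pairs (R \<union> Z) \<subseteq> vertex_pairs ?T"
    by (intro vertex_pairs_mono; auto)+
  have "?X (\<lambda>E. of_bool ({y, z} \<in> E) * of_nat (card (edge_cluster (R \<union> Z) E z)))
      = ?X (\<lambda>E. of_bool ({y, z} \<in> E)) * ?X (\<lambda>E. of_nat (card (edge_cluster (R \<union> Z) E z)))"
    by (rule edge_expectation_mult[OF _ _ _ d1])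
      (use yz RZ finT in \<open>auto simp: finite_vertex_pairs pair_prob_bounds edge_cluster_Int\<close>)
  also have "?X (\<lambda>E. of_nat (card (edge_cluster (R \<union> Z) E z))) = mean_size (R \<union> Z) z"
    using finT by (intro mean_size_superset[symmetric]) auto
  also have "?X (\<lambda>E. of_bool ({y, z} \<in> E)) = ennreal (\<phi> y z)"
    using yz finT by (subst edge_expectation_edge) (auto simp: finite_vertex_pairs pair_prob_bounds)
  finally have 1: "?X (\<lambda>E. of_bool ({y, z} \<in> E) * of_nat (card (edge_cluster (R \<union> Z) E z)))
      = ennreal (\<phi> y z) * mean_size (R \<union> Z) z" .
  have "?X (\<lambda>E. of_bool (edge_cluster (B \<union> R) E x = B) *
        (of_bool ({y, z} \<in> E) * of_nat (card (edge_cluster (R \<union> Z) E z))))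
    = ?X (\<lambda>E. of_bool (edge_cluster (B \<union> R) E x = B)) *
      ?X (\<lambda>E. of_bool ({y, z} \<in> E) * of_nat (card (edge_cluster (R \<union> Z) E z)))"
  proof (rule edge_expectation_mult[OF _ _ _ d2])
    fix E
    have "edge_cluster B (E \<inter> (vertex_pairs B \<union> crossing_pairs B R)) x = edge_cluster B E x"
      by (intro cluster_cong) auto
    then show "of_bool (edge_cluster (B \<union> R) E x = B) =
      (of_bool (edge_cluster (B \<union> R) (E \<inter> (vertex_pairs B \<union> crossing_pairs B R)) x = B) :: ennreal)"
      unfolding edge_cluster_eq_iff[OF \<open>x \<in> B\<close> \<open>B \<inter> R = {}\<close>] by (simp add: Int_assoc Int_absorb1)
    have "edge_cluster (R \<union> Z) (E \<inter> ({{y, z}} \<union> vertex_pairs (R \<union> Z))) z = edge_cluster (R \<union> Z) E z"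
      by (intro cluster_cong) auto
    then show "of_bool ({y, z} \<in> E) * of_nat (card (edge_cluster (R \<union> Z) E z)) =
        (of_bool ({y, z} \<in> E \<inter> ({{y, z}} \<union> vertex_pairs (R \<union> Z))) *
         of_nat (card (edge_cluster (R \<union> Z) (E \<inter> ({{y, z}} \<union> vertex_pairs (R \<union> Z))) z)) :: ennreal)"
      by simp
  qed (use yz RZ B c finT in \<open>auto simp: finite_vertex_pairs pair_prob_bounds\<close>)
  then show ?thesis
    using assms finT 1 by (simp add: edge_expectation_cluster_eq)
qed

text \<open>Exactly one \<open>A\<close> contributes, the cluster of \<open>x\<close> with the root
  removed; the sum is a case distinction over the explored cluster. The vertex set is written as
  \<open>insert x A \<union> (V - A)\<close> to match the factorisation lemmas.\<close>

lemma sum_cluster_indicator: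
  assumes "finite V" "x \<notin> V"
  shows "(\<Sum>A\<in>Pow V. of_bool (edge_cluster (insert x A \<union> (V - A)) E x = insert x A) * f A)
    = (f (edge_cluster (insert x V) E x - {x}) :: ennreal)"
proof -
  let ?C = "edge_cluster (insert x V) E x"
  have "(\<Sum>A\<in>Pow V. of_bool (edge_cluster (insert x A \<union> (V - A)) E x = insert x A) * f A) =
      (\<Sum>A\<in>Pow V. if A = ?C - {x} then f A else 0)"
  proof (intro sum.cong refl)
    fix A assume A: "A \<in> Pow V"
    then have "insert x A \<union> (V - A) = insert x V" by auto
    moreover have "?C = insert x A \<longleftrightarrow> A = ?C - {x}"
      using A assms cluster_self[of x "insert x V"] by auto
    ultimately show "of_bool (edge_cluster (insert x A \<union> (V - A)) E x = insert x A) * f A =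
        (if A = ?C - {x} then f A else 0)" by simp
  qed
  also have "\<dots> = f (?C - {x})"
    using assms cluster_subset[of "insert x V" "\<lambda>e. e \<in> E" x] by (subst sum.delta) auto
  finally show ?thesis .
qed

lemma card_cluster_Diff:
  assumes "finite V"
  shows "1 + of_nat (card (edge_cluster (insert x V) E x - {x})) =
    (of_nat (card (edge_cluster (insert x V) E x)) :: ennreal)"
proof -
  have "card (edge_cluster (insert x V) E x) = Suc (card (edge_cluster (insert x V) E x - {x}))"
    using assms cluster_self[of x "insert x V"]
    by (intro card.remove finite_subset[OF cluster_subset]) auto
  then show ?thesis by simp
qed

text \<open>The case distinction of \<open>sum_cluster_indicator\<close> under the expectation. The
  weights agree with those in \<open>mean_size_exploration\<close>, so that weights times
  \<open>1 + card A\<close> fold back into a mean size without new points.\<close>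

lemma mean_size_decomposition:
  assumes "finite V" "x \<notin> V"
  shows "mean_size (insert x V) x =
    (\<Sum>A\<in>Pow V. conn_prob (insert x A) x * (\<Prod>r\<in>V - A. isolation (insert x A) r) * (1 + of_nat (card A)))"
proof -
  let ?X = "edge_expectation pair_prob (vertex_pairs (insert x V))"
  have "mean_size (insert x V) x = ?X (\<lambda>E. of_nat (card (edge_cluster (insert x V) E x)))"
    by (rule mean_size_eq)
  also have "\<dots> = ?X (\<lambda>E. \<Sum>A\<in>Pow V. of_bool (edge_cluster (insert x A \<union> (V - A)) E x = insert x A) * (1 + of_nat (card A)))"
    by (subst sum_cluster_indicator[OF assms]) (simp add: card_cluster_Diff assms)
  also have "\<dots> = (\<Sum>A\<in>Pow V. ?X (\<lambda>E. (1 + of_nat (card A)) * of_bool (edge_cluster (insert x A \<union> (V - A)) E x = insert x A)))"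
    unfolding edge_expectation_sum by (simp add: mult.commute)
  also have "\<dots> = (\<Sum>A\<in>Pow V. conn_prob (insert x A) x * (\<Prod>r\<in>V - A. isolation (insert x A) r) * (1 + of_nat (card A)))"
  proof (intro sum.cong refl)
    fix A assume A: "A \<in> Pow V"
    then have "?X (\<lambda>E. of_bool (edge_cluster (insert x A \<union> (V - A)) E x = insert x A)) =
        conn_prob (insert x A) x * (\<Prod>r\<in>V - A. isolation (insert x A) r)"
      using assms by (intro edge_expectation_cluster_eq) (auto intro: finite_subset)
    then show "?X (\<lambda>E. (1 + of_nat (card A)) * of_bool (edge_cluster (insert x A \<union> (V - A)) E x = insert x A)) =
       conn_prob (insert x A) x * (\<Prod>r\<in>V - A. isolation (insert x A) r) * (1 + of_nat (card A))"
      by (simp only: edge_expectation_cmult mult.commute)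
  qed
  finally show ?thesis .
qed

text \<open>Given the old cluster \<open>insert x A\<close>, every further vertex lies in the
  cluster of some new \<open>z\<close> adjacent to it, computed in the graph without
  \<open>insert x A\<close>. Summing over all pairs \<open>y\<close>, \<open>z\<close> counts a new
  point once per neighbour; this overcount leaves single edge indicators, which are independent of
  both clusters.\<close>

theorem mean_size_exploration:
  assumes "finite V" "finite Z" "x \<notin> V" "x \<notin> Z" "V \<inter> Z = {}"
  shows "mean_size (insert x (V \<union> Z)) x \<le>
    (\<Sum>A\<in>Pow V. conn_prob (insert x A) x * (\<Prod>r\<in>V - A. isolation (insert x A) r) *
       (1 + of_nat (card A) +
        (\<Sum>z\<in>Z. (\<Sum>y\<in>insert x A. ennreal (\<phi> y z)) * mean_size (V - A \<union> Z) z)))"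
proof -
  let ?U = "insert x (V \<union> Z)"
  let ?X = "edge_expectation pair_prob (vertex_pairs ?U)"
  let ?I = "\<lambda>A E. of_bool (edge_cluster (insert x A \<union> (V - A)) E x = insert x A) :: ennreal"
  let ?N = "\<lambda>A E z. of_nat (card (edge_cluster (V - A \<union> Z) E z)) :: ennreal"
  let ?W = "\<lambda>A E. (\<Sum>z\<in>Z. \<Sum>y\<in>insert x A. of_bool ({y, z} \<in> E) * ?N A E z)"
  have U: "?U = insert x A \<union> (V - A) \<union> Z" if "A \<subseteq> V" for A using that by auto
  have *: "of_nat (card (edge_cluster ?U E x)) \<le> (\<Sum>A\<in>Pow V. ?I A E * (1 + of_nat (card A) + ?W A E))" for E
  proof -
    define A where "A = edge_cluster (insert x V) E x - {x}"
    have A: "A \<subseteq> V" using cluster_subset[of "insert x V"] unfolding A_def by fastforce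
    have C: "edge_cluster (insert x V) E x = insert x A"
      using cluster_self[of x "insert x V"] unfolding A_def by auto
    have fA: "finite A" using A assms finite_subset by auto
    have xA: "x \<notin> A" using A assms by auto
    have eq: "insert x V = insert x A \<union> (V - A)" using A by auto
    let ?Z = "{z\<in>Z. \<exists>y\<in>insert x A. {y, z} \<in> E}"
    have "edge_cluster ?U E x \<subseteq> insert x A \<union> (\<Union>z\<in>?Z. edge_cluster (V - A \<union> Z) E z)"
      unfolding U[OF A] using assms C A unfolding eq by (intro edge_cluster_exploration) auto
    moreover have finC: "finite (edge_cluster (V - A \<union> Z) E z)" for z
      using assms by (intro finite_subset[OF cluster_subset]) auto
    ultimately have "card (edge_cluster ?U E x) \<le> card (insert x A \<union> (\<Union>z\<in>?Z. edge_cluster (V - A \<union> Z) E z))"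
      using fA assms by (intro card_mono) auto
    also have "\<dots> \<le> card (insert x A) + card (\<Union>z\<in>?Z. edge_cluster (V - A \<union> Z) E z)"
      by (rule card_Un_le)
    also have "\<dots> \<le> card (insert x A) + (\<Sum>z\<in>?Z. card (edge_cluster (V - A \<union> Z) E z))"
      using assms by (intro add_left_mono card_UN_le) auto
    finally have "(of_nat (card (edge_cluster ?U E x)) :: ennreal) \<le>
        of_nat (card (insert x A) + (\<Sum>z\<in>?Z. card (edge_cluster (V - A \<union> Z) E z)))"
      by (rule of_nat_mono)
    also have "\<dots> = 1 + of_nat (card A) + (\<Sum>z\<in>?Z. ?N A E z)"
      using fA xA by simp
    also have "(\<Sum>z\<in>?Z. ?N A E z) \<le> ?W A E"
    proof -
      have "(\<Sum>z\<in>?Z. ?N A E z) \<le> (\<Sum>z\<in>?Z. \<Sum>y\<in>insert x A. of_bool ({y, z} \<in> E) * ?N A E z)"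
      proof (intro sum_mono)
        fix z assume "z \<in> ?Z"
        then obtain y where "y \<in> insert x A" "{y, z} \<in> E" by auto
        then have "?N A E z = of_bool ({y, z} \<in> E) * ?N A E z" by simp
        also have "\<dots> \<le> (\<Sum>y\<in>insert x A. of_bool ({y, z} \<in> E) * ?N A E z)"
          using fA \<open>y \<in> insert x A\<close> member_le_sum[of y "insert x A" "\<lambda>y. of_bool ({y, z} \<in> E) * ?N A E z"] by simp
        finally show "?N A E z \<le> (\<Sum>y\<in>insert x A. of_bool ({y, z} \<in> E) * ?N A E z)" .
      qed
      also have "\<dots> \<le> ?W A E" using assms by (intro sum_mono2) auto
      finally show ?thesis .
    qed
    also have "1 + of_nat (card A) + ?W A E = (\<Sum>A\<in>Pow V. ?I A E * (1 + of_nat (card A) + ?W A E))"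
      using assms by (subst sum_cluster_indicator) (auto simp: A_def)
    finally show ?thesis by (simp add: add_left_mono)
  qed
  have "mean_size ?U x \<le> ?X (\<lambda>E. \<Sum>A\<in>Pow V. ?I A E * (1 + of_nat (card A) + ?W A E))"
    unfolding mean_size_eq by (intro edge_expectation_mono *)
  also have "\<dots> = (\<Sum>A\<in>Pow V. ?X (\<lambda>E. (1 + of_nat (card A)) * ?I A E) +
      (\<Sum>z\<in>Z. \<Sum>y\<in>insert x A. ?X (\<lambda>E. ?I A E * (of_bool ({y, z} \<in> E) * ?N A E z))))"
    unfolding edge_expectation_sum[symmetric] edge_expectation_add[symmetric]
    by (simp only: distrib_left sum_distrib_left mult.commute)
  also have "\<dots> = (\<Sum>A\<in>Pow V. conn_prob (insert x A) x * (\<Prod>r\<in>V - A. isolation (insert x A) r) *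
       (1 + of_nat (card A) +
        (\<Sum>z\<in>Z. (\<Sum>y\<in>insert x A. ennreal (\<phi> y z)) * mean_size (V - A \<union> Z) z)))"
  proof (intro sum.cong refl)
    fix A assume "A \<in> Pow V"
    then have A: "A \<subseteq> V" by simp
    then have fA: "finite A" using assms finite_subset by auto
    let ?q = "conn_prob (insert x A) x * (\<Prod>r\<in>V - A. isolation (insert x A) r)"
    have 1: "?X (?I A) = ?q"
      unfolding U[OF A] using assms A fA by (intro edge_expectation_cluster_eq) auto
    have "?X (\<lambda>E. ?I A E * (of_bool ({y, z} \<in> E) * ?N A E z)) = ?q * (ennreal (\<phi> y z) * mean_size (V - A \<union> Z) z)"
      if "y \<in> insert x A" "z \<in> Z" for y z
      unfolding U[OF A] using assms A fA that by (intro edge_expectation_exploration) auto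
    then have "(\<Sum>z\<in>Z. \<Sum>y\<in>insert x A. ?X (\<lambda>E. ?I A E * (of_bool ({y, z} \<in> E) * ?N A E z))) =
        (\<Sum>z\<in>Z. \<Sum>y\<in>insert x A. ?q * (ennreal (\<phi> y z) * mean_size (V - A \<union> Z) z))"
      by (intro sum.cong refl) auto
    also have "\<dots> = ?q * (\<Sum>z\<in>Z. (\<Sum>y\<in>insert x A. ennreal (\<phi> y z)) * mean_size (V - A \<union> Z) z)"
      by (simp only: sum_distrib_left sum_distrib_right)
    finally show "?X (\<lambda>E. (1 + of_nat (card A)) * ?I A E) +
        (\<Sum>z\<in>Z. \<Sum>y\<in>insert x A. ?X (\<lambda>E. ?I A E * (of_bool ({y, z} \<in> E) * ?N A E z))) =
        ?q * (1 + of_nat (card A) + (\<Sum>z\<in>Z. (\<Sum>y\<in>insert x A. ennreal (\<phi> y z)) * mean_size (V - A \<union> Z) z))"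
      by (simp only: edge_expectation_cmult 1 distrib_left mult.commute)
  qed
  finally show ?thesis .
qed

end

section \<open>Measurable finite random sets\<close>

text \<open>For a functional of such a set to be measurable it suffices that, for each fixed set of
  indices, it is measurable in the positions \<open>p i\<close>.\<close>

definition random_finite_set :: "'n measure \<Rightarrow> ('n \<Rightarrow> 'x::topological_space set) \<Rightarrow> bool" where
  "random_finite_set N S \<longleftrightarrow> (\<exists>p J. (\<forall>i::nat. p i \<in> borel_measurable N) \<and>
     (\<forall>i. Measurable.pred N (\<lambda>n. i \<in> J n)) \<and>
     (\<forall>n\<in>space N. finite (J n) \<and> inj_on (\<lambda>i. p i n) (J n) \<and> S n = (\<lambda>i. p i n) ` J n))"

text \<open>By second countability the product sigma-algebra contains the closed diagonal.\<close>

lemma pred_eq_borel [measurable (raw)]: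
  fixes f g :: "'n \<Rightarrow> 'x::{second_countable_topology, t2_space}"
  assumes [measurable]: "f \<in> borel_measurable N" "g \<in> borel_measurable N"
  shows "Measurable.pred N (\<lambda>n. f n = g n)"
proof -
  have "{y. \<exists>x::'x. y = (x, x)} \<in> sets (borel \<Otimes>\<^sub>M borel)"
    unfolding borel_prod using closed_diagonal by (rule borel_closed)
  then have "(\<lambda>n. (f n, g n)) -` {y. \<exists>x. y = (x, x)} \<inter> space N \<in> sets N"
    by (rule measurable_sets[rotated]) auto
  also have "(\<lambda>n. (f n, g n)) -` {y. \<exists>x. y = (x, x)} \<inter> space N = {n \<in> space N. f n = g n}" by auto
  finally show ?thesis by (simp add: pred_def)
qed

text \<open>Repetitions are allowed here: among the indices in \<open>J n\<close> with the same
  position only the least is kept, which leaves the set unchanged and makes the enumeration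
  injective.\<close>

lemma random_finite_setI:
  fixes p :: "nat \<Rightarrow> 'n \<Rightarrow> 'x::{second_countable_topology, t2_space}"
  assumes p [measurable]: "\<And>i. p i \<in> borel_measurable N"
    and J [measurable]: "\<And>i. Measurable.pred N (\<lambda>n. i \<in> J n)"
    and S: "\<And>n. n \<in> space N \<Longrightarrow> finite (J n) \<and> S n = (\<lambda>i. p i n) ` J n"
  shows "random_finite_set N S"
proof -
  define J' where "J' n = {i \<in> J n. \<forall>j<i. j \<in> J n \<longrightarrow> p j n \<noteq> p i n}" for n
  have "Measurable.pred N (\<lambda>n. i \<in> J' n)" for i
    unfolding J'_def by simp
  moreover have "finite (J' n)" if "n \<in> space N" for n
    using S[OF that] unfolding J'_def by auto
  moreover have "inj_on (\<lambda>i. p i n) (J' n)" for n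
    unfolding J'_def inj_on_def by (auto, metis linorder_neqE_nat)
  moreover have "S n = (\<lambda>i. p i n) ` J' n" if "n \<in> space N" for n
  proof -
    have "p i n \<in> (\<lambda>i. p i n) ` J' n" if i: "i \<in> J n" for i
    proof -
      define k where "k = (LEAST k. k \<in> J n \<and> p k n = p i n)"
      have k: "k \<in> J n \<and> p k n = p i n"
        unfolding k_def by (rule LeastI[of _ i]) (use i in auto)
      have "\<not> (j \<in> J n \<and> p j n = p i n)" if "j < k" for j
        using that unfolding k_def by (rule not_less_Least)
      then have "k \<in> J' n" unfolding J'_def using k by auto
      then show ?thesis using k by (metis image_eqI)
    qed
    then show ?thesis using S[OF that] unfolding J'_def by auto
  qed
  ultimately show ?thesis unfolding random_finite_set_def using p by blast
qed

text \<open>There are only countably many finite index sets, and \<open>J\<close> is a measurable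
  choice among them; so the measurable functions obtained for the fixed index sets can be
  glued.\<close>

lemma random_finite_set_measurable:
  fixes F :: "'n \<Rightarrow> 'x::{second_countable_topology, t2_space} set \<Rightarrow> ennreal"
  assumes S: "random_finite_set N S"
    and F: "\<And>p J. finite J \<Longrightarrow> (\<And>i::nat. p i \<in> borel_measurable N) \<Longrightarrow>
      \<exists>h\<in>borel_measurable N. \<forall>n\<in>space N.
         inj_on (\<lambda>i. p i n) J \<and> S n = (\<lambda>i. p i n) ` J \<longrightarrow> F n ((\<lambda>i. p i n) ` J) = h n"
  shows "(\<lambda>n. F n (S n)) \<in> borel_measurable N"
proof -
  obtain p and J :: "_ \<Rightarrow> nat set" where p: "\<And>i. p i \<in> borel_measurable N"
    and J [measurable]: "\<And>i. Measurable.pred N (\<lambda>n. i \<in> J n)"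
    and SJ: "\<And>n. n \<in> space N \<Longrightarrow> finite (J n) \<and> inj_on (\<lambda>i. p i n) (J n) \<and> S n = (\<lambda>i. p i n) ` J n"
    using S unfolding random_finite_set_def by blast
  have "\<forall>J\<in>Collect finite. \<exists>h\<in>borel_measurable N. \<forall>n\<in>space N.
      inj_on (\<lambda>i. p i n) J \<and> S n = (\<lambda>i. p i n) ` J \<longrightarrow> F n ((\<lambda>i. p i n) ` J) = h n"
  proof
    fix J :: "nat set" assume "J \<in> Collect finite"
    then show "\<exists>h\<in>borel_measurable N. \<forall>n\<in>space N.
        inj_on (\<lambda>i. p i n) J \<and> S n = (\<lambda>i. p i n) ` J \<longrightarrow> F n ((\<lambda>i. p i n) ` J) = h n"
      using p by (intro F) auto
  qed
  from bchoice[OF this[unfolded Bex_def]] obtain h where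
    h0: "\<forall>J\<in>Collect finite. h J \<in> borel_measurable N \<and> (\<forall>n\<in>space N.
      inj_on (\<lambda>i. p i n) J \<and> S n = (\<lambda>i. p i n) ` J \<longrightarrow> F n ((\<lambda>i. p i n) ` J) = h J n)" ..
  then have h: "h J \<in> borel_measurable N" if "finite J" for J using that by simp
  have h': "F n (S n) = h (J n) n" if "n \<in> space N" for n
    using h0 SJ[OF that] that by simp
  have cnt: "countable (Collect finite :: nat set set)"
    using countable_Collect_finite by simp
  have Jm: "J \<in> measurable N (count_space (Collect finite))"
  proof (subst measurable_count_space_eq_countable[OF cnt], safe)
    show "finite (J n)" if "n \<in> space N" for n using SJ that by auto
    fix X :: "nat set"
    have "J -` {X} \<inter> space N = {n \<in> space N. \<forall>i. i \<in> J n \<longleftrightarrow> i \<in> X}" by auto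
    also have "\<dots> \<in> sets N" by simp
    finally show "J -` {X} \<inter> space N \<in> sets N" .
  qed
  have "(\<lambda>n. h (J n) n) \<in> borel_measurable N"
    by (rule measurable_compose_countable'[OF _ Jm cnt]) (use h in auto)
  also have "?this \<longleftrightarrow> ?thesis"
    by (intro measurable_cong) (simp add: h')
  finally show ?thesis .
qed

lemma random_finite_set_compose:
  assumes "random_finite_set N S" "f \<in> measurable M N"
  shows "random_finite_set M (\<lambda>m. S (f m))"
proof -
  obtain p and J :: "_ \<Rightarrow> nat set" where p: "\<And>i. p i \<in> borel_measurable N"
    and J: "\<And>i. Measurable.pred N (\<lambda>n. i \<in> J n)"
    and SJ: "\<And>n. n \<in> space N \<Longrightarrow> finite (J n) \<and> inj_on (\<lambda>i. p i n) (J n) \<and> S n = (\<lambda>i. p i n) ` J n"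
    using assms(1) unfolding random_finite_set_def by blast
  show ?thesis
    unfolding random_finite_set_def
  proof (intro exI[of _ "\<lambda>i m. p i (f m)"] exI[of _ "\<lambda>m. J (f m)"] conjI allI ballI)
    show "(\<lambda>m. p i (f m)) \<in> borel_measurable M" for i by (rule measurable_compose[OF assms(2) p])
    show "Measurable.pred M (\<lambda>m. i \<in> J (f m))" for i by (rule measurable_compose[OF assms(2) J])
    fix m assume "m \<in> space M"
    then show "finite (J (f m))" "inj_on (\<lambda>i. p i (f m)) (J (f m))" "S (f m) = (\<lambda>i. p i (f m)) ` J (f m)"
      using SJ[OF measurable_space[OF assms(2)]] by blast+
  qed
qed

lemma random_finite_set_single:
  fixes f :: "'n \<Rightarrow> 'x::{second_countable_topology, t2_space}"
  assumes [measurable]: "f \<in> borel_measurable N"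
  shows "random_finite_set N (\<lambda>n. {f n})"
  by (rule random_finite_setI[where p = "\<lambda>_. f" and J = "\<lambda>_. {0}"]) auto

lemma random_finite_set_empty:
  "random_finite_set N (\<lambda>n. {} :: 'x::{second_countable_topology, t2_space} set)"
  by (rule random_finite_setI[where p = "\<lambda>_ _. undefined" and J = "\<lambda>_. {}"]) auto

lemma random_finite_set_union:
  fixes S T :: "'n \<Rightarrow> 'x::{second_countable_topology, t2_space} set"
  assumes "random_finite_set N S" "random_finite_set N T"
  shows "random_finite_set N (\<lambda>n. S n \<union> T n)"
proof -
  obtain p and J :: "_ \<Rightarrow> nat set" where p [measurable]: "\<And>i. p i \<in> borel_measurable N"
    and J [measurable]: "\<And>i. Measurable.pred N (\<lambda>n. i \<in> J n)"
    and SJ: "\<And>n. n \<in> space N \<Longrightarrow> finite (J n) \<and> inj_on (\<lambda>i. p i n) (J n) \<and> S n = (\<lambda>i. p i n) ` J n"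
    using assms(1) unfolding random_finite_set_def by blast
  obtain q and K :: "_ \<Rightarrow> nat set" where q [measurable]: "\<And>i. q i \<in> borel_measurable N"
    and K [measurable]: "\<And>i. Measurable.pred N (\<lambda>n. i \<in> K n)"
    and TK: "\<And>n. n \<in> space N \<Longrightarrow> finite (K n) \<and> inj_on (\<lambda>i. q i n) (K n) \<and> T n = (\<lambda>i. q i n) ` K n"
    using assms(2) unfolding random_finite_set_def by blast
  \<comment> \<open>Interleaving: even indices enumerate \<open>S\<close>, odd indices enumerate
    \<open>T\<close>. Common points are no problem for \<open>random_finite_setI\<close>.\<close>
  let ?p = "\<lambda>i. if even i then p (i div 2) else q (i div 2)"
  let ?J = "\<lambda>n. {i. if even i then i div 2 \<in> J n else i div 2 \<in> K n}"
  have J_eq: "?J n = (\<lambda>i. 2 * i) ` J n \<union> (\<lambda>i. Suc (2 * i)) ` K n" for n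
  proof (intro set_eqI)
    fix i show "i \<in> ?J n \<longleftrightarrow> i \<in> (\<lambda>i. 2 * i) ` J n \<union> (\<lambda>i. Suc (2 * i)) ` K n"
    proof (cases "even i")
      case True
      then obtain k where "i = 2 * k" by (rule evenE)
      then show ?thesis by auto presburger
    next
      case False
      then obtain k where "i = 2 * k + 1" by (rule oddE)
      then show ?thesis by auto presburger
    qed
  qed
  show ?thesis
  proof (rule random_finite_setI[where p = ?p and J = ?J])
    show "?p i \<in> borel_measurable N" for i by (cases "even i") auto
    show "Measurable.pred N (\<lambda>n. i \<in> ?J n)" for i by (cases "even i") auto
    fix n assume n: "n \<in> space N"
    show "finite (?J n) \<and> S n \<union> T n = (\<lambda>i. ?p i n) ` ?J n"
      unfolding J_eq using SJ[OF n] TK[OF n] by (auto simp: image_Un image_image)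
  qed
qed

lemma random_finite_set_insert:
  fixes f :: "'n \<Rightarrow> 'x::{second_countable_topology, t2_space}"
  assumes "f \<in> borel_measurable N" "random_finite_set N S"
  shows "random_finite_set N (\<lambda>n. insert (f n) (S n))"
  using random_finite_set_union[OF random_finite_set_single[OF assms(1)] assms(2)] by simp

lemma random_finite_set_sum:
  fixes f :: "'n \<Rightarrow> 'x::{second_countable_topology, t2_space} \<Rightarrow> ennreal"
  assumes "random_finite_set N S"
    and [measurable]: "(\<lambda>(n, x). f n x) \<in> borel_measurable (N \<Otimes>\<^sub>M borel)"
  shows "(\<lambda>n. \<Sum>x\<in>S n. f n x) \<in> borel_measurable N"
proof (rule random_finite_set_measurable[OF assms(1)])
  fix p :: "nat \<Rightarrow> 'n \<Rightarrow> 'x" and J :: "nat set"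
  assume p [measurable]: "\<And>i. p i \<in> borel_measurable N"
  show "\<exists>h\<in>borel_measurable N. \<forall>n\<in>space N. inj_on (\<lambda>i. p i n) J \<and> S n = (\<lambda>i. p i n) ` J \<longrightarrow>
      (\<Sum>x\<in>(\<lambda>i. p i n) ` J. f n x) = h n"
    by (rule bexI[of _ "\<lambda>n. \<Sum>i\<in>J. f n (p i n)"]) (auto simp: sum.reindex)
qed

lemma random_finite_set_prod:
  fixes f :: "'n \<Rightarrow> 'x::{second_countable_topology, t2_space} \<Rightarrow> ennreal"
  assumes "random_finite_set N S"
    and [measurable]: "(\<lambda>(n, x). f n x) \<in> borel_measurable (N \<Otimes>\<^sub>M borel)"
  shows "(\<lambda>n. \<Prod>x\<in>S n. f n x) \<in> borel_measurable N"
proof (rule random_finite_set_measurable[OF assms(1)])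
  fix p :: "nat \<Rightarrow> 'n \<Rightarrow> 'x" and J :: "nat set"
  assume p [measurable]: "\<And>i. p i \<in> borel_measurable N"
  show "\<exists>h\<in>borel_measurable N. \<forall>n\<in>space N. inj_on (\<lambda>i. p i n) J \<and> S n = (\<lambda>i. p i n) ` J \<longrightarrow>
      (\<Prod>x\<in>(\<lambda>i. p i n) ` J. f n x) = h n"
    by (rule bexI[of _ "\<lambda>n. \<Prod>i\<in>J. f n (p i n)"]) (auto simp: prod.reindex)
qed

lemma random_finite_set_card:
  fixes S :: "'n \<Rightarrow> 'x::{second_countable_topology, t2_space} set"
  assumes "random_finite_set N S"
  shows "(\<lambda>n. of_nat (card (S n)) :: ennreal) \<in> borel_measurable N"
  using random_finite_set_sum[OF assms, of "\<lambda>_ _. 1"] by simp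

section \<open>Relabelling of vertices\<close>

lemma cluster_image:
  assumes p: "inj_on p J" and i: "i \<in> J"
    and c: "\<And>a b. a \<in> J \<Longrightarrow> b \<in> J \<Longrightarrow> a \<noteq> b \<Longrightarrow> c' {p a, p b} = c {a, b}"
  shows "cluster (p ` J) c' (p i) = p ` cluster J c i"
proof
  show "cluster (p ` J) c' (p i) \<subseteq> p ` cluster J c i"
  proof (rule cluster_least)
    show "p i \<in> p ` cluster J c i" using cluster_self[OF i] by auto
    fix u v assume "u \<in> p ` cluster J c i" "v \<in> p ` J" "u \<noteq> v" "c' {u, v}"
    then obtain a b where ab: "a \<in> cluster J c i" "b \<in> J" "u = p a" "v = p b" by auto
    then have "a \<in> J" using cluster_subset by fastforce
    then have "b \<in> cluster J c i"
      using cluster_step[OF ab(1,2), of] c[of a b] ab \<open>u \<noteq> v\<close> \<open>c' {u, v}\<close> by auto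
    then show "v \<in> p ` cluster J c i" using ab by auto
  qed
  have "cluster J c i \<subseteq> {a \<in> J. p a \<in> cluster (p ` J) c' (p i)}"
  proof (rule cluster_least)
    show "i \<in> {a \<in> J. p a \<in> cluster (p ` J) c' (p i)}" using i cluster_self[of "p i"] by auto
    fix u v assume uv: "u \<in> {a \<in> J. p a \<in> cluster (p ` J) c' (p i)}" "v \<in> J" "u \<noteq> v" "c {u, v}"
    then have "p u \<noteq> p v" using p by (auto simp: inj_on_def)
    then show "v \<in> {a \<in> J. p a \<in> cluster (p ` J) c' (p i)}"
      using uv c[of u v] cluster_step[of "p u" "p ` J" c' "p i" "p v"] by auto
  qed
  then show "p ` cluster J c i \<subseteq> cluster (p ` J) c' (p i)" by auto
qed

text \<open>Pulling the kernel back along an enumeration \<open>p\<close> gives a graph on indices;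
  the positions then enter only through the kernel.\<close>

lemma (in edge_kernel) edge_kernel_compose: "edge_kernel (\<lambda>i j. \<phi> (p i) (p j))"
  by unfold_locales (use kernel_sym kernel_nonneg kernel_le_1 in auto)

text \<open>An injective \<open>p\<close> carries edge sets bijectively to edge sets and preserves
  their weights, the cluster cardinalities and the number of vertices, which are all that
  \<open>cluster_mean\<close> depends on.\<close>

lemma (in edge_kernel) cluster_mean_image:
  assumes p: "inj_on p J" and i: "i \<in> J"
  shows "cluster_mean \<psi> (p ` J) (p i) = edge_kernel.cluster_mean (\<lambda>i j. \<phi> (p i) (p j)) \<psi> J i"
proof -
  interpret P: edge_kernel "\<lambda>i j. \<phi> (p i) (p j)" by (rule edge_kernel_compose)
  have vp: "vertex_pairs (p ` J) = (`) p ` vertex_pairs J"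
  proof
    show "(`) p ` vertex_pairs J \<subseteq> vertex_pairs (p ` J)"
      using p unfolding vertex_pairs_def inj_on_def by blast
    show "vertex_pairs (p ` J) \<subseteq> (`) p ` vertex_pairs J"
    proof
      fix e assume "e \<in> vertex_pairs (p ` J)"
      then obtain a b where "a \<in> J" "b \<in> J" "p a \<noteq> p b" "e = p ` {a, b}"
        unfolding vertex_pairs_def by auto
      then show "e \<in> (`) p ` vertex_pairs J" unfolding vertex_pairs_def by blast
    qed
  qed
  have inj: "inj_on ((`) p) (vertex_pairs J)"
    using inj_on_image_Pow[OF p] vertex_pairs_subset_Pow by (rule inj_on_subset)
  have bij: "bij_betw ((`) ((`) p)) (Pow (vertex_pairs J)) (Pow (vertex_pairs (p ` J)))"
    unfolding vp by (rule bij_betw_Pow) (use inj in \<open>simp add: bij_betw_def\<close>)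
  have mem: "p ` e \<in> (`) p ` E \<longleftrightarrow> e \<in> E" if "e \<in> vertex_pairs J" "E \<subseteq> vertex_pairs J" for e E
    using inj that by (meson inj_on_image_mem_iff)
  have "edge_weight pair_prob (vertex_pairs (p ` J)) ((`) p ` E) = edge_weight P.pair_prob (vertex_pairs J) E"
    if E: "E \<subseteq> vertex_pairs J" for E
  proof -
    have "pair_prob (p ` e) = P.pair_prob e" if "e \<in> vertex_pairs J" for e
      using that unfolding vertex_pairs_def by auto
    then show ?thesis
      unfolding edge_weight_def vp using mem[OF _ E] by (auto simp: prod.reindex[OF inj] intro!: prod.cong)
  qed
  moreover have "card (edge_cluster (p ` J) ((`) p ` E) (p i)) = card (edge_cluster J E i)"
    if E: "E \<subseteq> vertex_pairs J" for E
  proof -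
    have "edge_cluster (p ` J) ((`) p ` E) (p i) = p ` edge_cluster J E i"
    proof (rule cluster_image[OF p i])
      fix a b assume "a \<in> J" "b \<in> J" "a \<noteq> b"
      then have "{a, b} \<in> vertex_pairs J" unfolding vertex_pairs_def by auto
      then show "({p a, p b} \<in> (`) p ` E) = ({a, b} \<in> E)" using mem[of "{a, b}" E] E by auto
    qed
    then show ?thesis
      using card_image[OF inj_on_subset[OF p cluster_subset]] by metis
  qed
  moreover have "card (p ` J) = card J" using p by (rule card_image)
  ultimately show ?thesis
    unfolding cluster_mean_def P.cluster_mean_def edge_expectation_def
    by (subst sum.reindex_bij_betw[OF bij, symmetric]) (auto intro!: sum.cong)
qed

section \<open>Measurability of cluster functionals\<close>

locale measurable_kernel = edge_kernel \<phi>
  for \<phi> :: "'x::{second_countable_topology, t2_space} \<Rightarrow> 'x \<Rightarrow> real" +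
  assumes kernel_measurable: "(\<lambda>(x, y). \<phi> x y) \<in> borel_measurable (borel \<Otimes>\<^sub>M borel)"
begin

lemma measurable_kernel_compose [measurable (raw)]:
  assumes [measurable]: "f \<in> borel_measurable N" "g \<in> borel_measurable N"
  shows "(\<lambda>n. \<phi> (f n) (g n)) \<in> borel_measurable N"
  using measurable_compose[OF measurable_Pair[OF assms] kernel_measurable] by simp

text \<open>For fixed \<open>J\<close> the edge sets and their cluster sizes are constant in
  \<open>n\<close>; only the weights vary, and they are products of kernel values and their
  complements.\<close>

lemma measurable_cluster_mean_index:
  assumes [measurable]: "\<And>i. p i \<in> borel_measurable N"
  shows "(\<lambda>n. edge_kernel.cluster_mean (\<lambda>i j. \<phi> (p i n) (p j n)) \<psi> J i) \<in> borel_measurable N"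
proof -
  have pp: "(\<lambda>n. edge_kernel.pair_prob (\<lambda>i j. \<phi> (p i n) (p j n)) e) \<in> borel_measurable N"
    if "e \<in> vertex_pairs J" for e
  proof -
    from that obtain a b where e: "e = {a, b}" unfolding vertex_pairs_def by auto
    have "edge_kernel.pair_prob (\<lambda>i j. \<phi> (p i n) (p j n)) {a, b} = \<phi> (p a n) (p b n)" for n
      by (rule edge_kernel.pair_prob_eq[OF edge_kernel_compose])
    then show ?thesis unfolding e by simp
  qed
  have "(\<lambda>n. edge_weight (edge_kernel.pair_prob (\<lambda>i j. \<phi> (p i n) (p j n))) (vertex_pairs J) E) \<in> borel_measurable N"
    for E
    unfolding edge_weight_def using pp by (intro borel_measurable_prod) (auto intro: borel_measurable_diff)
  then show ?thesis
    unfolding edge_kernel.cluster_mean_def[OF edge_kernel_compose] edge_expectation_def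
    by (intro borel_measurable_sum borel_measurable_times measurable_compose[OF _ measurable_ennreal]) auto
qed

lemma measurable_cluster_mean:
  assumes S: "random_finite_set N S" and f [measurable]: "f \<in> borel_measurable N"
    and fS: "\<And>n. n \<in> space N \<Longrightarrow> f n \<in> S n"
  shows "(\<lambda>n. cluster_mean \<psi> (S n) (f n)) \<in> borel_measurable N"
proof (rule random_finite_set_measurable[OF S])
  fix p :: "nat \<Rightarrow> 'a \<Rightarrow> 'x" and J :: "nat set"
  assume J: "finite J" and p [measurable]: "\<And>i. p i \<in> borel_measurable N"
  let ?g = "\<lambda>i n. edge_kernel.cluster_mean (\<lambda>i j. \<phi> (p i n) (p j n)) \<psi> J i"
  have [measurable]: "?g i \<in> borel_measurable N" for i
    by (rule measurable_cluster_mean_index) simp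
  show "\<exists>h\<in>borel_measurable N. \<forall>n\<in>space N. inj_on (\<lambda>i. p i n) J \<and> S n = (\<lambda>i. p i n) ` J \<longrightarrow>
      cluster_mean \<psi> ((\<lambda>i. p i n) ` J) (f n) = h n"
  \<comment> \<open>The index of the root varies with \<open>n\<close>. The sum selects it, and
    injectivity leaves a single summand.\<close>
  proof (rule bexI[of _ "\<lambda>n. \<Sum>i\<in>J. if p i n = f n then ?g i n else 0"]; safe?)
    fix n assume n: "n \<in> space N" and inj: "inj_on (\<lambda>i. p i n) J" and Sn: "S n = (\<lambda>i. p i n) ` J"
    then obtain i where i: "i \<in> J" "f n = p i n" using fS by auto
    have "(\<Sum>i\<in>J. if p i n = f n then ?g i n else 0) = (\<Sum>j\<in>J. if j = i then ?g j n else 0)"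
      using inj i by (intro sum.cong) (auto simp: inj_on_def)
    also have "\<dots> = ?g i n" using J i by simp
    also have "\<dots> = cluster_mean \<psi> ((\<lambda>i. p i n) ` J) (f n)"
      unfolding i(2) using cluster_mean_image[OF inj i(1)] by simp
    finally show "cluster_mean \<psi> ((\<lambda>i. p i n) ` J) (f n) = (\<Sum>i\<in>J. if p i n = f n then ?g i n else 0)" ..
  qed measurable
qed

lemma measurable_mean_size:
  assumes "random_finite_set N S" "f \<in> borel_measurable N" "\<And>n. n \<in> space N \<Longrightarrow> f n \<in> S n"
  shows "(\<lambda>n. mean_size (S n) (f n)) \<in> borel_measurable N"
  unfolding mean_size_def by (rule measurable_cluster_mean[OF assms])

lemma measurable_conn_prob:
  assumes "random_finite_set N S" "f \<in> borel_measurable N" "\<And>n. n \<in> space N \<Longrightarrow> f n \<in> S n"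
  shows "(\<lambda>n. conn_prob (S n) (f n)) \<in> borel_measurable N"
  unfolding conn_prob_def by (rule measurable_cluster_mean[OF assms])

lemma measurable_isolation:
  assumes "random_finite_set N S" and [measurable]: "f \<in> borel_measurable N"
  shows "(\<lambda>n. isolation (S n) (f n)) \<in> borel_measurable N"
  unfolding isolation_def by (rule random_finite_set_prod[OF assms(1)]) measurable

end

section \<open>Poisson configurations\<close>

text \<open>A Poisson process on a set of finite measure \<open>t\<close> is realised as the first \<open>k\<close> terms of an
  i.i.d. sequence with law \<open>Q\<close>, where \<open>k\<close> has Poisson weights.\<close>

definition poisson_weight :: "real \<Rightarrow> nat \<Rightarrow> ennreal" where
  "poisson_weight t k = ennreal (exp (- t) * t ^ k / fact k)"

definition points :: "nat \<times> (nat \<Rightarrow> 'x) \<Rightarrow> 'x set" where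
  "points c = snd c ` {..<fst c}"

definition config_space :: "(nat \<times> (nat \<Rightarrow> 'x::topological_space)) measure" where
  "config_space = count_space UNIV \<Otimes>\<^sub>M (\<Pi>\<^sub>M i\<in>UNIV. borel)"

definition poisson_config :: "'x measure \<Rightarrow> real \<Rightarrow> (nat \<times> (nat \<Rightarrow> 'x::topological_space)) measure" where
  "poisson_config Q t = density (count_space UNIV) (poisson_weight t) \<Otimes>\<^sub>M (\<Pi>\<^sub>M i\<in>UNIV. Q)"

lemma poisson_weight_sums:
  assumes "0 \<le> t"
  shows "(\<Sum>k. poisson_weight t k) = 1"
proof -
  have "(\<lambda>k. exp (- t) * (t ^ k /\<^sub>R fact k)) sums (exp (- t) * exp t)"
    by (intro sums_mult exp_converges)
  then have "(\<lambda>k. exp (- t) * t ^ k / fact k) sums 1"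
    by (simp add: exp_minus field_simps)
  then have "(\<Sum>k. poisson_weight t k) = ennreal 1"
    unfolding poisson_weight_def using assms by (intro suminf_ennreal_eq) auto
  then show ?thesis by simp
qed

lemma suminf_triangle_ennreal:
  fixes h :: "nat \<Rightarrow> nat \<Rightarrow> ennreal"
  shows "(\<Sum>k. \<Sum>m\<le>k. h m (k - m)) = (\<Sum>m. \<Sum>n. h m n)"
proof -
  have shift: "(\<Sum>n. h m n) = (\<Sum>k. if m \<le> k then h m (k - m) else 0)" for m
    by (subst suminf_offset[of "\<lambda>k. if m \<le> k then h m (k - m) else 0" m]) auto
  have "(\<Sum>k. \<Sum>m\<le>k. h m (k - m)) = (\<Sum>k. \<Sum>m. if m \<le> k then h m (k - m) else 0)"
  proof (rule suminf_cong)
    fix k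
    have "(\<Sum>m. if m \<le> k then h m (k - m) else 0) = (\<Sum>m\<le>k. if m \<le> k then h m (k - m) else 0)"
      by (rule suminf_finite) auto
    then show "(\<Sum>m\<le>k. h m (k - m)) = (\<Sum>m. if m \<le> k then h m (k - m) else 0)" by simp
  qed
  also have "\<dots> = (\<Sum>m. \<Sum>k. if m \<le> k then h m (k - m) else 0)"
    using nn_integral_suminf[of "\<lambda>m k. if m \<le> k then h m (k - m) else 0" "count_space UNIV"]
    by (simp add: nn_integral_count_space_nat)
  finally show ?thesis using shift by simp
qed

lemma random_finite_set_points:
  "random_finite_set (config_space :: (nat \<times> (nat \<Rightarrow> 'x::{second_countable_topology, t2_space})) measure) points"
proof (rule random_finite_setI[where p = "\<lambda>i c. snd c i" and J = "\<lambda>c. {..<fst c}"])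
  show "(\<lambda>c. snd c i) \<in> borel_measurable config_space" for i unfolding config_space_def by measurable
  show "Measurable.pred config_space (\<lambda>c. i \<in> {..<fst c})" for i
    unfolding config_space_def by measurable
qed (auto simp: points_def)

lemma random_finite_set_points':
  fixes f :: "'n \<Rightarrow> nat \<times> (nat \<Rightarrow> 'x::{second_countable_topology, t2_space})"
  shows "f \<in> measurable N config_space \<Longrightarrow> random_finite_set N (\<lambda>n. points (f n))"
  by (rule random_finite_set_compose[OF random_finite_set_points])

lemma finite_points [simp]: "finite (points c)"
  by (simp add: points_def)

lemma shift_interval: "{m..<m + n} = (\<lambda>i::nat. i + m) ` {0..<n}"
  unfolding image_add_atLeastLessThan' by (simp add: add.commute)

lemma comb_seq_image:
  "comb_seq m \<omega> \<omega>' ` {..<m} = \<omega> ` {..<m}" "comb_seq m \<omega> \<omega>' ` {m..<m + n} = \<omega>' ` {..<n}"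
proof -
  show "comb_seq m \<omega> \<omega>' ` {..<m} = \<omega> ` {..<m}"
    by (intro image_cong) (auto simp: comb_seq_def)
  have "comb_seq m \<omega> \<omega>' ` {m..<m + n} = (\<lambda>i. comb_seq m \<omega> \<omega>' (i + m)) ` {0..<n}"
    by (simp only: shift_interval image_image)
  then show "comb_seq m \<omega> \<omega>' ` {m..<m + n} = \<omega>' ` {..<n}"
    by (simp add: comb_seq_add atLeast0LessThan)
qed

text \<open>Enumerating \<open>I\<close> and \<open>K\<close> turns the two images into
  configurations of constant size, so measurability on pairs of configurations covers all finite
  index sets.\<close>

lemma measurable_two_points:
  fixes f :: "'x::{second_countable_topology, t2_space} set \<Rightarrow> 'x set \<Rightarrow> ennreal"
  assumes f: "(\<lambda>(c1, c2). f (points c1) (points c2)) \<in> borel_measurable (config_space \<Otimes>\<^sub>M config_space)"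
    and p [measurable]: "\<And>i::nat. p i \<in> borel_measurable N" and fin: "finite I" "finite K"
  shows "(\<lambda>n. f ((\<lambda>i. p i n) ` I) ((\<lambda>i. p i n) ` K)) \<in> borel_measurable N"
proof -
  obtain e where e: "bij_betw e {0..<card I} I" using ex_bij_betw_nat_finite[OF fin(1)] by blast
  obtain e' where e': "bij_betw e' {0..<card K} K" using ex_bij_betw_nat_finite[OF fin(2)] by blast
  have m: "(\<lambda>n. ((card I, \<lambda>i. p (e i) n), (card K, \<lambda>i. p (e' i) n))) \<in> measurable N (config_space \<Otimes>\<^sub>M config_space)"
    unfolding config_space_def by (intro measurable_Pair measurable_abs_UNIV p) auto
  have "(\<lambda>i. p (e i) n) ` {..<card I} = (\<lambda>i. p i n) ` I" "(\<lambda>i. p (e' i) n) ` {..<card K} = (\<lambda>i. p i n) ` K" for n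
    using bij_betw_imp_surj_on[OF e] bij_betw_imp_surj_on[OF e']
      image_image[of "\<lambda>i. p i n" e "{..<card I}"] image_image[of "\<lambda>i. p i n" e' "{..<card K}"]
    by (simp_all add: atLeast0LessThan)
  then show ?thesis
    using measurable_compose[OF m f] by (simp add: points_def)
qed

text \<open>Without atoms the terms of an i.i.d. sequence are almost surely distinct, so describing
  a configuration by its set of points loses no multiplicity.\<close>

locale diffuse_prob = prob_space Q
  for Q :: "'x::{second_countable_topology, t2_space} measure" +
  assumes sets_Q [measurable_cong, simp]: "sets Q = sets borel"
    and diffuse: "emeasure Q {x} = 0"
begin

abbreviation iid :: "(nat \<Rightarrow> 'x) measure" where
  "iid \<equiv> \<Pi>\<^sub>M i\<in>UNIV. Q"

sublocale iid: sequence_space Q ..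

lemma space_Q [simp]: "space Q = UNIV"
  using sets_eq_imp_space_eq[OF sets_Q] by simp

lemma sets_iid [measurable_cong]: "sets iid = sets (\<Pi>\<^sub>M i\<in>UNIV. borel)"
  by (intro sets_PiM_cong) auto

lemma sets_poisson_config [measurable_cong, simp]: "sets (poisson_config Q t) = sets config_space"
  unfolding poisson_config_def config_space_def by (intro sets_pair_measure_cong sets_iid) simp

lemma space_poisson_config [simp]: "space (poisson_config Q t) = UNIV"
  unfolding poisson_config_def by (simp add: space_pair_measure space_PiM)

lemma prob_space_weights: "0 \<le> t \<Longrightarrow> prob_space (density (count_space UNIV) (poisson_weight t))"
  by (rule prob_spaceI) (simp add: emeasure_density nn_integral_count_space_nat poisson_weight_sums)

lemma prob_space_poisson_config: "0 \<le> t \<Longrightarrow> prob_space (poisson_config Q t)"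
  unfolding poisson_config_def
  using prob_space_pair prob_space_weights iid.prob_space_axioms by blast

lemma borel_measurable_poisson_config:
  "borel_measurable (poisson_config Q t) = (borel_measurable config_space :: (_ \<Rightarrow> 'b::topological_space) set)"
  by (rule measurable_cong_sets) auto

lemma nn_integral_poisson_config:
  assumes [measurable]: "F \<in> borel_measurable config_space"
  shows "(\<integral>\<^sup>+ c. F c \<partial>poisson_config Q t) = (\<Sum>k. poisson_weight t k * (\<integral>\<^sup>+ \<omega>. F (k, \<omega>) \<partial>iid))"
proof -
  have F: "F \<in> borel_measurable (density (count_space UNIV) (poisson_weight t) \<Otimes>\<^sub>M iid)"
    using assms by (simp flip: poisson_config_def add: borel_measurable_poisson_config)
  have "(\<integral>\<^sup>+ c. F c \<partial>poisson_config Q t) =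
      (\<integral>\<^sup>+ k. (\<integral>\<^sup>+ \<omega>. F (k, \<omega>) \<partial>iid) \<partial>density (count_space UNIV) (poisson_weight t))"
    unfolding poisson_config_def using iid.nn_integral_fst[OF F] by simp
  also have "\<dots> = (\<Sum>k. poisson_weight t k * (\<integral>\<^sup>+ \<omega>. F (k, \<omega>) \<partial>iid))"
    by (simp add: nn_integral_density nn_integral_count_space_nat)
  finally show ?thesis .
qed

lemma measurable_points_prefix:
  assumes "(\<lambda>c. F (points c)) \<in> borel_measurable config_space"
  shows "(\<lambda>\<omega>. F (\<omega> ` {..<k})) \<in> borel_measurable iid"
proof -
  have "(\<lambda>\<omega>. (k, \<omega>)) \<in> measurable iid config_space" unfolding config_space_def by measurable
  from measurable_compose[OF this assms] show ?thesis by (simp add: points_def)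
qed

section \<open>Exchangeability and independence of blocks of an i.i.d. sequence\<close>

lemma iid_reindex:
  assumes "inj \<sigma>" and [measurable]: "g \<in> borel_measurable iid"
  shows "(\<integral>\<^sup>+ \<omega>. g (\<lambda>i. \<omega> (\<sigma> i)) \<partial>iid) = (\<integral>\<^sup>+ \<omega>. g \<omega> \<partial>iid)"
proof -
  have "distr iid iid (\<lambda>\<omega> i. \<omega> (\<sigma> i)) = iid"
    using distr_PiM_reindex[of UNIV "\<lambda>_. Q" \<sigma> UNIV] assms(1) prob_space_axioms by (simp add: restrict_def)
  then have "(\<integral>\<^sup>+ \<omega>. g \<omega> \<partial>iid) = (\<integral>\<^sup>+ \<omega>. g \<omega> \<partial>distr iid iid (\<lambda>\<omega> i. \<omega> (\<sigma> i)))" by simp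
  also have "\<dots> = (\<integral>\<^sup>+ \<omega>. g (\<lambda>i. \<omega> (\<sigma> i)) \<partial>iid)"
    by (intro nn_integral_distr measurable_abs_UNIV) (use assms(2) in auto)
  finally show ?thesis ..
qed

lemma iid_comb_seq:
  assumes [measurable]: "g \<in> borel_measurable iid"
  shows "(\<integral>\<^sup>+ \<omega>. g \<omega> \<partial>iid) = (\<integral>\<^sup>+ \<omega>. \<integral>\<^sup>+ \<omega>'. g (comb_seq m \<omega> \<omega>') \<partial>iid \<partial>iid)"
proof -
  have "(\<integral>\<^sup>+ \<omega>. g \<omega> \<partial>iid) = (\<integral>\<^sup>+ \<omega>. g \<omega> \<partial>distr (iid \<Otimes>\<^sub>M iid) iid (\<lambda>(\<omega>, \<omega>'). comb_seq m \<omega> \<omega>'))"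
    by (simp add: iid.PiM_comb_seq)
  also have "\<dots> = (\<integral>\<^sup>+ x. g (case x of (\<omega>, \<omega>') \<Rightarrow> comb_seq m \<omega> \<omega>') \<partial>(iid \<Otimes>\<^sub>M iid))"
    by (rule nn_integral_distr) measurable
  also have "\<dots> = (\<integral>\<^sup>+ \<omega>. \<integral>\<^sup>+ \<omega>'. g (comb_seq m \<omega> \<omega>') \<partial>iid \<partial>iid)"
    by (subst iid.nn_integral_fst[symmetric]) auto
  finally show ?thesis .
qed

text \<open>By exchangeability the blocks \<open>I\<close> and \<open>K\<close> may be moved to the
  initial positions, where \<open>comb_seq\<close> splits the sequence into two independent ones.
  Thus a chosen part of a sample and the rest become independent samples.\<close>

lemma iid_two_sets:
  fixes f :: "'x set \<Rightarrow> 'x set \<Rightarrow> ennreal"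
  assumes f: "(\<lambda>(c1, c2). f (points c1) (points c2)) \<in> borel_measurable (config_space \<Otimes>\<^sub>M config_space)"
    and fin: "finite I" "finite K" "I \<inter> K = {}"
  shows "(\<integral>\<^sup>+ \<omega>. f (\<omega> ` I) (\<omega> ` K) \<partial>iid) =
    (\<integral>\<^sup>+ \<omega>. \<integral>\<^sup>+ \<omega>'. f (\<omega> ` {..<card I}) (\<omega>' ` {..<card K}) \<partial>iid \<partial>iid)"
proof -
  define m n where "m = card I" and "n = card K"
  obtain e where e: "bij_betw e {0..<m} I" using ex_bij_betw_nat_finite[OF fin(1)] m_def by blast
  obtain e' where e': "bij_betw e' {0..<n} K" using ex_bij_betw_nat_finite[OF fin(2)] n_def by blast
  obtain b where b: "\<And>i. i \<in> I \<union> K \<Longrightarrow> i < b" using fin finite_nat_set_iff_bounded[of "I \<union> K"] by auto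
  \<comment> \<open>Any injection with the right values on the two blocks will do; the indices from
    \<open>m + n\<close> on are pushed beyond the bound \<open>b\<close> of
    \<open>I \<union> K\<close>.\<close>
  define \<sigma> where "\<sigma> i = (if i < m then e i else if i < m + n then e' (i - m) else i + b)" for i
  have eI: "e i \<in> I" if "i < m" for i using e that by (auto simp: bij_betw_def)
  have eK: "e' (i - m) \<in> K" if "i < m + n" "\<not> i < m" for i using e' that by (auto simp: bij_betw_def)
  have "inj \<sigma>"
  proof (rule linorder_injI)
    fix x y :: nat assume "x < y"
    show "\<sigma> x \<noteq> \<sigma> y"
    proof (cases "y < m + n")
      case False
      then have "\<sigma> y = y + b" by (simp add: \<sigma>_def)
      moreover have "\<sigma> x < b \<or> \<sigma> x = x + b"
        using eI[of x] eK[of x] b by (auto simp: \<sigma>_def)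
      ultimately show ?thesis using \<open>x < y\<close> by auto
    next
      case True
      show ?thesis
      proof (cases "y < m")
        case True
        then have "e x \<noteq> e y"
          using \<open>x < y\<close> inj_onD[OF bij_betw_imp_inj_on[OF e], of x y] by auto
        then show ?thesis using \<open>x < y\<close> True by (simp add: \<sigma>_def)
      next
        case False
        show ?thesis
        proof (cases "x < m")
          case True
          then show ?thesis using \<open>y < m + n\<close> False eI[of x] eK[of y] fin(3) by (auto simp: \<sigma>_def)
        next
          case xm: False
          then have "x - m \<noteq> y - m" using \<open>x < y\<close> False by auto
          moreover have "x - m < n" "y - m < n" using \<open>y < m + n\<close> \<open>x < y\<close> False xm by auto
          ultimately have "e' (x - m) \<noteq> e' (y - m)"
            using \<open>y < m + n\<close> \<open>x < y\<close> False xm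
              inj_onD[OF bij_betw_imp_inj_on[OF e'], of "x - m" "y - m"] by auto
          then show ?thesis using \<open>y < m + n\<close> \<open>x < y\<close> False xm by (simp add: \<sigma>_def)
        qed
      qed
    qed
  qed
  have im1: "(\<lambda>i. \<omega> (\<sigma> i)) ` {..<m} = \<omega> ` I" for \<omega> :: "nat \<Rightarrow> 'x"
  proof -
    have "\<sigma> ` {..<m} = e ` {0..<m}" by (intro image_cong) (auto simp: \<sigma>_def)
    then show ?thesis using e by (simp add: bij_betw_def image_image[symmetric])
  qed
  have im2: "(\<lambda>i. \<omega> (\<sigma> i)) ` {m..<m + n} = \<omega> ` K" for \<omega> :: "nat \<Rightarrow> 'x"
  proof -
    have "\<sigma> ` {m..<m + n} = (\<lambda>i. \<sigma> (i + m)) ` {0..<n}"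
      by (simp only: shift_interval image_image)
    also have "\<dots> = e' ` {0..<n}" by (intro image_cong) (auto simp: \<sigma>_def)
    finally show ?thesis using e' by (simp add: bij_betw_def image_image[symmetric])
  qed
  have g: "(\<lambda>\<omega>. f (\<omega> ` {..<m}) (\<omega> ` {m..<m + n})) \<in> borel_measurable iid"
    by (rule measurable_two_points[OF f, of "\<lambda>i \<omega>. \<omega> i"]) auto
  have "(\<integral>\<^sup>+ \<omega>. f (\<omega> ` I) (\<omega> ` K) \<partial>iid) = (\<integral>\<^sup>+ \<omega>. f (\<omega> ` {..<m}) (\<omega> ` {m..<m + n}) \<partial>iid)"
    using iid_reindex[OF \<open>inj \<sigma>\<close> g] by (simp add: im1 im2)
  also have "\<dots> = (\<integral>\<^sup>+ \<omega>. \<integral>\<^sup>+ \<omega>'. f (\<omega> ` {..<m}) (\<omega>' ` {..<n}) \<partial>iid \<partial>iid)"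
    by (subst iid_comb_seq[OF g, of m]) (simp add: comb_seq_image)
  finally show ?thesis unfolding m_def n_def .
qed

section \<open>Almost sure properties of configurations\<close>

lemma AE_Q_neq: "AE y in Q. y \<noteq> x"
  by (rule AE_I[of _ _ "{x}"]) (use diffuse in auto)

lemma AE_iid_inj: "AE \<omega> in iid. inj \<omega>"
proof -
  have *: "AE \<omega> in iid. \<omega> i \<noteq> \<omega> j" if "i \<noteq> j" for i j :: nat
  proof -
    \<comment> \<open>\<open>?f\<close> counts coincidences between two sets. For singletons of
      indices, \<open>iid_two_sets\<close> makes the two coordinates independent, and diffuseness
      applies to one with the other fixed.\<close>
    let ?f = "\<lambda>A B. \<Sum>x\<in>A. \<Sum>y\<in>B. of_bool (x = y) :: ennreal"
    have f: "(\<lambda>(c1, c2). ?f (points c1) (points c2)) \<in>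
        borel_measurable (config_space \<Otimes>\<^sub>M (config_space :: (nat \<times> (nat \<Rightarrow> 'x)) measure))"
      unfolding split_beta'
      by (intro random_finite_set_sum random_finite_set_points' measurable_fst, unfold split_beta',
          intro random_finite_set_sum random_finite_set_points') measurable
    have "(\<integral>\<^sup>+ \<omega>. of_bool (\<omega> i = \<omega> j) \<partial>iid) = (\<integral>\<^sup>+ \<omega>. ?f (\<omega> ` {i}) (\<omega> ` {j}) \<partial>iid)"
      by (intro nn_integral_cong) (auto simp: Int_insert_left)
    also have "\<dots> = (\<integral>\<^sup>+ \<omega>. \<integral>\<^sup>+ \<omega>'. ?f (\<omega> ` {..<card {i}}) (\<omega>' ` {..<card {j}}) \<partial>iid \<partial>iid)"
      by (rule iid_two_sets[OF f]) (use that in auto)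
    also have "\<dots> = (\<integral>\<^sup>+ \<omega>. 0 \<partial>iid)"
    proof (rule nn_integral_cong)
      fix \<omega> :: "nat \<Rightarrow> 'x"
      have "AE \<omega>' in iid. \<omega>' 0 \<noteq> \<omega> 0"
        by (rule AE_PiM_component) (use prob_space_axioms AE_Q_neq in auto)
      then have "(\<integral>\<^sup>+ \<omega>'. ?f (\<omega> ` {..<card {i}}) (\<omega>' ` {..<card {j}}) \<partial>iid) = (\<integral>\<^sup>+ \<omega>'. 0 \<partial>iid)"
        by (intro nn_integral_cong_AE) auto
      then show "(\<integral>\<^sup>+ \<omega>'. ?f (\<omega> ` {..<card {i}}) (\<omega>' ` {..<card {j}}) \<partial>iid) = 0" by simp
    qed
    finally have "(\<integral>\<^sup>+ \<omega>. of_bool (\<omega> i = \<omega> j) \<partial>iid) = 0" by simp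
    then have "AE \<omega> in iid. of_bool (\<omega> i = \<omega> j) = (0 :: ennreal)"
      by (subst (asm) nn_integral_0_iff_AE) measurable
    then show ?thesis by eventually_elim auto
  qed
  have "AE \<omega> in iid. \<forall>i j. i \<noteq> j \<longrightarrow> \<omega> i \<noteq> \<omega> j"
    unfolding AE_all_countable using * by auto
  then show ?thesis by eventually_elim (auto simp: inj_on_def)
qed

lemma AE_poisson_config_iid:
  assumes "0 \<le> t" "AE \<omega> in iid. R \<omega>"
  shows "AE c in poisson_config Q t. R (snd c)"
proof -
  interpret A: prob_space "density (count_space UNIV) (poisson_weight t)"
    using assms(1) by (rule prob_space_weights)
  obtain N where N: "{\<omega>\<in>space iid. \<not> R \<omega>} \<subseteq> N" "N \<in> sets iid" "emeasure iid N = 0"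
    using assms(2) by (rule AE_E)
  have "emeasure (poisson_config Q t) (UNIV \<times> N) = 0"
    unfolding poisson_config_def using N by (subst iid.emeasure_pair_measure_Times) auto
  moreover have "UNIV \<times> N \<in> sets (poisson_config Q t)"
    unfolding poisson_config_def using N by (intro pair_measureI) auto
  ultimately show ?thesis
    using N by (intro AE_I[of _ _ "UNIV \<times> N"]) (auto simp: space_PiM)
qed

lemma AE_points:
  assumes "0 \<le> t" "AE x in Q. R x"
  shows "AE c in poisson_config Q t. \<forall>x\<in>points c. R x"
proof -
  have "AE \<omega> in iid. \<forall>i. R (\<omega> i)"
    unfolding AE_all_countable using assms(2) prob_space_axioms by (auto intro!: AE_PiM_component)
  from AE_poisson_config_iid[OF assms(1) this] show ?thesis
    by eventually_elim (auto simp: points_def)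
qed

lemma AE_notin_points: "0 \<le> t \<Longrightarrow> AE c in poisson_config Q t. x \<notin> points c"
  using AE_points[OF _ AE_Q_neq[of x], of t] by (auto elim: eventually_mono)

lemma AE_disjoint_points:
  assumes "0 \<le> t" "finite A"
  shows "AE c in poisson_config Q t. A \<inter> points c = {}"
proof -
  have "AE c in poisson_config Q t. \<forall>x\<in>A. x \<notin> points c"
    using assms by (intro AE_finite_allI AE_notin_points)
  then show ?thesis by eventually_elim auto
qed

text \<open>Choosing \<open>m\<close> of \<open>k\<close> points turns \<open>t ^ k / fact k\<close>
  into the product of the terms for \<open>m\<close> and \<open>k - m\<close>. Each Poisson weight
  on the right carries its own \<open>exp (- t)\<close>, and \<open>exp t\<close> compensates for
  the second one.\<close>

lemma poisson_weight_mult: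
  assumes "0 \<le> t" "m \<le> k"
  shows "poisson_weight t k * of_nat (k choose m) = ennreal (exp t) * (poisson_weight t m * poisson_weight t (k - m))"
proof -
  have "exp (- t) * t ^ k / fact k * real (k choose m) =
      exp t * (exp (- t) * t ^ m / fact m * (exp (- t) * t ^ (k - m) / fact (k - m)))"
    using assms(2) by (simp add: binomial_fact exp_minus field_simps flip: power_add)
  then show ?thesis
    unfolding poisson_weight_def using assms(1)
    by (simp flip: ennreal_mult add: ennreal_of_nat_eq_real_of_nat)
qed

lemma nn_integral_two_configs:
  fixes f :: "'x set \<Rightarrow> 'x set \<Rightarrow> ennreal"
  assumes t: "0 \<le> t" "0 \<le> s"
    and f: "(\<lambda>(c1, c2). f (points c1) (points c2)) \<in> borel_measurable (config_space \<Otimes>\<^sub>M config_space)"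
  shows "(\<integral>\<^sup>+ c1. \<integral>\<^sup>+ c2. f (points c1) (points c2) \<partial>poisson_config Q s \<partial>poisson_config Q t) =
    (\<Sum>m. \<Sum>n. poisson_weight t m * (poisson_weight s n *
      (\<integral>\<^sup>+ \<omega>. \<integral>\<^sup>+ \<omega>'. f (\<omega> ` {..<m}) (\<omega>' ` {..<n}) \<partial>iid \<partial>iid)))"
proof -
  interpret S: prob_space "poisson_config Q s" using t by (intro prob_space_poisson_config)
  have f': "(\<lambda>(c1, c2). f (points c1) (points c2)) \<in> borel_measurable (config_space \<Otimes>\<^sub>M poisson_config Q s)"
    using f by (subst measurable_cong_sets[OF sets_pair_measure_cong refl]) auto
  have f2: "(\<lambda>c2. f A (points c2)) \<in> borel_measurable config_space" if A: "A = points c1" for c1 A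
    using measurable_compose[OF measurable_Pair1' f, of c1] A by (simp add: config_space_def space_pair_measure space_PiM)
  have "(\<lambda>c1. \<integral>\<^sup>+ c2. f (points c1) (points c2) \<partial>poisson_config Q s) \<in> borel_measurable config_space"
    using S.borel_measurable_nn_integral_fst[OF f'] by simp
  then have "(\<integral>\<^sup>+ c1. \<integral>\<^sup>+ c2. f (points c1) (points c2) \<partial>poisson_config Q s \<partial>poisson_config Q t) =
    (\<Sum>m. poisson_weight t m * (\<integral>\<^sup>+ \<omega>. \<integral>\<^sup>+ c2. f (\<omega> ` {..<m}) (points c2) \<partial>poisson_config Q s \<partial>iid))"
    by (subst nn_integral_poisson_config) (auto simp: points_def)
  also have "\<dots> = (\<Sum>m. poisson_weight t m * (\<integral>\<^sup>+ \<omega>. (\<Sum>n. poisson_weight s n *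
      (\<integral>\<^sup>+ \<omega>'. f (\<omega> ` {..<m}) (\<omega>' ` {..<n}) \<partial>iid)) \<partial>iid))"
  proof (intro suminf_cong arg_cong2[where f = times] refl nn_integral_cong)
    fix m and \<omega> :: "nat \<Rightarrow> 'x"
    have "\<omega> ` {..<m} = points (m, \<omega>)" by (simp add: points_def)
    from nn_integral_poisson_config[OF f2[OF this]]
    show "(\<integral>\<^sup>+ c2. f (\<omega> ` {..<m}) (points c2) \<partial>poisson_config Q s) =
        (\<Sum>n. poisson_weight s n * (\<integral>\<^sup>+ \<omega>'. f (\<omega> ` {..<m}) (\<omega>' ` {..<n}) \<partial>iid))"
      by (simp add: points_def)
  qed
  also have "\<dots> = (\<Sum>m. poisson_weight t m * (\<Sum>n. poisson_weight s n * (\<integral>\<^sup>+ \<omega>.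
      (\<integral>\<^sup>+ \<omega>'. f (\<omega> ` {..<m}) (\<omega>' ` {..<n}) \<partial>iid) \<partial>iid)))"
  proof (intro suminf_cong arg_cong2[where f = times] refl)
    fix m
    have [measurable]: "(\<lambda>\<omega>. \<integral>\<^sup>+ \<omega>'. f (\<omega> ` {..<m}) (\<omega>' ` {..<n}) \<partial>iid) \<in> borel_measurable iid" for n
    proof -
      have "(\<lambda>(\<omega>, \<omega>'). ((m, \<omega>), (n, \<omega>'))) \<in> measurable (iid \<Otimes>\<^sub>M iid) (config_space \<Otimes>\<^sub>M config_space)"
        unfolding config_space_def by measurable
      from measurable_compose[OF this f]
      have "(\<lambda>(\<omega>, \<omega>'). f (\<omega> ` {..<m}) (\<omega>' ` {..<n})) \<in> borel_measurable (iid \<Otimes>\<^sub>M iid)"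
        by (simp add: points_def case_prod_beta)
      then show ?thesis using iid.borel_measurable_nn_integral_fst by fastforce
    qed
    show "(\<integral>\<^sup>+ \<omega>. (\<Sum>n. poisson_weight s n * (\<integral>\<^sup>+ \<omega>'. f (\<omega> ` {..<m}) (\<omega>' ` {..<n}) \<partial>iid)) \<partial>iid) =
        (\<Sum>n. poisson_weight s n * (\<integral>\<^sup>+ \<omega>. (\<integral>\<^sup>+ \<omega>'. f (\<omega> ` {..<m}) (\<omega>' ` {..<n}) \<partial>iid) \<partial>iid))"
      by (subst nn_integral_suminf) (auto simp: nn_integral_cmult)
  qed
  finally show ?thesis by simp
qed

text \<open>Mecke's formula for finite parts of the process: removing the part leaves an independent copy.
  The factor \<open>exp t\<close> turns the Poisson weights of the part into \<open>t ^ m / fact m\<close>.\<close>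

lemma nn_integral_split:
  fixes f :: "'x set \<Rightarrow> 'x set \<Rightarrow> ennreal"
  assumes t: "0 \<le> t"
    and f: "(\<lambda>(c1, c2). f (points c1) (points c2)) \<in> borel_measurable (config_space \<Otimes>\<^sub>M config_space)"
  shows "(\<lambda>c. \<Sum>A\<in>Pow (points c). f A (points c - A)) \<in> borel_measurable config_space"
    and "(\<integral>\<^sup>+ c. (\<Sum>A\<in>Pow (points c). f A (points c - A)) \<partial>poisson_config Q t) = ennreal (exp t) *
      (\<integral>\<^sup>+ c1. \<integral>\<^sup>+ c2. f (points c1) (points c2) \<partial>poisson_config Q t \<partial>poisson_config Q t)"
proof -
  have inj_sum: "(\<Sum>A\<in>Pow (p ` J). f A (p ` J - A)) = (\<Sum>I\<in>Pow J. f (p ` I) (p ` (J - I)))"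
    if "inj_on p J" for p :: "nat \<Rightarrow> 'x" and J
  proof -
    have "bij_betw ((`) p) (Pow J) (Pow (p ` J))"
      using that by (intro bij_betw_Pow) (simp add: bij_betw_def)
    then have "(\<Sum>A\<in>Pow (p ` J). f A (p ` J - A)) = (\<Sum>I\<in>Pow J. f (p ` I) (p ` J - p ` I))"
      by (rule sum.reindex_bij_betw[symmetric])
    also have "\<dots> = (\<Sum>I\<in>Pow J. f (p ` I) (p ` (J - I)))"
      by (intro sum.cong refl arg_cong2[where f = f]) (use that in \<open>auto simp: inj_on_image_set_diff\<close>)
    finally show ?thesis .
  qed
  have meas: "(\<lambda>n. \<Sum>I\<in>Pow J. f ((\<lambda>i. p i n) ` I) ((\<lambda>i. p i n) ` (J - I))) \<in> borel_measurable N"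
    if "finite J" "\<And>i::nat. p i \<in> borel_measurable N" for p J and N :: "'n measure"
    using that by (intro borel_measurable_sum measurable_two_points[OF f]) (auto intro: finite_subset)
  show m: "(\<lambda>c. \<Sum>A\<in>Pow (points c). f A (points c - A)) \<in> borel_measurable config_space"
  proof (rule random_finite_set_measurable[OF random_finite_set_points])
    fix p :: "nat \<Rightarrow> (nat \<times> (nat \<Rightarrow> 'x)) \<Rightarrow> 'x" and J :: "nat set"
    assume J: "finite J" and p: "\<And>i. p i \<in> borel_measurable config_space"
    show "\<exists>h\<in>borel_measurable config_space. \<forall>n\<in>space config_space.
         inj_on (\<lambda>i. p i n) J \<and> points n = (\<lambda>i. p i n) ` J \<longrightarrow>
         (\<Sum>A\<in>Pow ((\<lambda>i. p i n) ` J). f A ((\<lambda>i. p i n) ` J - A)) = h n"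
      by (rule bexI[OF _ meas[OF J p]]) (auto simp: inj_sum)
  qed
  \<comment> \<open>The mean of \<open>f\<close> over two independent samples of sizes
    \<open>m\<close> and \<open>n\<close>. Points are almost surely distinct, so subsets of a sample
    of size \<open>k\<close> correspond to index sets; by \<open>iid_two_sets\<close> only their
    cardinality matters, which leaves \<open>k choose m\<close> equal terms.\<close>
  let ?a = "\<lambda>m n. (\<integral>\<^sup>+ \<omega>. \<integral>\<^sup>+ \<omega>'. f (\<omega> ` {..<m}) (\<omega>' ` {..<n}) \<partial>iid \<partial>iid)"
  have "(\<integral>\<^sup>+ c. (\<Sum>A\<in>Pow (points c). f A (points c - A)) \<partial>poisson_config Q t) =
      (\<Sum>k. poisson_weight t k * (\<integral>\<^sup>+ \<omega>. (\<Sum>A\<in>Pow (\<omega> ` {..<k}). f A (\<omega> ` {..<k} - A)) \<partial>iid))"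
    by (subst nn_integral_poisson_config[OF m]) (simp add: points_def)
  also have "\<dots> = (\<Sum>k. poisson_weight t k * (\<Sum>m\<le>k. of_nat (k choose m) * ?a m (k - m)))"
  proof (intro suminf_cong arg_cong2[where f = times] refl)
    fix k
    have "(\<integral>\<^sup>+ \<omega>. (\<Sum>A\<in>Pow (\<omega> ` {..<k}). f A (\<omega> ` {..<k} - A)) \<partial>iid) =
        (\<integral>\<^sup>+ \<omega>. (\<Sum>I\<in>Pow {..<k}. f (\<omega> ` I) (\<omega> ` ({..<k} - I))) \<partial>iid)"
      by (intro nn_integral_cong_AE) (use AE_iid_inj in eventually_elim, simp add: inj_sum inj_on_subset)
    also have "\<dots> = (\<Sum>I\<in>Pow {..<k}. \<integral>\<^sup>+ \<omega>. f (\<omega> ` I) (\<omega> ` ({..<k} - I)) \<partial>iid)"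
      by (intro nn_integral_sum measurable_two_points[OF f]) (auto intro: finite_subset)
    also have "\<dots> = (\<Sum>I\<in>Pow {..<k}. ?a (card I) (k - card I))"
    proof (intro sum.cong refl)
      fix I assume I: "I \<in> Pow {..<k}"
      then have "card ({..<k} - I) = k - card I" by (subst card_Diff_subset) (auto intro: finite_subset)
      then show "(\<integral>\<^sup>+ \<omega>. f (\<omega> ` I) (\<omega> ` ({..<k} - I)) \<partial>iid) = ?a (card I) (k - card I)"
        using I by (subst iid_two_sets[OF f]) (auto intro: finite_subset)
    qed
    also have "\<dots> = (\<Sum>m\<le>k. \<Sum>I\<in>{I \<in> Pow {..<k}. card I = m}. ?a (card I) (k - card I))"
    proof (rule sum.group[symmetric])
      show "card ` Pow {..<k} \<subseteq> {..k}"
        using card_mono[OF finite_lessThan[of k]] by auto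
    qed auto
    also have "\<dots> = (\<Sum>m\<le>k. of_nat (k choose m) * ?a m (k - m))"
    proof (intro sum.cong refl)
      fix m
      have "card {I \<in> Pow {..<k}. card I = m} = k choose m"
        using n_subsets[of "{..<k}" m] by simp
      moreover have "(\<Sum>I\<in>{I \<in> Pow {..<k}. card I = m}. ?a (card I) (k - card I)) =
          (\<Sum>I\<in>{I \<in> Pow {..<k}. card I = m}. ?a m (k - m))"
        by (intro sum.cong) auto
      ultimately show "(\<Sum>I\<in>{I \<in> Pow {..<k}. card I = m}. ?a (card I) (k - card I)) = of_nat (k choose m) * ?a m (k - m)"
        by simp
    qed
    finally show "(\<integral>\<^sup>+ \<omega>. (\<Sum>A\<in>Pow (\<omega> ` {..<k}). f A (\<omega> ` {..<k} - A)) \<partial>iid) =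
        (\<Sum>m\<le>k. of_nat (k choose m) * ?a m (k - m))" .
  qed
  also have "\<dots> = (\<Sum>k. \<Sum>m\<le>k. ennreal (exp t) * (poisson_weight t m * (poisson_weight t (k - m) * ?a m (k - m))))"
  proof (intro suminf_cong)
    fix k
    have "poisson_weight t k * (of_nat (k choose m) * a) = ennreal (exp t) * (poisson_weight t m * (poisson_weight t (k - m) * a))"
      if "m \<in> {..k}" for m a
      using poisson_weight_mult[OF t, of m k] that by (simp add: mult.assoc[symmetric])
    then show "poisson_weight t k * (\<Sum>m\<le>k. of_nat (k choose m) * ?a m (k - m)) =
        (\<Sum>m\<le>k. ennreal (exp t) * (poisson_weight t m * (poisson_weight t (k - m) * ?a m (k - m))))"
      unfolding sum_distrib_left by (intro sum.cong) auto
  qed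
  also have "\<dots> = (\<Sum>m. \<Sum>n. ennreal (exp t) * (poisson_weight t m * (poisson_weight t n * ?a m n)))"
    by (rule suminf_triangle_ennreal)
  also have "\<dots> = ennreal (exp t) *
      (\<integral>\<^sup>+ c1. \<integral>\<^sup>+ c2. f (points c1) (points c2) \<partial>poisson_config Q t \<partial>poisson_config Q t)"
    by (simp add: nn_integral_two_configs[OF t t f])
  finally show "(\<integral>\<^sup>+ c. (\<Sum>A\<in>Pow (points c). f A (points c - A)) \<partial>poisson_config Q t) = ennreal (exp t) *
      (\<integral>\<^sup>+ c1. \<integral>\<^sup>+ c2. f (points c1) (points c2) \<partial>poisson_config Q t \<partial>poisson_config Q t)" .
qed

text \<open>The union of samples of sizes \<open>m\<close> and \<open>n\<close> has the law of one
  sample of size \<open>m + n\<close>, by concatenation of the sequences, and the Poisson weights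
  convolve by the binomial theorem.\<close>

lemma nn_integral_superposition:
  fixes F :: "'x set \<Rightarrow> ennreal"
  assumes t: "0 \<le> t" "0 \<le> s"
    and F: "(\<lambda>c. F (points c)) \<in> borel_measurable config_space"
    and F2: "(\<lambda>(c1, c2). F (points c1 \<union> points c2)) \<in> borel_measurable (config_space \<Otimes>\<^sub>M config_space)"
  shows "(\<integral>\<^sup>+ c. F (points c) \<partial>poisson_config Q (t + s)) =
    (\<integral>\<^sup>+ c1. \<integral>\<^sup>+ c2. F (points c1 \<union> points c2) \<partial>poisson_config Q s \<partial>poisson_config Q t)"
proof -
  let ?b = "\<lambda>k. \<integral>\<^sup>+ \<omega>. F (\<omega> ` {..<k}) \<partial>iid"
  have 1: "(\<integral>\<^sup>+ \<omega>. \<integral>\<^sup>+ \<omega>'. F (\<omega> ` {..<m} \<union> \<omega>' ` {..<n}) \<partial>iid \<partial>iid) = ?b (m + n)" for m n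
  proof -
    have "{..<m + n} = {..<m} \<union> {m..<m + n}" by auto
    then have "comb_seq m \<omega> \<omega>' ` {..<m + n} = \<omega> ` {..<m} \<union> \<omega>' ` {..<n}" for \<omega> \<omega>' :: "nat \<Rightarrow> 'x"
      by (simp only: image_Un comb_seq_image)
    then show ?thesis by (subst iid_comb_seq[OF measurable_points_prefix[OF F], of _ m]) simp
  qed
  have 2: "(\<Sum>m\<le>k. poisson_weight t m * poisson_weight s (k - m)) = poisson_weight (t + s) k" for k
  proof -
    have e: "exp (- (t + s)) = exp (- t) * exp (- s)" by (simp flip: exp_add)
    have "exp (- (t + s)) * (t + s) ^ k / fact k =
        (\<Sum>m\<le>k. exp (- t) * t ^ m / fact m * (exp (- s) * s ^ (k - m) / fact (k - m)))"
      unfolding binomial_ring sum_distrib_left sum_divide_distrib e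
      by (intro sum.cong refl) (simp add: binomial_fact)
    then show ?thesis
      unfolding poisson_weight_def using t by (simp flip: ennreal_mult)
  qed
  have "(\<integral>\<^sup>+ c1. \<integral>\<^sup>+ c2. F (points c1 \<union> points c2) \<partial>poisson_config Q s \<partial>poisson_config Q t) =
     (\<Sum>m. \<Sum>n. poisson_weight t m * (poisson_weight s n * ?b (m + n)))"
    by (subst nn_integral_two_configs[OF t F2]) (simp add: 1)
  also have "\<dots> = (\<Sum>k. \<Sum>m\<le>k. poisson_weight t m * (poisson_weight s (k - m) * ?b (m + (k - m))))"
    by (rule suminf_triangle_ennreal[symmetric])
  also have "\<dots> = (\<Sum>k. poisson_weight (t + s) k * ?b k)"
    by (intro suminf_cong) (simp add: 2[symmetric] sum_distrib_right mult.assoc)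
  also have "\<dots> = (\<integral>\<^sup>+ c. F (points c) \<partial>poisson_config Q (t + s))"
    by (subst nn_integral_poisson_config[OF F]) (simp add: points_def)
  finally show ?thesis ..
qed

text \<open>The case of \<open>nn_integral_split\<close> for parts with one element:
  \<open>f\<close> vanishes unless its first argument is a singleton, so only samples of size 1
  survive, and \<open>exp t * poisson_weight t 1 = t\<close>.\<close>

lemma nn_integral_Mecke:
  fixes \<psi> :: "'x \<Rightarrow> 'x set \<Rightarrow> ennreal"
  assumes t: "0 \<le> t"
    and \<psi>: "(\<lambda>(z, c). \<psi> z (points c)) \<in> borel_measurable (borel \<Otimes>\<^sub>M config_space)"
  shows "(\<integral>\<^sup>+ c. (\<Sum>z\<in>points c. \<psi> z (points c - {z})) \<partial>poisson_config Q t) =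
    ennreal t * (\<integral>\<^sup>+ z. \<integral>\<^sup>+ c. \<psi> z (points c) \<partial>poisson_config Q t \<partial>Q)"
proof -
  interpret T: prob_space "poisson_config Q t" using t by (rule prob_space_poisson_config)
  define f where "f A B = of_bool (card A = 1) * (\<Sum>z\<in>A. \<psi> z B)" for A B
  define H where "H z = (\<integral>\<^sup>+ c. \<psi> z (points c) \<partial>poisson_config Q t)" for z
  have \<psi>': "(\<lambda>c. \<psi> z (points c)) \<in> borel_measurable config_space" for z
    using measurable_compose[OF measurable_Pair1' \<psi>, of z] by simp
  have [measurable]: "H \<in> borel_measurable borel"
  proof -
    have "(\<lambda>(z, c). \<psi> z (points c)) \<in> borel_measurable (borel \<Otimes>\<^sub>M poisson_config Q t)"
      using \<psi> by (subst measurable_cong_sets[OF sets_pair_measure_cong refl]) auto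
    then show ?thesis unfolding H_def using T.borel_measurable_nn_integral_fst by fastforce
  qed
  have card1: "Measurable.pred config_space (\<lambda>c. card (points c :: 'x set) = 1)"
  proof -
    have "Measurable.pred config_space (\<lambda>c. (of_nat (card (points c :: 'x set)) :: ennreal) = 1)"
      using random_finite_set_card[OF random_finite_set_points] by measurable
    then show ?thesis by simp
  qed
  have f: "(\<lambda>(c1, c2). f (points c1) (points c2)) \<in> borel_measurable (config_space \<Otimes>\<^sub>M config_space)"
  proof -
    have [measurable]: "Measurable.pred (config_space \<Otimes>\<^sub>M config_space) (\<lambda>c. card (points (fst c) :: 'x set) = 1)"
      by (rule measurable_compose[OF measurable_fst card1])
    have "(\<lambda>x. ((\<lambda>x. (snd x, snd (fst x))) x)) \<in> measurable ((config_space \<Otimes>\<^sub>M config_space) \<Otimes>\<^sub>M borel) (borel \<Otimes>\<^sub>M (config_space :: (nat \<times> (nat \<Rightarrow> 'x)) measure))"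
      by measurable
    from measurable_compose[OF this \<psi>]
    have [measurable]: "(\<lambda>c. \<Sum>z\<in>points (fst c). \<psi> z (points (snd c))) \<in> borel_measurable (config_space \<Otimes>\<^sub>M config_space)"
      by (intro random_finite_set_sum random_finite_set_points' measurable_fst) (simp add: split_beta')
    show ?thesis unfolding f_def case_prod_beta by measurable
  qed
  have "(\<Sum>z\<in>S. \<psi> z (S - {z})) = (\<Sum>A\<in>Pow S. f A (S - A))" if "finite S" for S
  proof -
    have "(\<Sum>A\<in>Pow S. f A (S - A)) = (\<Sum>A\<in>(\<lambda>z. {z}) ` S. f A (S - A))"
      using that by (intro sum.mono_neutral_right) (auto simp: f_def card_1_singleton_iff)
    also have "\<dots> = (\<Sum>z\<in>S. f {z} (S - {z}))"
      by (subst sum.reindex) auto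
    finally show ?thesis by (simp add: f_def)
  qed
  then have "(\<integral>\<^sup>+ c. (\<Sum>z\<in>points c. \<psi> z (points c - {z})) \<partial>poisson_config Q t) =
     (\<integral>\<^sup>+ c. (\<Sum>A\<in>Pow (points c). f A (points c - A)) \<partial>poisson_config Q t)"
    by simp
  also have "\<dots> = ennreal (exp t) *
      (\<integral>\<^sup>+ c1. \<integral>\<^sup>+ c2. f (points c1) (points c2) \<partial>poisson_config Q t \<partial>poisson_config Q t)"
    by (rule nn_integral_split[OF t f])
  also have "(\<integral>\<^sup>+ c1. \<integral>\<^sup>+ c2. f (points c1) (points c2) \<partial>poisson_config Q t \<partial>poisson_config Q t) =
      (\<integral>\<^sup>+ c1. of_bool (card (points c1) = 1) * (\<Sum>z\<in>points c1. H z) \<partial>poisson_config Q t)"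
    unfolding f_def H_def
    by (intro nn_integral_cong) (simp add: nn_integral_cmult nn_integral_sum \<psi>' borel_measurable_poisson_config)
  also have "\<dots> = (\<Sum>k. poisson_weight t k * (\<integral>\<^sup>+ \<omega>. of_bool (card (\<omega> ` {..<k}) = 1) * (\<Sum>z\<in>\<omega> ` {..<k}. H z) \<partial>iid))"
  proof -
    have [measurable]: "(\<lambda>c. \<Sum>z\<in>points c. H z) \<in> borel_measurable config_space"
      by (rule random_finite_set_sum[OF random_finite_set_points]) measurable
    note card1 [measurable]
    have "(\<lambda>c. of_bool (card (points c) = 1) * (\<Sum>z\<in>points c. H z)) \<in> borel_measurable config_space"
      by measurable
    then show ?thesis by (subst nn_integral_poisson_config) (auto simp: points_def)
  qed
  also have "\<dots> = (\<Sum>k\<in>{1}. poisson_weight t k * (\<integral>\<^sup>+ \<omega>. of_bool (card (\<omega> ` {..<k}) = 1) * (\<Sum>z\<in>\<omega> ` {..<k}. H z) \<partial>iid))"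
  proof (rule suminf_finite)
    fix k :: nat assume "k \<notin> {1}"
    have "(\<integral>\<^sup>+ \<omega>. of_bool (card (\<omega> ` {..<k}) = 1) * (\<Sum>z\<in>\<omega> ` {..<k}. H z) \<partial>iid) = (\<integral>\<^sup>+ \<omega>. 0 \<partial>iid)"
    proof (rule nn_integral_cong_AE, use AE_iid_inj in eventually_elim)
      fix \<omega> :: "nat \<Rightarrow> 'x" assume "inj \<omega>"
      then have "card (\<omega> ` {..<k}) = k" by (subst card_image) (auto intro: inj_on_subset)
      then show "of_bool (card (\<omega> ` {..<k}) = 1) * (\<Sum>z\<in>\<omega> ` {..<k}. H z) = 0" using \<open>k \<notin> {1}\<close> by simp
    qed
    then show "poisson_weight t k * (\<integral>\<^sup>+ \<omega>. of_bool (card (\<omega> ` {..<k}) = 1) * (\<Sum>z\<in>\<omega> ` {..<k}. H z) \<partial>iid) = 0"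
      by simp
  qed simp
  also have "\<dots> = poisson_weight t 1 * (\<integral>\<^sup>+ \<omega>. H (\<omega> 0) \<partial>iid)"
    by (simp add: lessThan_Suc)
  also have "(\<integral>\<^sup>+ \<omega>. H (\<omega> 0) \<partial>iid) = (\<integral>\<^sup>+ z. H z \<partial>distr iid Q (\<lambda>\<omega>. \<omega> 0))"
    by (rule nn_integral_distr[symmetric]) measurable
  also have "distr iid Q (\<lambda>\<omega>. \<omega> 0) = Q"
    by (rule distr_PiM_component) (use prob_space_axioms in auto)
  also have "ennreal (exp t) * (poisson_weight t 1 * (\<integral>\<^sup>+ z. H z \<partial>Q)) = ennreal t * (\<integral>\<^sup>+ z. H z \<partial>Q)"
  proof -
    have "ennreal (exp t) * poisson_weight t 1 = ennreal t"
      unfolding poisson_weight_def using t by (simp flip: ennreal_mult add: exp_minus)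
    then show ?thesis by (simp flip: mult.assoc)
  qed
  finally show ?thesis unfolding H_def .
qed

text \<open>Keeping each point \<open>r\<close> with probability \<open>w r\<close> splits the process into two independent ones. The
  kept points have a smaller value of \<open>G\<close>, and dividing by the same identity for \<open>G = 1\<close> gives
  a correlation inequality.\<close>

lemma nn_integral_prod_le:
  fixes w :: "'x \<Rightarrow> ennreal" and G :: "'x set \<Rightarrow> ennreal"
  assumes t: "0 \<le> t" and w [measurable]: "w \<in> borel_measurable borel" and w1: "\<And>r. w r \<le> 1"
    and G: "(\<lambda>c. G (points c)) \<in> borel_measurable config_space"
    and mono: "\<And>A B. finite B \<Longrightarrow> A \<subseteq> B \<Longrightarrow> G A \<le> G B"
  shows "(\<integral>\<^sup>+ c. (\<Prod>r\<in>points c. w r) * G (points c) \<partial>poisson_config Q t) \<le>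
    (\<integral>\<^sup>+ c. (\<Prod>r\<in>points c. w r) \<partial>poisson_config Q t) * (\<integral>\<^sup>+ c. G (points c) \<partial>poisson_config Q t)"
proof -
  interpret T: prob_space "poisson_config Q t" using t by (rule prob_space_poisson_config)
  have W: "(\<lambda>c. \<Prod>r\<in>points c. w r) \<in> borel_measurable config_space"
    by (rule random_finite_set_prod[OF random_finite_set_points]) measurable
  have W': "(\<lambda>c. \<Prod>r\<in>points c. 1 - w r) \<in> borel_measurable config_space"
    by (rule random_finite_set_prod[OF random_finite_set_points]) measurable
  let ?P = "poisson_config Q t"
  \<comment> \<open>The contribution of the removed points. It is the same for all functionals
    \<open>H\<close> of the kept points, so it cancels when \<open>H = G\<close> is compared with
    \<open>H = 1\<close>.\<close>
  let ?d = "\<integral>\<^sup>+ c. (\<Prod>r\<in>points c. 1 - w r) \<partial>?P"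
  have key: "ennreal (exp t) * ((\<integral>\<^sup>+ c. (\<Prod>r\<in>points c. w r) * H (points c) \<partial>?P) * ?d) =
      (\<integral>\<^sup>+ c. (\<Sum>A\<in>Pow (points c). (\<Prod>r\<in>A. w r) * H A * (\<Prod>r\<in>points c - A. 1 - w r)) \<partial>?P)"
    if H: "(\<lambda>c. H (points c)) \<in> borel_measurable config_space" for H :: "'x set \<Rightarrow> ennreal"
  proof -
    have WH: "(\<lambda>c. (\<Prod>r\<in>points c. w r) * H (points c)) \<in> borel_measurable config_space"
      using W H by measurable
    have f: "(\<lambda>(c1, c2). (\<Prod>r\<in>points c1. w r) * H (points c1) * (\<Prod>r\<in>points c2. 1 - w r))
        \<in> borel_measurable (config_space \<Otimes>\<^sub>M config_space)"
      unfolding case_prod_beta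
      using measurable_compose[OF measurable_fst WH] measurable_compose[OF measurable_snd W']
      by measurable
    show ?thesis
      unfolding nn_integral_split(2)[OF t f]
      using W' WH by (simp add: nn_integral_cmult nn_integral_multc borel_measurable_poisson_config)
  qed
  have one: "(\<Sum>A\<in>Pow S. (\<Prod>r\<in>A. w r) * (\<Prod>r\<in>S - A. 1 - w r)) = 1" if "finite S" for S
  proof -
    have "w r + (1 - w r) = 1" for r
      using diff_add_cancel_ennreal[OF w1, of r] by (simp add: add.commute)
    then show ?thesis using prod_add[OF that, of w "\<lambda>r. 1 - w r"] by (simp only: prod.neutral_const)
  qed
  have 1: "ennreal (exp t) * ((\<integral>\<^sup>+ c. (\<Prod>r\<in>points c. w r) \<partial>?P) * ?d) = 1"
    using key[of "\<lambda>_. 1"] by (simp add: one T.emeasure_space_1[simplified])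
  have "ennreal (exp t) * ((\<integral>\<^sup>+ c. (\<Prod>r\<in>points c. w r) * G (points c) \<partial>?P) * ?d) \<le> (\<integral>\<^sup>+ c. G (points c) \<partial>?P)"
    unfolding key[OF G]
  proof (rule nn_integral_mono)
    fix c :: "nat \<times> (nat \<Rightarrow> 'x)"
    have "(\<Sum>A\<in>Pow (points c). (\<Prod>r\<in>A. w r) * G A * (\<Prod>r\<in>points c - A. 1 - w r)) \<le>
       (\<Sum>A\<in>Pow (points c). G (points c) * ((\<Prod>r\<in>A. w r) * (\<Prod>r\<in>points c - A. 1 - w r)))"
    proof (rule sum_mono)
      fix A assume "A \<in> Pow (points c)"
      then have "G A \<le> G (points c)" by (intro mono) auto
      then show "(\<Prod>r\<in>A. w r) * G A * (\<Prod>r\<in>points c - A. 1 - w r) \<le>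
          G (points c) * ((\<Prod>r\<in>A. w r) * (\<Prod>r\<in>points c - A. 1 - w r))"
        using mult_right_mono[of "G A" "G (points c)" "(\<Prod>r\<in>A. w r) * (\<Prod>r\<in>points c - A. 1 - w r)"]
        by (simp add: mult_ac)
    qed
    also have "\<dots> = G (points c)"
      unfolding sum_distrib_left[symmetric] one[OF finite_points] by simp
    finally show "(\<Sum>A\<in>Pow (points c). (\<Prod>r\<in>A. w r) * G A * (\<Prod>r\<in>points c - A. 1 - w r)) \<le> G (points c)" .
  qed
  \<comment> \<open>To avoid a division of extended reals, multiply by the integral of the weights;
    after reordering, fact \<open>1\<close> removes the common factor.\<close>
  then have "(\<integral>\<^sup>+ c. (\<Prod>r\<in>points c. w r) \<partial>?P) * (ennreal (exp t) * ((\<integral>\<^sup>+ c. (\<Prod>r\<in>points c. w r) * G (points c) \<partial>?P) * ?d))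
     \<le> (\<integral>\<^sup>+ c. (\<Prod>r\<in>points c. w r) \<partial>?P) * (\<integral>\<^sup>+ c. G (points c) \<partial>?P)"
    by (rule mult_left_mono) simp
  also have "(\<integral>\<^sup>+ c. (\<Prod>r\<in>points c. w r) \<partial>?P) * (ennreal (exp t) * ((\<integral>\<^sup>+ c. (\<Prod>r\<in>points c. w r) * G (points c) \<partial>?P) * ?d))
     = (\<integral>\<^sup>+ c. (\<Prod>r\<in>points c. w r) * G (points c) \<partial>?P) * (ennreal (exp t) * ((\<integral>\<^sup>+ c. (\<Prod>r\<in>points c. w r) \<partial>?P) * ?d))"
    by (simp only: mult_ac)
  finally show ?thesis by (simp add: 1)
qed

end

section \<open>Poisson processes restricted to sets of finite measure\<close>

lemma poisson_process_count:
  assumes "poisson_process M \<mu> \<eta>" "B \<in> sets \<mu>" "emeasure \<mu> B < \<infinity>"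
  shows "measure M {\<omega>\<in>space M. num_points (\<eta> \<omega>) B = of_nat k} =
    measure \<mu> B ^ k / fact k * exp (- measure \<mu> B)"
  using assms unfolding poisson_process_def by simp

lemma poisson_process_indep:
  fixes B :: "nat \<Rightarrow> 'x set"
  assumes "poisson_process M \<mu> \<eta>" "\<And>i. i < n \<Longrightarrow> B i \<in> sets \<mu>" "disjoint_family_on B {..<n}"
  shows "prob_space.indep_vars M (\<lambda>_. borel) (\<lambda>i \<omega>. num_points (\<eta> \<omega>) (B i)) {..<n}"
proof -
  from assms(1) have "\<forall>(B :: nat \<Rightarrow> _) n. (\<forall>i<n. B i \<in> sets \<mu>) \<and> disjoint_family_on B {..<n} \<longrightarrow>
      prob_space.indep_vars M (\<lambda>_. borel) (\<lambda>i \<omega>. num_points (\<eta> \<omega>) (B i)) {..<n}"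
    unfolding poisson_process_def by (elim conjE)
  from spec[OF spec[OF this, of B], of n] show ?thesis
    by (rule mp) (use assms(2,3) in simp)
qed

section \<open>Injective tuples and boxes with disjoint sides\<close>

definition injective_tuples :: "nat \<Rightarrow> (nat \<Rightarrow> 'x) set" where
  "injective_tuples k = {x \<in> PiE {..<k} (\<lambda>_. UNIV). inj_on x {..<k}}"

text \<open>Counts of a Poisson process are independent on disjoint sets, so boxes with disjoint
  sides are those whose probabilities can be computed. They contain no tuple with a repeated entry,
  hence the restriction to injective tuples.\<close>

definition disjoint_boxes :: "nat \<Rightarrow> (nat \<Rightarrow> 'x::topological_space) set set" where
  "disjoint_boxes k = {PiE {..<k} B | B. (\<forall>i<k. B i \<in> sets borel) \<and> disjoint_family_on B {..<k}}"

definition tuple_space :: "nat \<Rightarrow> (nat \<Rightarrow> 'x::topological_space) measure" where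
  "tuple_space k = restrict_space (\<Pi>\<^sub>M i\<in>{..<k}. borel) (injective_tuples k)"

lemma Int_stable_disjoint_boxes: "Int_stable (disjoint_boxes k)"
proof (rule Int_stableI)
  fix a b :: "(nat \<Rightarrow> 'x::topological_space) set" assume "a \<in> disjoint_boxes k" "b \<in> disjoint_boxes k"
  then obtain A B where A: "a = PiE {..<k} A" "\<forall>i<k. A i \<in> sets borel" "disjoint_family_on A {..<k}"
    and B: "b = PiE {..<k} B" "\<forall>i<k. B i \<in> sets borel"
    unfolding disjoint_boxes_def by blast
  have "a \<inter> b = PiE {..<k} (\<lambda>i. A i \<inter> B i)" using A B by (simp add: PiE_Int)
  moreover have "disjoint_family_on (\<lambda>i. A i \<inter> B i) {..<k}"
    using A(3) unfolding disjoint_family_on_def by blast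
  moreover have "\<forall>i<k. A i \<inter> B i \<in> sets borel" using A(2) B(2) by auto
  ultimately show "a \<inter> b \<in> disjoint_boxes k"
    unfolding disjoint_boxes_def by auto
qed

lemma disjoint_boxes_subset: "disjoint_boxes k \<subseteq> Pow (injective_tuples k)"
proof safe
  fix b and x :: "nat \<Rightarrow> 'x::topological_space" assume "b \<in> disjoint_boxes k" "x \<in> b"
  then obtain B where B: "x \<in> PiE {..<k} B" "disjoint_family_on B {..<k}"
    unfolding disjoint_boxes_def by blast
  have "inj_on x {..<k}"
  proof (rule inj_onI, rule ccontr)
    fix i j assume ij: "i \<in> {..<k}" "j \<in> {..<k}" "x i = x j" "i \<noteq> j"
    have "x i \<in> B i" "x j \<in> B j" using PiE_mem[OF B(1)] ij(1,2) by blast+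
    then have "x i \<in> B i \<inter> B j" using ij(3) by simp
    then show False using B(2) ij by (auto simp: disjoint_family_on_def)
  qed
  then show "x \<in> injective_tuples k" using B(1) by (auto simp: injective_tuples_def PiE_iff)
qed

lemma separate_tuple:
  fixes x :: "nat \<Rightarrow> 'x::t2_space"
  assumes "inj_on x {..<k}"
  obtains U where "\<And>i. i < k \<Longrightarrow> open (U i)" "\<And>i. i < k \<Longrightarrow> x i \<in> U i" "disjoint_family_on U {..<k}"
proof -
  have "\<forall>i j. \<exists>V. i < k \<and> j < k \<and> i \<noteq> j \<longrightarrow>
      open (fst V) \<and> open (snd V) \<and> x i \<in> fst V \<and> x j \<in> snd V \<and> fst V \<inter> snd V = {}"
  proof (intro allI)
    fix i j
    show "\<exists>V. i < k \<and> j < k \<and> i \<noteq> j \<longrightarrow>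
      open (fst V) \<and> open (snd V) \<and> x i \<in> fst V \<and> x j \<in> snd V \<and> fst V \<inter> snd V = {}"
    proof (cases "i < k \<and> j < k \<and> i \<noteq> j")
      case True
      then have "x i \<noteq> x j" using assms by (auto simp: inj_on_def)
      then obtain A B where "open A" "open B" "x i \<in> A" "x j \<in> B" "A \<inter> B = {}"
        using hausdorff by metis
      then show ?thesis by (intro exI[of _ "(A, B)"]) auto
    qed auto
  qed
  then obtain V where V: "\<And>i j. i < k \<Longrightarrow> j < k \<Longrightarrow> i \<noteq> j \<Longrightarrow>
      open (fst (V i j)) \<and> open (snd (V i j)) \<and> x i \<in> fst (V i j) \<and> x j \<in> snd (V i j) \<and> fst (V i j) \<inter> snd (V i j) = {}"
    unfolding choice_iff by blast
  \<comment> \<open>\<open>V i j\<close> and \<open>V j i\<close> are chosen separately, so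
    \<open>U i\<close> is put into the first part of one and the second part of the other. Then
    \<open>V i j\<close> alone separates \<open>U i\<close> from \<open>U j\<close>.\<close>
  define U where "U i = (\<Inter>j\<in>{..<k} - {i}. fst (V i j) \<inter> snd (V j i))" for i
  show ?thesis
  proof (rule that[of U])
    show "open (U i)" if "i < k" for i
      unfolding U_def using V that by (intro open_INT) auto
    show "x i \<in> U i" if "i < k" for i
      unfolding U_def using V that by auto
    show "disjoint_family_on U {..<k}"
      unfolding disjoint_family_on_def
    proof safe
      fix i j y assume "i < k" "j < k" "i \<noteq> j" "y \<in> U i" "y \<in> U j"
      then have "y \<in> fst (V i j)" "y \<in> snd (V i j)" unfolding U_def by auto
      then show "y \<in> {}" using V[of i j] \<open>i < k\<close> \<open>j < k\<close> \<open>i \<noteq> j\<close> by blast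
    qed
  qed
qed

text \<open>Distinct points have disjoint basic neighbourhoods, and there are only countably many
  tuples of basic sets. The cover makes the set of injective tuples measurable and provides the
  countable exhaustion for the uniqueness of measures.\<close>

lemma countable_box_cover:
  obtains D :: "(nat \<Rightarrow> 'x::{second_countable_topology, t2_space}) set set"
  where "countable D" "D \<subseteq> disjoint_boxes k" "\<Union>D = injective_tuples k"
proof -
  obtain \<B> :: "'x set set" where \<B>: "countable \<B>" "topological_basis \<B>"
    using ex_countable_basis by auto
  define D where "D = PiE {..<k} ` {B \<in> PiE {..<k} (\<lambda>_. \<B>). disjoint_family_on B {..<k}}"
  have "countable (PiE {..<k} (\<lambda>_. \<B>))" using \<B>(1) by (intro countable_PiE) auto
  then have "countable {B \<in> PiE {..<k} (\<lambda>_. \<B>). disjoint_family_on B {..<k}}"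
    by (rule countable_subset[rotated]) auto
  then have "countable D" unfolding D_def by (rule countable_image)
  moreover have D: "D \<subseteq> disjoint_boxes k"
  proof -
    have "B i \<in> sets borel" if "B \<in> PiE {..<k} (\<lambda>_. \<B>)" "i < k" for B i
      using that topological_basis_open[OF \<B>(2)] by (auto simp: PiE_iff)
    then show ?thesis unfolding D_def disjoint_boxes_def by blast
  qed
  moreover have "\<Union>D = injective_tuples k"
  proof
    show "\<Union>D \<subseteq> injective_tuples k" using D disjoint_boxes_subset by blast
    show "injective_tuples k \<subseteq> \<Union>D"
    proof
      fix x :: "nat \<Rightarrow> 'x" assume x: "x \<in> injective_tuples k"
      then have "inj_on x {..<k}" by (simp add: injective_tuples_def)
      then obtain U where U: "\<And>i. i < k \<Longrightarrow> open (U i)" "\<And>i. i < k \<Longrightarrow> x i \<in> U i" "disjoint_family_on U {..<k}"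
        by (rule separate_tuple) blast
      have "\<exists>b. i < k \<longrightarrow> b \<in> \<B> \<and> x i \<in> b \<and> b \<subseteq> U i" for i
      proof (cases "i < k")
        case True
        obtain b where "b \<in> \<B>" "x i \<in> b" "b \<subseteq> U i"
          using topological_basisE[OF \<B>(2) U(1)[OF True] U(2)[OF True]] by blast
        then show ?thesis by blast
      qed auto
      then obtain b where b: "\<And>i. i < k \<Longrightarrow> b i \<in> \<B> \<and> x i \<in> b i \<and> b i \<subseteq> U i"
        by metis
      let ?b = "restrict b {..<k}"
      have "disjoint_family_on ?b {..<k}"
        unfolding disjoint_family_on_def
      proof safe
        fix i j y assume "i < k" "j < k" "i \<noteq> j" "y \<in> ?b i" "y \<in> ?b j"
        then have "y \<in> U i \<inter> U j" using b[of i] b[of j] by auto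
        then show "y \<in> {}" using U(3) \<open>i < k\<close> \<open>j < k\<close> \<open>i \<noteq> j\<close> by (auto simp: disjoint_family_on_def)
      qed
      moreover have "?b \<in> PiE {..<k} (\<lambda>_. \<B>)" using b by auto
      moreover have "x \<in> PiE {..<k} ?b" using x b by (auto simp: injective_tuples_def PiE_iff)
      ultimately show "x \<in> \<Union>D" unfolding D_def by blast
    qed
  qed
  ultimately show ?thesis by (rule that)
qed

lemma disjoint_boxes_sets:
  "b \<in> disjoint_boxes k \<Longrightarrow> b \<in> sets (\<Pi>\<^sub>M i\<in>{..<k}. (borel :: 'x::topological_space measure))"
  unfolding disjoint_boxes_def by (auto intro!: sets_PiM_I_finite)

lemma injective_tuples_sets:
  "injective_tuples k \<in> sets (\<Pi>\<^sub>M i\<in>{..<k}. (borel :: 'x::{second_countable_topology, t2_space} measure))"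
proof -
  obtain D :: "(nat \<Rightarrow> 'x) set set" where D: "countable D" "D \<subseteq> disjoint_boxes k" "\<Union>D = injective_tuples k"
    by (rule countable_box_cover)
  have "\<Union>D \<in> sets (\<Pi>\<^sub>M i\<in>{..<k}. borel)"
    using D(1,2) disjoint_boxes_sets by (intro sets.countable_Union) blast+
  then show ?thesis using D by simp
qed

text \<open>A general box, traced on the injective tuples, is the countable union of its
  intersections with the members of the cover, and these are again boxes with disjoint
  sides.\<close>

lemma sets_tuple_space:
  "sets (tuple_space k :: (nat \<Rightarrow> 'x::{second_countable_topology, t2_space}) measure) =
    sigma_sets (injective_tuples k) (disjoint_boxes k)"
proof
  let ?PM = "\<Pi>\<^sub>M i\<in>{..<k}. (borel :: 'x measure)"
  let ?st = "{(\<Pi>\<^sub>E i\<in>{..<k}. X i) |X. X \<in> (\<Pi> j\<in>{..<k}. sets (borel :: 'x measure))}"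
  have PM: "sets ?PM = sigma_sets (PiE {..<k} (\<lambda>_. UNIV)) ?st"
    by (simp add: sets_PiM prod_algebra_eq_finite)
  have eq: "sets (tuple_space k) = sigma_sets (injective_tuples k) ((\<inter>) (injective_tuples k) ` ?st)"
    unfolding tuple_space_def sets_restrict_space PM
    by (rule sigma_sets_Int) (use injective_tuples_sets[of k, where 'x = 'x] PM in \<open>auto simp: injective_tuples_def\<close>)
  obtain D :: "(nat \<Rightarrow> 'x) set set" where D: "countable D" "D \<subseteq> disjoint_boxes k" "\<Union>D = injective_tuples k"
    by (rule countable_box_cover)
  interpret sigma_algebra "injective_tuples k" "sigma_sets (injective_tuples k) (disjoint_boxes k :: (nat \<Rightarrow> 'x) set set)"
    by (rule sigma_algebra_sigma_sets[OF disjoint_boxes_subset])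
  show "sets (tuple_space k) \<subseteq> sigma_sets (injective_tuples k) (disjoint_boxes k :: (nat \<Rightarrow> 'x) set set)"
    unfolding eq
  proof (rule sigma_sets_mono, safe)
    fix X assume X: "X \<in> (\<Pi> j\<in>{..<k}. sets (borel :: 'x measure))"
    have "b \<inter> PiE {..<k} X \<in> disjoint_boxes k" if b: "b \<in> D" for b
    proof -
      obtain B where B: "b = PiE {..<k} B" "\<forall>i<k. B i \<in> sets borel" "disjoint_family_on B {..<k}"
        using b D(2) unfolding disjoint_boxes_def by blast
      have "b \<inter> PiE {..<k} X = PiE {..<k} (\<lambda>i. B i \<inter> X i)" using B by (simp add: PiE_Int)
      moreover have "disjoint_family_on (\<lambda>i. B i \<inter> X i) {..<k}"
        using B(3) unfolding disjoint_family_on_def by blast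
      moreover have "\<forall>i<k. B i \<inter> X i \<in> sets borel" using B(2) X by auto
      ultimately show ?thesis unfolding disjoint_boxes_def by auto
    qed
    then have "(\<Union>b\<in>D. b \<inter> PiE {..<k} X) \<in> sigma_sets (injective_tuples k) (disjoint_boxes k)"
      using D(1) by (intro countable_UN') auto
    also have "(\<Union>b\<in>D. b \<inter> PiE {..<k} X) = injective_tuples k \<inter> PiE {..<k} X"
      using D(3) by blast
    finally show "injective_tuples k \<inter> PiE {..<k} X \<in> sigma_sets (injective_tuples k) (disjoint_boxes k)" .
  qed
  show "sigma_sets (injective_tuples k) (disjoint_boxes k :: (nat \<Rightarrow> 'x) set set) \<subseteq> sets (tuple_space k)"
  proof -
    have "(disjoint_boxes k :: (nat \<Rightarrow> 'x) set set) \<subseteq> sets (tuple_space k)"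
    proof
      fix b :: "(nat \<Rightarrow> 'x) set" assume b: "b \<in> disjoint_boxes k"
      then have "b = injective_tuples k \<inter> b" using disjoint_boxes_subset by blast
      then show "b \<in> sets (tuple_space k)"
        unfolding tuple_space_def sets_restrict_space using disjoint_boxes_sets[OF b] by (rule image_eqI)
    qed
    then have "sigma_sets (space (tuple_space k)) (disjoint_boxes k :: (nat \<Rightarrow> 'x) set set) \<subseteq> sets (tuple_space k)"
      by (rule sets.sigma_sets_subset)
    moreover have "space (tuple_space k :: (nat \<Rightarrow> 'x) measure) = injective_tuples k"
      unfolding tuple_space_def by (auto simp: space_restrict_space space_PiM injective_tuples_def)
    ultimately show ?thesis by simp
  qed
qed

lemma space_tuple_space [simp]: "space (tuple_space k) = injective_tuples k"
  unfolding tuple_space_def by (auto simp: space_restrict_space space_PiM injective_tuples_def)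

section \<open>Enumerations of a finite set\<close>

definition tuples_in :: "nat \<Rightarrow> 'x set \<Rightarrow> (nat \<Rightarrow> 'x) set" where
  "tuples_in k S = {x \<in> PiE {..<k} (\<lambda>_. S). inj_on x {..<k}}"

lemma card_tuples_in:
  assumes "finite S" "card S = k"
  shows "card (tuples_in k S) = fact k"
proof -
  have "card (tuples_in k S) = card S ^ (card {..<k} - card {..<k}) * prod ((-) (card S)) {0..<card {..<k}}"
    unfolding tuples_in_def using assms(1) by (intro card_inj_on_subset_funcset) auto
  also have "\<dots> = (\<Prod>i = 0..<k. k - i)" using assms(2) by simp
  also have "\<dots> = fact k" by (simp add: fact_prod_rev)
  finally show ?thesis .
qed

lemma tuples_in_image:
  assumes "finite S" "card S = k" "x \<in> tuples_in k S"
  shows "x ` {..<k} = S"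
proof (rule card_subset_eq[OF assms(1)])
  show "x ` {..<k} \<subseteq> S" using assms(3) by (auto simp: tuples_in_def PiE_iff)
  show "card (x ` {..<k}) = card S" using assms by (simp add: tuples_in_def card_image)
qed

lemma num_points_finite:
  "num_points S B = of_nat k \<longleftrightarrow> finite (S \<inter> B) \<and> card (S \<inter> B) = k"
  unfolding num_points_def by (cases "finite (S \<inter> B)") (auto simp: emeasure_count_space_infinite)

text \<open>An enumeration inside the box takes its \<open>i\<close>-th point from
  \<open>B i\<close>. It exists only if every \<open>B i\<close> contains exactly one of the
  \<open>k\<close> points, and is then unique; so this cardinality is the indicator of an event
  about counts.\<close>

lemma card_tuples_in_box:
  assumes S: "finite S" "card S = k" and B: "disjoint_family_on B {..<k}"
  shows "card (tuples_in k S \<inter> PiE {..<k} B) =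
    of_bool ((\<forall>i<k. card (S \<inter> B i) = 1) \<and> S - (\<Union>i<k. B i) = {})"
proof -
  have eq: "tuples_in k S \<inter> PiE {..<k} B = PiE {..<k} (\<lambda>i. S \<inter> B i)"
  proof -
    have "inj_on x {..<k}" if "x \<in> PiE {..<k} B" for x
    proof (rule inj_onI, rule ccontr)
      fix i j assume ij: "i \<in> {..<k}" "j \<in> {..<k}" "x i = x j" "i \<noteq> j"
      have "x i \<in> B i" "x j \<in> B j" using PiE_mem[OF that] ij(1,2) by blast+
      then have "x i \<in> B i \<inter> B j" using ij(3) by simp
      then show False using B ij by (auto simp: disjoint_family_on_def)
    qed
    then show ?thesis unfolding tuples_in_def by (auto simp: PiE_iff)
  qed
  have c: "card (tuples_in k S \<inter> PiE {..<k} B) = (\<Prod>i<k. card (S \<inter> B i))"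
    unfolding eq by (subst card_PiE) auto
  have disj: "card (\<Union>i<k. S \<inter> B i) = (\<Sum>i<k. card (S \<inter> B i))"
    using S B by (intro card_UN_disjoint') (auto simp: disjoint_family_on_def)
  have le: "card (\<Union>i<k. S \<inter> B i) \<le> k"
    using card_mono[OF S(1), of "\<Union>i<k. S \<inter> B i"] S(2) by auto
  show ?thesis
  proof (cases "\<forall>i<k. card (S \<inter> B i) \<noteq> 0")
    case False
    then show ?thesis unfolding c by auto
  next
    case True
    have ge: "\<And>i. i \<in> {..<k} \<Longrightarrow> 1 \<le> card (S \<inter> B i)" using True by (auto simp: Suc_le_eq)
    \<comment> \<open>There are \<open>k\<close> disjoint nonempty parts of a set with
      \<open>k\<close> elements; equality of the sums forces every part to be a singleton.\<close>
    have "(\<Sum>i<k. card (S \<inter> B i)) = (\<Sum>i<k. 1)"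
      using sum_mono[of "{..<k}" "\<lambda>_. 1" "\<lambda>i. card (S \<inter> B i)"] ge le disj by auto
    from sum_mono_inv[OF this[symmetric] ge] have one: "card (S \<inter> B i) = 1" if "i < k" for i
      using that by simp
    have "card (\<Union>i<k. S \<inter> B i) = card S" using disj one S(2) by simp
    then have "(\<Union>i<k. S \<inter> B i) = S" using S(1) by (intro card_subset_eq) auto
    then have "S - (\<Union>i<k. B i) = {}" by auto
    then show ?thesis unfolding c using one by simp
  qed
qed

context diffuse_prob
begin

lemma nn_integral_iid_tuple:
  assumes [measurable]: "f \<in> borel_measurable (\<Pi>\<^sub>M i\<in>{..<k}. borel)"
  shows "(\<integral>\<^sup>+ x. f x \<partial>(\<Pi>\<^sub>M i\<in>{..<k}. Q)) = (\<integral>\<^sup>+ \<omega>. f (restrict \<omega> {..<k}) \<partial>iid)"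
proof -
  have "distr iid (\<Pi>\<^sub>M i\<in>{..<k}. Q) (\<lambda>\<omega>. restrict \<omega> {..<k}) = (\<Pi>\<^sub>M i\<in>{..<k}. Q)"
    using distr_PiM_reindex[of UNIV "\<lambda>_. Q" "\<lambda>i. i" "{..<k}"] prob_space_axioms by (simp add: restrict_def)
  then have "(\<integral>\<^sup>+ x. f x \<partial>(\<Pi>\<^sub>M i\<in>{..<k}. Q)) = (\<integral>\<^sup>+ x. f x \<partial>distr iid (\<Pi>\<^sub>M i\<in>{..<k}. Q) (\<lambda>\<omega>. restrict \<omega> {..<k}))"
    by simp
  also have "\<dots> = (\<integral>\<^sup>+ \<omega>. f (restrict \<omega> {..<k}) \<partial>iid)"
  proof (rule nn_integral_distr)
    show "(\<lambda>\<omega>. restrict \<omega> {..<k}) \<in> measurable iid (\<Pi>\<^sub>M i\<in>{..<k}. Q)"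
      by (rule measurable_restrict_subset) simp
    have "sets (\<Pi>\<^sub>M i\<in>{..<k}. Q) = sets (\<Pi>\<^sub>M i\<in>{..<k}. borel)" by (intro sets_PiM_cong) auto
    then show "f \<in> borel_measurable (distr iid (\<Pi>\<^sub>M i\<in>{..<k}. Q) (\<lambda>\<omega>. restrict \<omega> {..<k}))"
      using assms by (simp cong: measurable_cong_sets)
  qed
  finally show ?thesis .
qed

text \<open>Conditionally on having \<open>k\<close> points in \<open>\<Lambda>\<close>, a Poisson process looks like \<open>k\<close> i.i.d. points: the
  law of a uniformly random enumeration of the points is identified on disjoint boxes, where only
  the numbers of points matter.\<close>

lemma poisson_process_restrict_card:
  fixes M :: "'w measure" and F :: "'x set \<Rightarrow> ennreal" and k :: nat
  assumes pp: "poisson_process M \<mu> \<eta>" and sets_\<mu>: "sets \<mu> = sets borel" and t: "0 \<le> t"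
    and \<Lambda>: "\<Lambda> \<in> sets borel" and \<mu>Q: "\<forall>B\<in>sets borel. emeasure \<mu> (\<Lambda> \<inter> B) = ennreal t * emeasure Q B"
    and F: "(\<lambda>c. F (points c)) \<in> borel_measurable config_space"
  defines "g \<equiv> \<lambda>\<omega>. if finite (\<eta> \<omega> \<inter> \<Lambda>) \<and> card (\<eta> \<omega> \<inter> \<Lambda>) = k then F (\<eta> \<omega> \<inter> \<Lambda>) else 0"
  shows "g \<in> borel_measurable M"
    and "(\<integral>\<^sup>+ \<omega>. g \<omega> \<partial>M) = poisson_weight t k * (\<integral>\<^sup>+ \<omega>. F (\<omega> ` {..<k}) \<partial>iid)"
proof -
  interpret M: prob_space M using pp by (simp add: poisson_process_def)
  let ?T = "tuple_space k :: (nat \<Rightarrow> 'x) measure" and ?\<Omega> = "injective_tuples k :: (nat \<Rightarrow> 'x) set"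
  let ?S = "\<lambda>\<omega>. \<eta> \<omega> \<inter> \<Lambda>"
  let ?ev = "\<lambda>B. {\<omega>\<in>space M. (\<forall>i<k. num_points (\<eta> \<omega>) (\<Lambda> \<inter> B i) = 1) \<and> num_points (\<eta> \<omega>) (\<Lambda> - (\<Union>i<k. B i)) = 0}"
  have num: "(\<lambda>\<omega>. num_points (\<eta> \<omega>) B) \<in> borel_measurable M" if "B \<in> sets borel" for B
    using pp that sets_\<mu> by (simp add: poisson_process_def)
  define E where "E \<omega> \<longleftrightarrow> finite (?S \<omega>) \<and> card (?S \<omega>) = k" for \<omega>
  have E_num: "E \<omega> \<longleftrightarrow> num_points (\<eta> \<omega>) \<Lambda> = of_nat k" for \<omega> by (simp add: E_def num_points_finite)
  have [measurable]: "Measurable.pred M E" unfolding E_num using num[OF \<Lambda>] by measurable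
  \<comment> \<open>The conditional law of a uniformly random enumeration of the points in
    \<open>\<Lambda>\<close>. The null measure off \<open>E\<close> makes \<open>K\<close> a
    subprobability kernel defined for every outcome and discards the other cardinalities.\<close>
  define K where "K \<omega> = (if E \<omega> then distr (uniform_count_measure (tuples_in k (?S \<omega>))) ?T (\<lambda>x. x) else null_measure ?T)" for \<omega>
  have fin_tuples: "finite (tuples_in k S)" if "finite S" for S :: "'x set"
    unfolding tuples_in_def
    by (rule finite_subset[OF _ finite_PiE[of "{..<k}" "\<lambda>_. S"]]) (use that in auto)
  have tup_sub: "tuples_in k S \<subseteq> ?\<Omega>" for S :: "'x set"
    unfolding tuples_in_def injective_tuples_def by (auto simp: PiE_iff)
  have id: "(\<lambda>x. x) \<in> measurable (uniform_count_measure (tuples_in k S)) ?T" for S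
    using tup_sub by (auto simp: measurable_def space_uniform_count_measure sets_uniform_count_measure)
  \<comment> \<open>Subprobability spaces must be nonempty; the almost surely injective i.i.d.
    sequences provide \<open>k\<close> distinct points.\<close>
  have nonempty: "?\<Omega> \<noteq> {}"
  proof -
    have "\<exists>\<omega>. inj (\<omega> :: nat \<Rightarrow> 'x)"
    proof (rule ccontr)
      assume "\<not> ?thesis"
      then have "AE \<omega> in iid. False" using AE_iid_inj by simp
      then show False using iid.AE_False by simp
    qed
    then obtain \<omega> :: "nat \<Rightarrow> 'x" where "inj \<omega>" by auto
    then have "restrict \<omega> {..<k} \<in> ?\<Omega>" by (auto simp: injective_tuples_def inj_on_def)
    then show ?thesis by auto
  qed
  have emK: "emeasure (K \<omega>) A = (if E \<omega> then of_nat (card (tuples_in k (?S \<omega>) \<inter> A)) / of_nat (fact k) else 0)"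
    if A: "A \<in> sets ?T" for A \<omega>
  proof (cases "E \<omega>")
    case True
    then have S: "finite (?S \<omega>)" "card (?S \<omega>) = k" by (auto simp: E_def)
    have "emeasure (K \<omega>) A = emeasure (uniform_count_measure (tuples_in k (?S \<omega>))) (A \<inter> tuples_in k (?S \<omega>))"
      using True A by (simp add: K_def emeasure_distr[OF id] space_uniform_count_measure)
    also have "\<dots> = of_nat (card (tuples_in k (?S \<omega>) \<inter> A)) / of_nat (fact k)"
    proof -
      have "0 < (fact k :: real)" by simp
      then show ?thesis
      using S fin_tuples[OF S(1)]
      by (simp add: emeasure_uniform_count_measure card_tuples_in Int_commute divide_ennreal[symmetric]
          ennreal_of_nat_eq_real_of_nat)
    qed
    finally show ?thesis using True by simp
  qed (simp add: K_def)
  have prob_K: "prob_space (K \<omega>)" if "E \<omega>" for \<omega>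
  proof -
    have S: "finite (?S \<omega>)" "card (?S \<omega>) = k" using that by (auto simp: E_def)
    have "tuples_in k (?S \<omega>) \<noteq> {}" using card_tuples_in[OF S] by auto
    then have "prob_space (uniform_count_measure (tuples_in k (?S \<omega>)))"
      using fin_tuples[OF S(1)] by (intro prob_space_uniform_count_measure)
    then show ?thesis using that id by (simp add: K_def prob_space.prob_space_distr)
  qed
  have subprob_K: "subprob_space (K \<omega>)" for \<omega>
  proof (cases "E \<omega>")
    case True
    then show ?thesis using prob_K prob_space_imp_subprob_space by blast
  next
    case False
    then show ?thesis using nonempty by (intro subprob_spaceI) (auto simp: K_def)
  qed
  have sets_K: "sets (K \<omega>) = sets ?T" for \<omega> by (simp add: K_def)
  have box_event: "(if E \<omega> then of_nat (card (tuples_in k (?S \<omega>) \<inter> PiE {..<k} B)) else 0) =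
      (indicator (?ev B) \<omega> :: ennreal)"
    if B: "disjoint_family_on B {..<k}" and \<omega>: "\<omega> \<in> space M" for B \<omega>
  proof -
    have 1: "num_points (\<eta> \<omega>) (\<Lambda> \<inter> B i) = 1 \<longleftrightarrow> finite (?S \<omega> \<inter> B i) \<and> card (?S \<omega> \<inter> B i) = 1" for i
      using num_points_finite[of "\<eta> \<omega>" "\<Lambda> \<inter> B i" 1] by (simp add: Int_assoc)
    have 2: "num_points (\<eta> \<omega>) (\<Lambda> - (\<Union>i<k. B i)) = 0 \<longleftrightarrow> ?S \<omega> - (\<Union>i<k. B i) = {}"
    proof -
      have "\<eta> \<omega> \<inter> (\<Lambda> - (\<Union>i<k. B i)) = ?S \<omega> - (\<Union>i<k. B i)" by auto
      then show ?thesis by (simp add: num_points_def emeasure_count_space_eq_0)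
    qed
    show ?thesis
    proof (cases "E \<omega>")
      case True
      then have S: "finite (?S \<omega>)" "card (?S \<omega>) = k" by (auto simp: E_def)
      show ?thesis using True S(1) \<omega> unfolding card_tuples_in_box[OF S B] by (auto simp: 1 2 split: split_indicator)
    next
      case False
      have "E \<omega>" if *: "\<forall>i<k. card (?S \<omega> \<inter> B i) = 1" "?S \<omega> - (\<Union>i<k. B i) = {}" "\<forall>i<k. finite (?S \<omega> \<inter> B i)"
      proof -
        have "?S \<omega> = (\<Union>i<k. ?S \<omega> \<inter> B i)" using *(2) by auto
        moreover have "disjoint_family_on (\<lambda>i. ?S \<omega> \<inter> B i) {..<k}"
          using B unfolding disjoint_family_on_def by blast
        then have "card (\<Union>i<k. ?S \<omega> \<inter> B i) = (\<Sum>i<k. card (?S \<omega> \<inter> B i))"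
          using *(3) by (intro card_UN_disjoint') auto
        moreover have "finite (\<Union>i<k. ?S \<omega> \<inter> B i)" using *(3) by (intro finite_UN_I) auto
        ultimately show ?thesis unfolding E_def using *(1) by simp
      qed
      then show ?thesis using False by (auto simp: 1 2 split: split_indicator)
    qed
  qed
  have event_sets: "?ev B \<in> sets M"
    if "\<forall>i<k. B i \<in> sets borel" for B
  proof -
    have 1: "{\<omega>\<in>space M. num_points (\<eta> \<omega>) C = c} \<in> sets M" if "C \<in> sets borel" for C c
      using pred_eq_borel[OF num[OF that], of "\<lambda>_. c"] by (simp add: pred_def)
    have a: "{\<omega>\<in>space M. \<forall>i\<in>{..<k}. num_points (\<eta> \<omega>) (\<Lambda> \<inter> B i) = 1} \<in> sets M"
      using that \<Lambda> by (intro sets.sets_Collect_finite_All 1) auto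
    have b: "{\<omega>\<in>space M. num_points (\<eta> \<omega>) (\<Lambda> - (\<Union>i<k. B i)) = 0} \<in> sets M"
      using that \<Lambda> by (intro 1 sets.Diff sets.finite_UN) auto
    have "?ev B =
      {\<omega>\<in>space M. \<forall>i\<in>{..<k}. num_points (\<eta> \<omega>) (\<Lambda> \<inter> B i) = 1} \<inter>
      {\<omega>\<in>space M. num_points (\<eta> \<omega>) (\<Lambda> - (\<Union>i<k. B i)) = 0}" by blast
    then show ?thesis using sets.Int[OF a b] by (simp only:)
  qed
  \<comment> \<open>It suffices to test a generator. On a box with disjoint sides the mass is an
    indicator determined by counts, divided by \<open>fact k\<close>, and counts are
    measurable.\<close>
  have K: "K \<in> measurable M (subprob_algebra ?T)"
  proof (rule measurable_subprob_algebra_generated[OF sets_tuple_space Int_stable_disjoint_boxes disjoint_boxes_subset])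
    show "subprob_space (K \<omega>)" "sets (K \<omega>) = sets ?T" for \<omega> by (fact subprob_K sets_K)+
    show "(\<lambda>\<omega>. emeasure (K \<omega>) ?\<Omega>) \<in> borel_measurable M"
    proof -
      have "emeasure (K \<omega>) ?\<Omega> = (if E \<omega> then 1 else 0)" for \<omega>
        using prob_space.emeasure_space_1[OF prob_K] sets_eq_imp_space_eq[OF sets_K] by (auto simp: K_def)
      then show ?thesis by simp
    qed
    fix A :: "(nat \<Rightarrow> 'x) set" assume A: "A \<in> disjoint_boxes k"
    then obtain B where B: "A = PiE {..<k} B" "\<forall>i<k. B i \<in> sets borel" "disjoint_family_on B {..<k}"
      unfolding disjoint_boxes_def by blast
    have AT: "A \<in> sets ?T" unfolding sets_tuple_space using A by auto
    have "(\<lambda>\<omega>. indicator (?ev B) \<omega> * inverse (of_nat (fact k)) :: ennreal) \<in> borel_measurable M"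
      by (intro borel_measurable_times_ennreal borel_measurable_indicator event_sets[OF B(2)]) simp
    also have "?this \<longleftrightarrow> (\<lambda>\<omega>. emeasure (K \<omega>) A) \<in> borel_measurable M"
    proof (rule measurable_cong)
      fix \<omega> assume "\<omega> \<in> space M"
      from box_event[OF B(3) this] show "indicator (?ev B) \<omega> * inverse (of_nat (fact k)) = emeasure (K \<omega>) A"
        unfolding emK[OF AT] unfolding B(1) by (auto simp: divide_ennreal_def simp del: of_nat_fact)
    qed
    finally show "(\<lambda>\<omega>. emeasure (K \<omega>) A) \<in> borel_measurable M" .
  qed
  have prob_event: "emeasure M (?ev B)
      = ennreal (exp (- t) * t ^ k) * (\<Prod>i<k. emeasure Q (B i))"
    if B: "\<forall>i<k. B i \<in> sets borel" "disjoint_family_on B {..<k}" for B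
  proof -
    \<comment> \<open>The region outside the boxes is added with index \<open>k\<close> and count 0.
      The sets \<open>B' i\<close> for \<open>i < Suc k\<close> then partition the space, so that
      the exponentials of the Poisson probabilities multiply to \<open>exp (- t)\<close>.\<close>
    define C where "C i = (if i < k then \<Lambda> \<inter> B i else \<Lambda> - (\<Union>i<k. B i))" for i
    define B' where "B' i = (if i < k then B i else - (\<Union>i<k. B i))" for i
    define n where "n i = (if i < k then 1 else 0 :: nat)" for i :: nat
    have U: "- (\<Union>i<k. B i) \<in> sets borel"
      using B(1) by (intro borel_comp sets.finite_UN) auto
    have B': "B' i \<in> sets borel" for i using B(1) U by (simp add: B'_def)
    have C_eq: "C i = \<Lambda> \<inter> B' i" for i by (auto simp: C_def B'_def)
    have C: "C i \<in> sets borel" for i unfolding C_eq using \<Lambda> B' by (rule sets.Int)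
    have \<mu>C: "emeasure \<mu> (C i) = ennreal (t * prob (B' i))" for i
      unfolding C_eq using bspec[OF \<mu>Q B'] t by (simp add: emeasure_eq_measure ennreal_mult)
    then have \<mu>C': "measure \<mu> (C i) = t * prob (B' i)" for i
      using t by (simp add: measure_def)
    have disj: "disjoint_family_on C {..<Suc k}"
      using B(2) unfolding disjoint_family_on_def C_def by auto
    have indep: "M.indep_vars (\<lambda>_. borel) (\<lambda>i \<omega>. num_points (\<eta> \<omega>) (C i)) {..<Suc k}"
      using C sets_\<mu> by (intro poisson_process_indep[OF pp _ disj]) simp
    have single: "M.prob ((\<lambda>\<omega>. num_points (\<eta> \<omega>) (C i)) -` {of_nat (n i)} \<inter> space M) =
        (t * prob (B' i)) ^ n i * exp (- (t * prob (B' i)))" for i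
    proof -
      have "(\<lambda>\<omega>. num_points (\<eta> \<omega>) (C i)) -` {of_nat (n i)} \<inter> space M = {\<omega>\<in>space M. num_points (\<eta> \<omega>) (C i) = of_nat (n i)}"
        by auto
      moreover have "M.prob {\<omega>\<in>space M. num_points (\<eta> \<omega>) (C i) = of_nat (n i)} =
          measure \<mu> (C i) ^ n i / fact (n i) * exp (- measure \<mu> (C i))"
        using C sets_\<mu> \<mu>C[of i] by (intro poisson_process_count[OF pp]) simp_all
      ultimately show ?thesis by (simp add: \<mu>C' n_def)
    qed
    have eq: "?ev B =
        (\<Inter>i\<in>{..<Suc k}. (\<lambda>\<omega>. num_points (\<eta> \<omega>) (C i)) -` {of_nat (n i)} \<inter> space M)"
    proof -
      have "(\<forall>i<Suc k. num_points (\<eta> \<omega>) (C i) = of_nat (n i)) \<longleftrightarrow>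
          (\<forall>i<k. num_points (\<eta> \<omega>) (\<Lambda> \<inter> B i) = 1) \<and> num_points (\<eta> \<omega>) (\<Lambda> - (\<Union>i<k. B i)) = 0" for \<omega>
        unfolding All_less_Suc by (auto simp: C_def n_def)
      then show ?thesis by auto
    qed
    then have "M.prob (?ev B) =
        (\<Prod>i<Suc k. (t * prob (B' i)) ^ n i * exp (- (t * prob (B' i))))"
    proof -
      have "M.prob (\<Inter>i\<in>{..<Suc k}. (\<lambda>\<omega>. num_points (\<eta> \<omega>) (C i)) -` {of_nat (n i)} \<inter> space M) =
          (\<Prod>i<Suc k. M.prob ((\<lambda>\<omega>. num_points (\<eta> \<omega>) (C i)) -` {of_nat (n i)} \<inter> space M))"
        by (rule M.indep_varsD_finite[OF indep]) auto
      then show ?thesis by (simp only: eq single)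
    qed
    also have "\<dots> = (\<Prod>i<Suc k. (t * prob (B' i)) ^ n i) * exp (- (t * (\<Sum>i<Suc k. prob (B' i))))"
    proof -
      have "(\<Prod>i<Suc k. exp (- (t * prob (B' i)))) = exp (\<Sum>i<Suc k. - (t * prob (B' i)))"
        by (rule exp_sum[symmetric]) simp
      then show ?thesis by (simp only: prod.distrib sum_negf sum_distrib_left)
    qed
    also have "(\<Sum>i<Suc k. prob (B' i)) = prob (\<Union>i<Suc k. B' i)"
    proof (rule finite_measure_finite_Union[symmetric])
      show "disjoint_family_on B' {..<Suc k}"
        using B(2) unfolding disjoint_family_on_def B'_def by auto
    qed (use B' in auto)
    also have "(\<Union>i<Suc k. B' i) = UNIV" by (auto simp: B'_def less_Suc_eq)
    also have "prob UNIV = 1" using prob_space by simp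
    also have "(\<Prod>i<Suc k. (t * prob (B' i)) ^ n i) = t ^ k * (\<Prod>i<k. prob (B i))"
      by (simp add: n_def B'_def prod.distrib)
    finally have "M.prob (?ev B) =
      exp (- t) * t ^ k * (\<Prod>i<k. prob (B i))" by (simp add: mult_ac)
    then show ?thesis
      using t by (simp add: M.emeasure_eq_measure emeasure_eq_measure prod_ennreal ennreal_mult prod_nonneg)
  qed
  let ?PQ = "\<Pi>\<^sub>M i\<in>{..<k}. Q"
  have sets_PQ: "sets ?PQ = sets (\<Pi>\<^sub>M i\<in>{..<k}. borel)" by (intro sets_PiM_cong) auto
  interpret PQ: prob_space ?PQ by (intro prob_space_PiM prob_space_axioms)
  have \<Omega>PQ: "?\<Omega> \<inter> space ?PQ \<in> sets ?PQ"
    using injective_tuples_sets sets_PQ by (metis sets.Int_space_eq2)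
  \<comment> \<open>The law of \<open>k\<close> i.i.d. points with the Poisson weight as total mass.
    The factor \<open>1 / fact k\<close> of the weight arises from the uniform choice among the
    enumerations, so \<open>M \<bind> K\<close> and \<open>N\<close> agree on disjoint
    boxes.\<close>
  define N where "N = scale_measure (poisson_weight t k) (restrict_space ?PQ ?\<Omega>)"
  have sets_N: "sets N = sets ?T"
    unfolding N_def tuple_space_def by (simp add: sets_restrict_space sets_PQ)
  have bind_eq: "M \<bind> K = N"
  proof -
    obtain D :: "(nat \<Rightarrow> 'x) set set" where D: "countable D" "D \<subseteq> disjoint_boxes k" "\<Union>D = injective_tuples k"
      by (rule countable_box_cover)
    have sb: "sets (M \<bind> K) = sets ?T"
      by (rule sets_bind[OF sets_K M.not_empty])
    show ?thesis
    proof (rule measure_eqI_generator_eq_countable[OF Int_stable_disjoint_boxes disjoint_boxes_subset _ _ _ D(2,3,1)])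
      show "sets (M \<bind> K) = sigma_sets (injective_tuples k) (disjoint_boxes k)"
        "sets N = sigma_sets (injective_tuples k) (disjoint_boxes k)"
        using sb sets_N by (simp_all add: sets_tuple_space)
      show "emeasure (M \<bind> K) a \<noteq> \<infinity>" for a
      proof -
        have "subprob_space (M \<bind> K)"
          by (rule subprob_space_bind[OF prob_space_imp_subprob_space[OF M.prob_space_axioms] K])
        then show ?thesis by (simp add: subprob_space.subprob_emeasure_le_1 subprob_space_def finite_measure.emeasure_finite)
      qed
      fix A :: "(nat \<Rightarrow> 'x) set" assume A: "A \<in> disjoint_boxes k"
      then obtain B where B: "A = PiE {..<k} B" "\<forall>i<k. B i \<in> sets borel" "disjoint_family_on B {..<k}"
        unfolding disjoint_boxes_def by blast
      have AT: "A \<in> sets ?T" unfolding sets_tuple_space using A by auto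
        have "emeasure (M \<bind> K) A = (\<integral>\<^sup>+ \<omega>. emeasure (K \<omega>) A \<partial>M)"
        by (rule emeasure_bind[OF M.not_empty K AT])
      also have "\<dots> = (\<integral>\<^sup>+ \<omega>. indicator (?ev B) \<omega> / of_nat (fact k) \<partial>M)"
      proof (rule nn_integral_cong)
        fix \<omega> assume "\<omega> \<in> space M"
        from box_event[OF B(3) this] show "emeasure (K \<omega>) A = indicator (?ev B) \<omega> / of_nat (fact k)"
          unfolding emK[OF AT] unfolding B(1) by (auto simp del: of_nat_fact)
      qed
      also have "\<dots> = emeasure M (?ev B) / of_nat (fact k)"
        using event_sets[OF B(2)]
        by (simp only: divide_ennreal_def nn_integral_multc[OF borel_measurable_indicator] nn_integral_indicator)
      also have "\<dots> = ennreal (exp (- t) * t ^ k) / of_nat (fact k) * (\<Prod>i<k. emeasure Q (B i))"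
        unfolding prob_event[OF B(2,3)] by (simp only: divide_ennreal_def mult_ac)
      also have "ennreal (exp (- t) * t ^ k) / of_nat (fact k) = poisson_weight t k"
      proof -
        have "(of_nat (fact k) :: ennreal) = ennreal (fact k)"
          using ennreal_of_nat_eq_real_of_nat[of "fact k"] by simp
        then show ?thesis unfolding poisson_weight_def using t by (simp add: divide_ennreal del: of_nat_fact)
      qed
      also have "(\<Prod>i<k. emeasure Q (B i)) = emeasure ?PQ A"
        unfolding B(1) using B(2) by (subst iid.emeasure_PiM) auto
      also have "poisson_weight t k * emeasure ?PQ A = emeasure N A"
        unfolding N_def using A disjoint_boxes_subset \<Omega>PQ by (subst emeasure_scale_measure, subst emeasure_restrict_space) auto
      finally show "emeasure (M \<bind> K) A = emeasure N A" .
    qed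
  qed
  define f where "f x = F (x ` {..<k})" for x :: "nat \<Rightarrow> 'x"
  have f: "f \<in> borel_measurable (\<Pi>\<^sub>M i\<in>{..<k}. borel)"
  proof -
    have m: "(\<lambda>x. (k, \<lambda>i. if i < k then x i else undefined)) \<in> measurable (\<Pi>\<^sub>M i\<in>{..<k}. borel) (config_space :: (nat \<times> (nat \<Rightarrow> 'x)) measure)"
      unfolding config_space_def
    proof (intro measurable_Pair measurable_abs_UNIV)
      show "(\<lambda>x. if i < k then x i else undefined) \<in> borel_measurable (\<Pi>\<^sub>M i\<in>{..<k}. (borel :: 'x measure))" for i
        by (cases "i < k") auto
    qed auto
    have im: "(\<lambda>i. if i < k then x i else undefined) ` {..<k} = x ` {..<k}" for x :: "nat \<Rightarrow> 'x"
      by (intro image_cong) auto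
    show ?thesis
      using measurable_compose[OF m F] by (simp only: f_def[abs_def] points_def fst_conv snd_conv im)
  qed
  have fT: "f \<in> borel_measurable ?T"
    unfolding tuple_space_def by (rule measurable_restrict_space1[OF f])
  \<comment> \<open>Every enumeration in \<open>tuples_in k\<close> has the whole point set as its
    image, and \<open>F\<close> depends only on that set; averaging over \<open>K\<close> therefore
    recovers \<open>g\<close>.\<close>
  have g_eq: "g \<omega> = (\<integral>\<^sup>+ x. f x \<partial>K \<omega>)" for \<omega>
  proof (cases "E \<omega>")
    case True
    then have S: "finite (?S \<omega>)" "card (?S \<omega>) = k" by (auto simp: E_def)
    interpret U: prob_space "uniform_count_measure (tuples_in k (?S \<omega>))"
      using fin_tuples[OF S(1)] card_tuples_in[OF S] by (intro prob_space_uniform_count_measure) auto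
    have "(\<integral>\<^sup>+ x. f x \<partial>K \<omega>) = (\<integral>\<^sup>+ x. f x \<partial>uniform_count_measure (tuples_in k (?S \<omega>)))"
    proof -
      have "f \<in> borel_measurable (distr (uniform_count_measure (tuples_in k (?S \<omega>))) ?T (\<lambda>x. x))"
        using fT by (simp only: measurable_distr_eq1)
      then show ?thesis using True by (simp only: K_def if_True nn_integral_distr[OF id])
    qed
    also have "\<dots> = (\<integral>\<^sup>+ x. F (?S \<omega>) \<partial>uniform_count_measure (tuples_in k (?S \<omega>)))"
      by (intro nn_integral_cong) (simp add: f_def space_uniform_count_measure tuples_in_image[OF S])
    also have "\<dots> = F (?S \<omega>)" by (simp add: U.emeasure_space_1)
    finally show ?thesis using True by (simp add: g_def E_def)
  next
    case False
    then show ?thesis by (auto simp: g_def E_def K_def)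
  qed
  show "g \<in> borel_measurable M"
    unfolding g_eq using measurable_compose[OF K nn_integral_measurable_subprob_algebra[OF fT]] by simp
  have "(\<integral>\<^sup>+ \<omega>. g \<omega> \<partial>M) = (\<integral>\<^sup>+ x. f x \<partial>(M \<bind> K))"
    unfolding g_eq by (rule nn_integral_bind[OF fT K, symmetric])
  also have "\<dots> = poisson_weight t k * (\<integral>\<^sup>+ x. f x \<partial>restrict_space ?PQ ?\<Omega>)"
    unfolding bind_eq N_def
  proof (rule nn_integral_scale_measure)
    have "sets (restrict_space ?PQ ?\<Omega>) = sets ?T" unfolding tuple_space_def by (simp add: sets_restrict_space sets_PQ)
    then show "f \<in> borel_measurable (restrict_space ?PQ ?\<Omega>)" using fT by (simp cong: measurable_cong_sets)
  qed
  also have "(\<integral>\<^sup>+ x. f x \<partial>restrict_space ?PQ ?\<Omega>) = (\<integral>\<^sup>+ x. f x * indicator ?\<Omega> x \<partial>?PQ)"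
    by (rule nn_integral_restrict_space[OF \<Omega>PQ])
  also have "\<dots> = (\<integral>\<^sup>+ \<omega>. f (restrict \<omega> {..<k}) * indicator ?\<Omega> (restrict \<omega> {..<k}) \<partial>iid)"
    using injective_tuples_sets[of k, where 'x = 'x] f
    by (intro nn_integral_iid_tuple borel_measurable_times_ennreal borel_measurable_indicator)
  also have "\<dots> = (\<integral>\<^sup>+ \<omega>. F (\<omega> ` {..<k}) \<partial>iid)"
  proof (rule nn_integral_cong_AE, use AE_iid_inj in eventually_elim)
    fix \<omega> :: "nat \<Rightarrow> 'x" assume "inj \<omega>"
    then have "restrict \<omega> {..<k} \<in> ?\<Omega>" by (auto simp: injective_tuples_def inj_on_def)
    then show "f (restrict \<omega> {..<k}) * indicator ?\<Omega> (restrict \<omega> {..<k}) = F (\<omega> ` {..<k})"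
      by (simp add: f_def)
  qed
  finally show "(\<integral>\<^sup>+ \<omega>. g \<omega> \<partial>M) = poisson_weight t k * (\<integral>\<^sup>+ \<omega>. F (\<omega> ` {..<k}) \<partial>iid)" .
qed

text \<open>The cardinalities split the event that \<open>\<Lambda>\<close> contains finitely many
  points. The default 0 off this event is harmless, because the event is almost sure by
  \<open>AE_poisson_process_finite\<close>.\<close>

theorem poisson_process_restrict:
  fixes M :: "'w measure" and F :: "'x set \<Rightarrow> ennreal"
  assumes pp: "poisson_process M \<mu> \<eta>" and sets_\<mu>: "sets \<mu> = sets borel" and t: "0 \<le> t"
    and \<Lambda>: "\<Lambda> \<in> sets borel" and \<mu>Q: "\<forall>B\<in>sets borel. emeasure \<mu> (\<Lambda> \<inter> B) = ennreal t * emeasure Q B"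
    and F: "(\<lambda>c. F (points c)) \<in> borel_measurable config_space"
  shows "(\<lambda>\<omega>. if finite (\<eta> \<omega> \<inter> \<Lambda>) then F (\<eta> \<omega> \<inter> \<Lambda>) else 0) \<in> borel_measurable M"
    and "(\<integral>\<^sup>+ \<omega>. (if finite (\<eta> \<omega> \<inter> \<Lambda>) then F (\<eta> \<omega> \<inter> \<Lambda>) else 0) \<partial>M) = (\<integral>\<^sup>+ c. F (points c) \<partial>poisson_config Q t)"
proof -
  let ?g = "\<lambda>k \<omega>. if finite (\<eta> \<omega> \<inter> \<Lambda>) \<and> card (\<eta> \<omega> \<inter> \<Lambda>) = k then F (\<eta> \<omega> \<inter> \<Lambda>) else 0"
  note restrict = poisson_process_restrict_card[OF pp sets_\<mu> t \<Lambda> \<mu>Q F]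
  have sum: "(if finite (\<eta> \<omega> \<inter> \<Lambda>) then F (\<eta> \<omega> \<inter> \<Lambda>) else 0) = (\<Sum>k. ?g k \<omega>)" for \<omega>
  proof -
    have "(\<Sum>k. ?g k \<omega>) = (\<Sum>k\<in>{card (\<eta> \<omega> \<inter> \<Lambda>)}. ?g k \<omega>)" by (rule suminf_finite) auto
    then show ?thesis by simp
  qed
  show "(\<lambda>\<omega>. if finite (\<eta> \<omega> \<inter> \<Lambda>) then F (\<eta> \<omega> \<inter> \<Lambda>) else 0) \<in> borel_measurable M"
    unfolding sum using restrict(1) by measurable
  show "(\<integral>\<^sup>+ \<omega>. (if finite (\<eta> \<omega> \<inter> \<Lambda>) then F (\<eta> \<omega> \<inter> \<Lambda>) else 0) \<partial>M) = (\<integral>\<^sup>+ c. F (points c) \<partial>poisson_config Q t)"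
    unfolding sum nn_integral_poisson_config[OF F] using restrict
    by (subst nn_integral_suminf) (auto simp: points_def)
qed

text \<open>For \<open>F = 1\<close> the restriction theorem gives the event of finitely many points
  the total mass of \<open>poisson_config\<close>, which is one.\<close>

lemma AE_poisson_process_finite:
  fixes M :: "'w measure"
  assumes pp: "poisson_process M \<mu> \<eta>" and sets_\<mu>: "sets \<mu> = sets borel" and t: "0 \<le> t"
    and \<Lambda>: "\<Lambda> \<in> sets borel" and \<mu>Q: "\<forall>B\<in>sets borel. emeasure \<mu> (\<Lambda> \<inter> B) = ennreal t * emeasure Q B"
  shows "AE \<omega> in M. finite (\<eta> \<omega> \<inter> \<Lambda>)"
proof -
  interpret M: prob_space M using pp by (simp add: poisson_process_def)
  interpret T: prob_space "poisson_config Q t" using t by (rule prob_space_poisson_config)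
  let ?A = "{\<omega>\<in>space M. finite (\<eta> \<omega> \<inter> \<Lambda>)}"
  note r = poisson_process_restrict[OF pp sets_\<mu> t \<Lambda> \<mu>Q, of "\<lambda>_. 1"]
  have "(\<lambda>\<omega>. if finite (\<eta> \<omega> \<inter> \<Lambda>) then 1 else 0 :: ennreal) -` {1} \<inter> space M \<in> sets M"
    using r(1) by (rule measurable_sets) auto
  also have "(\<lambda>\<omega>. if finite (\<eta> \<omega> \<inter> \<Lambda>) then 1 else 0 :: ennreal) -` {1} \<inter> space M = ?A"
    by (auto split: if_splits)
  finally have A: "?A \<in> sets M" .
  have "emeasure M ?A = (\<integral>\<^sup>+ \<omega>. indicator ?A \<omega> \<partial>M)" using A by simp
  also have "\<dots> = (\<integral>\<^sup>+ \<omega>. (if finite (\<eta> \<omega> \<inter> \<Lambda>) then 1 else 0) \<partial>M)"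
    by (intro nn_integral_cong) auto
  also have "\<dots> = 1" using r(2) T.emeasure_space_1 by simp
  finally have "M.prob ?A = 1" by (simp add: measure_def)
  then show ?thesis using M.prob_Collect_eq_1[of "\<lambda>\<omega>. finite (\<eta> \<omega> \<inter> \<Lambda>)"] A by simp
qed

end

section \<open>Mean cluster sizes at two intensities\<close>

lemma random_finite_set_const:
  "finite A \<Longrightarrow> random_finite_set N (\<lambda>_. A :: 'x::{second_countable_topology, t2_space} set)"
  by (induction A rule: finite_induct) (auto intro: random_finite_set_empty random_finite_set_insert)

locale poisson_kernel = diffuse_prob Q + measurable_kernel \<phi>
  for Q :: "'x::{second_countable_topology, t2_space} measure" and \<phi> :: "'x \<Rightarrow> 'x \<Rightarrow> real"
begin

definition poisson_mean :: "real \<Rightarrow> 'x \<Rightarrow> ennreal" where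
  "poisson_mean t x = (\<integral>\<^sup>+ c. mean_size (insert x (points c)) x \<partial>poisson_config Q t)"

section \<open>Measurability of the functionals in the exploration\<close>

lemma measurable_mean_size_insert:
  assumes S: "random_finite_set N S" and f: "f \<in> borel_measurable N"
  shows "(\<lambda>n. mean_size (insert (f n) (S n)) (f n)) \<in> borel_measurable N"
  by (intro measurable_mean_size random_finite_set_insert S f) simp

lemma measurable_isolation_prod:
  assumes R: "random_finite_set N R" and B: "random_finite_set N B"
  shows "(\<lambda>n. \<Prod>r\<in>R n. isolation (B n) r) \<in> borel_measurable N"
proof (rule random_finite_set_prod[OF R])
  have "random_finite_set (N \<Otimes>\<^sub>M borel) (\<lambda>p. B (fst p))"
    by (rule random_finite_set_compose[OF B]) simp
  then have "(\<lambda>p. isolation (B (fst p)) (snd p)) \<in> borel_measurable (N \<Otimes>\<^sub>M borel)"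
    by (rule measurable_isolation) simp
  then show "(\<lambda>(n, r). isolation (B n) r) \<in> borel_measurable (N \<Otimes>\<^sub>M borel)"
    by (simp add: split_beta')
qed

lemma measurable_kernel_sum:
  assumes B: "random_finite_set N B" and f: "f \<in> borel_measurable N"
  shows "(\<lambda>n. \<Sum>y\<in>B n. ennreal (\<phi> y (f n))) \<in> borel_measurable N"
proof (rule random_finite_set_sum[OF B])
  have "(\<lambda>p. \<phi> (snd p) (f (fst p))) \<in> borel_measurable (N \<Otimes>\<^sub>M borel)"
    by (intro measurable_kernel_compose measurable_compose[OF measurable_fst f] measurable_snd)
  then show "(\<lambda>(n, y). ennreal (\<phi> y (f n))) \<in> borel_measurable (N \<Otimes>\<^sub>M borel)"
    unfolding split_beta' by (rule measurable_compose[OF _ measurable_ennreal])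
qed

lemma measurable_config_cong:
  "borel_measurable (N \<Otimes>\<^sub>M config_space) = (borel_measurable (N \<Otimes>\<^sub>M poisson_config Q t) :: ('n \<times> _ \<Rightarrow> ennreal) set)"
  by (intro measurable_cong_sets sets_pair_measure_cong) auto

lemma borel_measurable_nn_integral_config:
  assumes t: "0 \<le> t" and f: "(\<lambda>(n, c). f n c) \<in> borel_measurable (N \<Otimes>\<^sub>M config_space)"
  shows "(\<lambda>n. \<integral>\<^sup>+ c. f n c \<partial>poisson_config Q t :: ennreal) \<in> borel_measurable N"
proof -
  interpret T: prob_space "poisson_config Q t" using t by (rule prob_space_poisson_config)
  show ?thesis
    using f unfolding measurable_config_cong[of _ t] by (rule T.borel_measurable_nn_integral)
qed

lemma borel_measurable_nn_integral_Q:
  assumes f: "(\<lambda>(n, z). f n z) \<in> borel_measurable (N \<Otimes>\<^sub>M borel)"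
  shows "(\<lambda>n. \<integral>\<^sup>+ z. f n z \<partial>Q :: ennreal) \<in> borel_measurable N"
proof -
  have "borel_measurable (N \<Otimes>\<^sub>M borel) = (borel_measurable (N \<Otimes>\<^sub>M Q) :: (_ \<Rightarrow> ennreal) set)"
    by (intro measurable_cong_sets sets_pair_measure_cong) auto
  with f have "(\<lambda>(n, z). f n z) \<in> borel_measurable (N \<Otimes>\<^sub>M Q)" by simp
  then show ?thesis by (rule borel_measurable_nn_integral)
qed

lemma measurable_mean_points:
  "(\<lambda>c. mean_size (insert x (points c)) x) \<in> borel_measurable config_space"
  by (intro measurable_mean_size_insert random_finite_set_points) simp

lemma measurable_poisson_mean:
  assumes "0 \<le> t"
  shows "poisson_mean t \<in> borel_measurable borel"
  unfolding poisson_mean_def[abs_def]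
  by (intro borel_measurable_nn_integral_config assms, unfold split_beta')
    (intro measurable_mean_size_insert random_finite_set_points' measurable_fst measurable_snd)

lemma nn_integral_card_points:
  assumes "0 \<le> t"
  shows "(\<integral>\<^sup>+ c. of_nat (card (points c)) \<partial>poisson_config Q t) = ennreal t"
proof -
  interpret T: prob_space "poisson_config Q t" using assms by (rule prob_space_poisson_config)
  have "(\<integral>\<^sup>+ c. (\<Sum>z\<in>points c. 1) \<partial>poisson_config Q t) =
      ennreal t * (\<integral>\<^sup>+ z. \<integral>\<^sup>+ c. 1 \<partial>poisson_config Q t \<partial>Q)"
    using assms by (intro nn_integral_Mecke) auto
  then show ?thesis using T.emeasure_space_1 emeasure_space_1 by simp
qed

lemma AE_points_empty: "AE c in poisson_config Q 0. points c = {}"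
proof -
  have "(\<lambda>c. of_nat (card (points c)) :: ennreal) \<in> borel_measurable (poisson_config Q 0)"
    unfolding borel_measurable_poisson_config by (rule random_finite_set_card[OF random_finite_set_points])
  from nn_integral_0_iff_AE[OF this] nn_integral_card_points[of 0]
  have "AE c in poisson_config Q 0. (of_nat (card (points c)) :: ennreal) = 0" by simp
  then show ?thesis by eventually_elim simp
qed

text \<open>A crude bound by the number of points. It matters only through its finiteness, which
  allows the self-referential estimate to be solved.\<close>

lemma poisson_mean_le:
  assumes "0 \<le> t"
  shows "poisson_mean t x \<le> 1 + ennreal t"
proof -
  interpret T: prob_space "poisson_config Q t" using assms by (rule prob_space_poisson_config)
  have "poisson_mean t x \<le> (\<integral>\<^sup>+ c. 1 + of_nat (card (points c)) \<partial>poisson_config Q t)"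
    unfolding poisson_mean_def
  proof (rule nn_integral_mono)
    fix c
    have "mean_size (insert x (points c)) x \<le> of_nat (card (insert x (points c)))"
      by (rule mean_size_le_card) simp
    also have "\<dots> \<le> of_nat (1 + card (points c))"
      by (intro of_nat_mono) (simp add: card_insert_if)
    finally show "mean_size (insert x (points c)) x \<le> 1 + of_nat (card (points c))" by simp
  qed
  also have "\<dots> = 1 + ennreal t"
  proof -
    have "(\<lambda>c. of_nat (card (points c)) :: ennreal) \<in> borel_measurable (poisson_config Q t)"
      unfolding borel_measurable_poisson_config by (rule random_finite_set_card[OF random_finite_set_points])
    then show ?thesis
      using T.emeasure_space_1 by (simp add: nn_integral_add nn_integral_card_points assms)
  qed
  finally show ?thesis .
qed

lemma poisson_mean_ge_1:
  assumes "0 \<le> t"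
  shows "1 \<le> poisson_mean t x"
proof -
  interpret T: prob_space "poisson_config Q t" using assms by (rule prob_space_poisson_config)
  have "1 = (\<integral>\<^sup>+ c. 1 \<partial>poisson_config Q t)" using T.emeasure_space_1 by simp
  also have "\<dots> \<le> poisson_mean t x"
    unfolding poisson_mean_def by (intro nn_integral_mono mean_size_ge_1) auto
  finally show ?thesis .
qed

text \<open>The density, with respect to the Poisson law, of the cluster of \<open>x\<close> without
  the root: \<open>A\<close> is connected to \<open>x\<close>, and no remaining point is adjacent to
  it. The factor \<open>exp t\<close> is that of \<open>nn_integral_split\<close>.\<close>

definition cluster_weight :: "real \<Rightarrow> 'x \<Rightarrow> 'x set \<Rightarrow> ennreal" where
  "cluster_weight t x A = ennreal (exp t) * (conn_prob (insert x A) x *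
     (\<integral>\<^sup>+ c. (\<Prod>r\<in>points c. isolation (insert x A) r) \<partial>poisson_config Q t))"

text \<open>The bound of \<open>mean_size_exploration\<close> for the explored part \<open>A\<close>
  and the remaining old points \<open>R\<close>, averaged over new points of intensity
  \<open>s\<close>. \<open>R\<close> stays explicit because monotonicity in \<open>R\<close> is what
  the correlation inequality requires.\<close>

definition extension_mean :: "real \<Rightarrow> 'x \<Rightarrow> 'x set \<Rightarrow> 'x set \<Rightarrow> ennreal" where
  "extension_mean s x A R = 1 + of_nat (card A) + ennreal s *
     (\<integral>\<^sup>+ z. (\<Sum>y\<in>insert x A. ennreal (\<phi> y z)) *
        (\<integral>\<^sup>+ c. mean_size (insert z (R \<union> points c)) z \<partial>poisson_config Q s) \<partial>Q)"

lemma extension_mean_mono: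
  assumes "finite R'" "R \<subseteq> R'"
  shows "extension_mean s x A R \<le> extension_mean s x A R'"
  unfolding extension_mean_def using assms
  by (intro add_left_mono mult_left_mono nn_integral_mono mean_size_mono) auto

lemma measurable_extension_mean:
  assumes s: "0 \<le> s" and A: "random_finite_set N A" and R: "random_finite_set N R"
  shows "(\<lambda>n. extension_mean s x (A n) (R n)) \<in> borel_measurable N"
proof -
  have 1: "(\<lambda>n. 1 + of_nat (card (A n)) :: ennreal) \<in> borel_measurable N"
    using random_finite_set_card[OF A] by simp
  have A1: "random_finite_set (N \<Otimes>\<^sub>M borel) (\<lambda>p. insert x (A (fst p)))"
    by (intro random_finite_set_insert random_finite_set_compose[OF A]) auto
  have m1: "(\<lambda>p. \<Sum>y\<in>insert x (A (fst p)). ennreal (\<phi> y (snd p))) \<in> borel_measurable (N \<Otimes>\<^sub>M borel)"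
    by (rule measurable_kernel_sum[OF A1]) simp
  have R1: "random_finite_set ((N \<Otimes>\<^sub>M borel) \<Otimes>\<^sub>M config_space) (\<lambda>q. R (fst (fst q)) \<union> points (snd q))"
    by (intro random_finite_set_union random_finite_set_compose[OF R] random_finite_set_points'
        measurable_snd measurable_compose[OF measurable_fst measurable_fst])
  have "(\<lambda>q. mean_size (insert (snd (fst q)) (R (fst (fst q)) \<union> points (snd q))) (snd (fst q))) \<in>
      borel_measurable ((N \<Otimes>\<^sub>M borel) \<Otimes>\<^sub>M config_space)"
    by (rule measurable_mean_size_insert[OF R1]) simp
  then have m2: "(\<lambda>p. \<integral>\<^sup>+ c. mean_size (insert (snd p) (R (fst p) \<union> points c)) (snd p) \<partial>poisson_config Q s)
      \<in> borel_measurable (N \<Otimes>\<^sub>M borel)"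
    by (intro borel_measurable_nn_integral_config s) (simp add: split_beta')
  have "(\<lambda>n. \<integral>\<^sup>+ z. (\<Sum>y\<in>insert x (A n). ennreal (\<phi> y z)) *
        (\<integral>\<^sup>+ c. mean_size (insert z (R n \<union> points c)) z \<partial>poisson_config Q s) \<partial>Q) \<in> borel_measurable N"
    by (rule borel_measurable_nn_integral_Q) (use borel_measurable_times_ennreal[OF m1 m2] in \<open>simp add: split_beta'\<close>)
  then show ?thesis
    unfolding extension_mean_def by (intro borel_measurable_add 1 borel_measurable_times_ennreal) auto
qed

lemma nn_integral_extension:
  assumes s: "0 \<le> s" and fin: "finite A" "finite R"
  shows "(\<integral>\<^sup>+ c. 1 + of_nat (card A) +
      (\<Sum>z\<in>points c. (\<Sum>y\<in>insert x A. ennreal (\<phi> y z)) * mean_size (R \<union> points c) z) \<partial>poisson_config Q s)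
    = extension_mean s x A R"
    and "(\<lambda>c. \<Sum>z\<in>points c. (\<Sum>y\<in>insert x A. ennreal (\<phi> y z)) * mean_size (R \<union> points c) z)
      \<in> borel_measurable config_space"
proof -
  interpret S: prob_space "poisson_config Q s" using s by (rule prob_space_poisson_config)
  let ?\<Phi> = "\<lambda>z. \<Sum>y\<in>insert x A. ennreal (\<phi> y z)"
  \<comment> \<open>Mecke's formula removes \<open>z\<close> from the configuration;
    \<open>insert z\<close> puts it back.\<close>
  define \<psi> where "\<psi> z B = ?\<Phi> z * mean_size (insert z (R \<union> B)) z" for z B
  have \<Phi>: "(\<lambda>n. ?\<Phi> (f n)) \<in> borel_measurable N" if "f \<in> borel_measurable N" for f and N :: "'n measure"
    using fin that by (intro measurable_kernel_sum random_finite_set_const) auto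
  have eq: "(\<Sum>z\<in>points c. \<psi> z (points c - {z})) = (\<Sum>z\<in>points c. ?\<Phi> z * mean_size (R \<union> points c) z)" for c
  proof (intro sum.cong refl)
    fix z assume "z \<in> points c"
    then have "insert z (R \<union> (points c - {z})) = R \<union> points c" by auto
    then show "\<psi> z (points c - {z}) = ?\<Phi> z * mean_size (R \<union> points c) z" by (simp add: \<psi>_def)
  qed
  have R': "random_finite_set (borel \<Otimes>\<^sub>M config_space) (\<lambda>p. R \<union> points (snd p))"
    by (intro random_finite_set_union random_finite_set_const fin random_finite_set_points' measurable_snd)
  have "(\<lambda>p. \<psi> (fst p) (points (snd p))) \<in> borel_measurable (borel \<Otimes>\<^sub>M config_space)"
    unfolding \<psi>_def
    by (intro borel_measurable_times_ennreal \<Phi> measurable_mean_size_insert R' measurable_fst)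
  then have \<psi>: "(\<lambda>(z, c). \<psi> z (points c)) \<in> borel_measurable (borel \<Otimes>\<^sub>M config_space)"
    by (simp add: split_beta')
  show m: "(\<lambda>c. \<Sum>z\<in>points c. ?\<Phi> z * mean_size (R \<union> points c) z) \<in> borel_measurable config_space"
  proof -
    have R'': "random_finite_set (config_space \<Otimes>\<^sub>M borel) (\<lambda>p. R \<union> points (fst p))"
      by (intro random_finite_set_union random_finite_set_const fin random_finite_set_points' measurable_fst)
    have "(\<lambda>p. ?\<Phi> (snd p) * mean_size (insert (snd p) (R \<union> points (fst p))) (snd p)) \<in> borel_measurable (config_space \<Otimes>\<^sub>M borel)"
      by (intro borel_measurable_times_ennreal \<Phi> measurable_mean_size_insert R'' measurable_snd)
    then have "(\<lambda>c. \<Sum>z\<in>points c. ?\<Phi> z * mean_size (insert z (R \<union> points c)) z) \<in> borel_measurable config_space"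
      by (intro random_finite_set_sum random_finite_set_points) (simp add: split_beta')
    also have "(\<lambda>c. \<Sum>z\<in>points c. ?\<Phi> z * mean_size (insert z (R \<union> points c)) z) =
        (\<lambda>c. \<Sum>z\<in>points c. ?\<Phi> z * mean_size (R \<union> points c) z)"
      by (intro ext sum.cong refl) (simp add: insert_absorb)
    finally show ?thesis .
  qed
  have inner: "(\<integral>\<^sup>+ c. \<psi> z (points c) \<partial>poisson_config Q s) =
      ?\<Phi> z * (\<integral>\<^sup>+ c. mean_size (insert z (R \<union> points c)) z \<partial>poisson_config Q s)" for z
    unfolding \<psi>_def
    by (intro nn_integral_cmult, unfold borel_measurable_poisson_config)
      (intro measurable_mean_size_insert random_finite_set_union random_finite_set_const fin random_finite_set_points measurable_const; simp)
  have "(\<integral>\<^sup>+ c. 1 + of_nat (card A) + (\<Sum>z\<in>points c. ?\<Phi> z * mean_size (R \<union> points c) z) \<partial>poisson_config Q s) =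
      1 + of_nat (card A) + (\<integral>\<^sup>+ c. (\<Sum>z\<in>points c. ?\<Phi> z * mean_size (R \<union> points c) z) \<partial>poisson_config Q s)"
    using m S.emeasure_space_1 by (subst nn_integral_add) (simp_all add: borel_measurable_poisson_config)
  also have "(\<integral>\<^sup>+ c. (\<Sum>z\<in>points c. ?\<Phi> z * mean_size (R \<union> points c) z) \<partial>poisson_config Q s) =
      ennreal s * (\<integral>\<^sup>+ z. \<integral>\<^sup>+ c. \<psi> z (points c) \<partial>poisson_config Q s \<partial>Q)"
    unfolding eq[symmetric] by (rule nn_integral_Mecke[OF s \<psi>])
  finally show "(\<integral>\<^sup>+ c. 1 + of_nat (card A) + (\<Sum>z\<in>points c. ?\<Phi> z * mean_size (R \<union> points c) z) \<partial>poisson_config Q s)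
    = extension_mean s x A R"
    unfolding extension_mean_def inner .
qed

lemma poisson_mean_superposition:
  assumes "0 \<le> t" "0 \<le> s"
  shows "poisson_mean (t + s) x =
    (\<integral>\<^sup>+ c1. \<integral>\<^sup>+ c2. mean_size (insert x (points c1 \<union> points c2)) x \<partial>poisson_config Q s \<partial>poisson_config Q t)"
  unfolding poisson_mean_def
proof (rule nn_integral_superposition[OF assms measurable_mean_points])
  show "(\<lambda>(c1, c2). mean_size (insert x (points c1 \<union> points c2)) x) \<in> borel_measurable (config_space \<Otimes>\<^sub>M config_space)"
    unfolding split_beta'
    by (intro measurable_mean_size_insert random_finite_set_union random_finite_set_points' measurable_fst measurable_snd) simp
qed

text \<open>Here the remaining old points form a full process of parameter \<open>t\<close>.
  Together with the new points they superpose to \<open>t + s\<close>, so the same mean that is to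
  be bounded reappears under the integral.\<close>

lemma nn_integral_extension_mean:
  assumes t: "0 \<le> t" "0 \<le> s" and A: "finite A"
  shows "(\<integral>\<^sup>+ c. extension_mean s x A (points c) \<partial>poisson_config Q t) =
    1 + of_nat (card A) + ennreal s * (\<integral>\<^sup>+ z. (\<Sum>y\<in>insert x A. ennreal (\<phi> y z)) * poisson_mean (t + s) z \<partial>Q)"
proof -
  interpret T: prob_space "poisson_config Q t" using t(1) by (rule prob_space_poisson_config)
  interpret QT: pair_sigma_finite Q "poisson_config Q t" ..
  let ?\<Phi> = "\<lambda>z. \<Sum>y\<in>insert x A. ennreal (\<phi> y z)"
  let ?h = "\<lambda>z R. \<integral>\<^sup>+ c. mean_size (insert z (R \<union> points c)) z \<partial>poisson_config Q s"
  have \<Phi>: "(\<lambda>n. ?\<Phi> (f n)) \<in> borel_measurable N" if "f \<in> borel_measurable N" for f and N :: "'n measure"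
    using A that by (intro measurable_kernel_sum random_finite_set_const) auto
  have h: "(\<lambda>n. ?h (f n) (R n)) \<in> borel_measurable N"
    if f: "f \<in> borel_measurable N" and R: "random_finite_set N R" for f R and N :: "'n measure"
  proof (intro borel_measurable_nn_integral_config t, unfold split_beta')
    show "(\<lambda>p. mean_size (insert (f (fst p)) (R (fst p) \<union> points (snd p))) (f (fst p))) \<in> borel_measurable (N \<Otimes>\<^sub>M config_space)"
      by (intro measurable_mean_size_insert random_finite_set_union random_finite_set_compose[OF R]
          random_finite_set_points' measurable_fst measurable_snd measurable_compose[OF measurable_fst f])
  qed
  have m: "(\<lambda>p. ?\<Phi> (fst p) * ?h (fst p) (points (snd p))) \<in> borel_measurable (borel \<Otimes>\<^sub>M config_space)"
    by (intro borel_measurable_times_ennreal \<Phi> h random_finite_set_points' measurable_fst measurable_snd)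
  have m1: "(\<lambda>c. \<integral>\<^sup>+ z. ?\<Phi> z * ?h z (points c) \<partial>Q) \<in> borel_measurable config_space"
  proof (rule borel_measurable_nn_integral_Q, unfold split_beta')
    show "(\<lambda>p. ?\<Phi> (snd p) * ?h (snd p) (points (fst p))) \<in> borel_measurable (config_space \<Otimes>\<^sub>M borel)"
      by (intro borel_measurable_times_ennreal \<Phi> h random_finite_set_points' measurable_fst measurable_snd)
  qed
  have "(\<integral>\<^sup>+ c. extension_mean s x A (points c) \<partial>poisson_config Q t) =
      1 + of_nat (card A) + ennreal s * (\<integral>\<^sup>+ c. \<integral>\<^sup>+ z. ?\<Phi> z * ?h z (points c) \<partial>Q \<partial>poisson_config Q t)"
    unfolding extension_mean_def using m1 T.emeasure_space_1
    by (subst nn_integral_add) (simp_all add: borel_measurable_poisson_config nn_integral_cmult)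
  also have "(\<integral>\<^sup>+ c. \<integral>\<^sup>+ z. ?\<Phi> z * ?h z (points c) \<partial>Q \<partial>poisson_config Q t) =
      (\<integral>\<^sup>+ z. \<integral>\<^sup>+ c. ?\<Phi> z * ?h z (points c) \<partial>poisson_config Q t \<partial>Q)"
  proof (rule QT.Fubini')
    have "borel_measurable (Q \<Otimes>\<^sub>M poisson_config Q t) = (borel_measurable (borel \<Otimes>\<^sub>M config_space) :: (_ \<Rightarrow> ennreal) set)"
      by (intro measurable_cong_sets sets_pair_measure_cong) auto
    then show "(\<lambda>(z, c). ?\<Phi> z * ?h z (points c)) \<in> borel_measurable (Q \<Otimes>\<^sub>M poisson_config Q t)"
      using m by (simp add: split_beta')
  qed
  also have "\<dots> = (\<integral>\<^sup>+ z. ?\<Phi> z * poisson_mean (t + s) z \<partial>Q)"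
  proof (rule nn_integral_cong)
    fix z
    have "(\<lambda>c. ?h z (points c)) \<in> borel_measurable (poisson_config Q t)"
      unfolding borel_measurable_poisson_config by (intro h random_finite_set_points) simp
    then show "(\<integral>\<^sup>+ c. ?\<Phi> z * ?h z (points c) \<partial>poisson_config Q t) = ?\<Phi> z * poisson_mean (t + s) z"
      unfolding poisson_mean_superposition[OF t] by (rule nn_integral_cmult)
  qed
  finally show ?thesis .
qed

text \<open>The same splitting as for the exploration, but without new points. Read from right to
  left it recovers the mean at the lower parameter.\<close>

lemma poisson_mean_decomposition:
  assumes t: "0 \<le> t"
  shows "poisson_mean t x =
    (\<integral>\<^sup>+ c. cluster_weight t x (points c) * (1 + of_nat (card (points c))) \<partial>poisson_config Q t)"
proof -
  interpret T: prob_space "poisson_config Q t" using t by (rule prob_space_poisson_config)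
  let ?w = "\<lambda>A R. \<Prod>r\<in>R. isolation (insert x A) r"
  define f where "f A R = conn_prob (insert x A) x * ?w A R * (1 + of_nat (card A))" for A R
  have w: "(\<lambda>n. ?w (A n) (R n)) \<in> borel_measurable N"
    if "random_finite_set N A" "random_finite_set N R" for A R and N :: "'n measure"
    using that by (intro measurable_isolation_prod random_finite_set_insert) auto
  have conn: "(\<lambda>n. conn_prob (insert x (A n)) x) \<in> borel_measurable N"
    if "random_finite_set N A" for A and N :: "'n measure"
    using that by (intro measurable_conn_prob random_finite_set_insert) auto
  have "(\<lambda>p. f (points (fst p)) (points (snd p))) \<in> borel_measurable (config_space \<Otimes>\<^sub>M config_space)"
    unfolding f_def
    by (intro borel_measurable_times_ennreal borel_measurable_add w conn random_finite_set_card
        random_finite_set_points' measurable_fst measurable_snd) auto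
  then have f: "(\<lambda>(c1, c2). f (points c1) (points c2)) \<in> borel_measurable (config_space \<Otimes>\<^sub>M config_space)"
    by (simp add: split_beta')
  have "poisson_mean t x = (\<integral>\<^sup>+ c. (\<Sum>A\<in>Pow (points c). f A (points c - A)) \<partial>poisson_config Q t)"
    unfolding poisson_mean_def f_def
    by (intro nn_integral_cong_AE, use AE_notin_points[OF t, of x] in eventually_elim)
      (simp add: mean_size_decomposition)
  also have "\<dots> = ennreal (exp t) * (\<integral>\<^sup>+ c1. \<integral>\<^sup>+ c2. f (points c1) (points c2) \<partial>poisson_config Q t \<partial>poisson_config Q t)"
    by (rule nn_integral_split[OF t f])
  also have "\<dots> = (\<integral>\<^sup>+ c1. ennreal (exp t) * (\<integral>\<^sup>+ c2. f (points c1) (points c2) \<partial>poisson_config Q t) \<partial>poisson_config Q t)"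
    using borel_measurable_nn_integral_config[OF t f]
    by (intro nn_integral_cmult[symmetric]) (simp add: borel_measurable_poisson_config)
  also have "\<dots> = (\<integral>\<^sup>+ c. cluster_weight t x (points c) * (1 + of_nat (card (points c))) \<partial>poisson_config Q t)"
  proof (rule nn_integral_cong)
    fix c1 :: "nat \<times> (nat \<Rightarrow> 'x)"
    let ?A = "points c1"
    have "(\<integral>\<^sup>+ c2. f ?A (points c2) \<partial>poisson_config Q t) =
        (\<integral>\<^sup>+ c2. (conn_prob (insert x ?A) x * (1 + of_nat (card ?A))) * ?w ?A (points c2) \<partial>poisson_config Q t)"
      unfolding f_def by (simp only: mult_ac)
    also have "\<dots> = (conn_prob (insert x ?A) x * (1 + of_nat (card ?A))) * (\<integral>\<^sup>+ c2. ?w ?A (points c2) \<partial>poisson_config Q t)"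
      by (intro nn_integral_cmult, unfold borel_measurable_poisson_config)
        (intro w random_finite_set_const random_finite_set_points; simp)
    finally show "ennreal (exp t) * (\<integral>\<^sup>+ c2. f ?A (points c2) \<partial>poisson_config Q t) =
        cluster_weight t x ?A * (1 + of_nat (card ?A))"
      unfolding cluster_weight_def by (simp only: mult_ac)
  qed
  finally show ?thesis .
qed

text \<open>The finite inequality holds almost surely, since the root, old and new points are
  distinct. Its sum over parts \<open>A\<close> is resolved by \<open>nn_integral_split\<close> into
  an explored cluster and an independent rest; the only further loss is the decoupling of the rest
  from its isolation weight.\<close>

theorem poisson_mean_exploration:
  assumes t: "0 \<le> t" "0 \<le> s"
  shows "poisson_mean (t + s) x \<le> (\<integral>\<^sup>+ c. cluster_weight t x (points c) *
    (1 + of_nat (card (points c)) + ennreal s *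
      (\<integral>\<^sup>+ z. (\<Sum>y\<in>insert x (points c). ennreal (\<phi> y z)) * poisson_mean (t + s) z \<partial>Q)) \<partial>poisson_config Q t)"
proof -
  let ?w = "\<lambda>A R. \<Prod>r\<in>R. isolation (insert x A) r"
  define q where "q A R = conn_prob (insert x A) x * ?w A R" for A R
  define f where "f A R = q A R * extension_mean s x A R" for A R
  have w: "(\<lambda>n. ?w (A n) (R n)) \<in> borel_measurable N"
    if "random_finite_set N A" "random_finite_set N R" for A R and N :: "'n measure"
    using that by (intro measurable_isolation_prod random_finite_set_insert) auto
  have conn: "(\<lambda>n. conn_prob (insert x (A n)) x) \<in> borel_measurable N"
    if "random_finite_set N A" for A and N :: "'n measure"
    using that by (intro measurable_conn_prob random_finite_set_insert) auto
  have "(\<lambda>p. f (points (fst p)) (points (snd p))) \<in> borel_measurable (config_space \<Otimes>\<^sub>M config_space)"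
    unfolding f_def q_def
    by (intro borel_measurable_times_ennreal w conn measurable_extension_mean t
        random_finite_set_points' measurable_fst measurable_snd)
  then have f: "(\<lambda>(c1, c2). f (points c1) (points c2)) \<in> borel_measurable (config_space \<Otimes>\<^sub>M config_space)"
    by (simp add: split_beta')
  let ?e = "\<lambda>A R Z. 1 + of_nat (card A) + (\<Sum>z\<in>Z. (\<Sum>y\<in>insert x A. ennreal (\<phi> y z)) * mean_size (R \<union> Z) z)"
  have "poisson_mean (t + s) x = (\<integral>\<^sup>+ c1. \<integral>\<^sup>+ c2. mean_size (insert x (points c1 \<union> points c2)) x \<partial>poisson_config Q s \<partial>poisson_config Q t)"
    by (rule poisson_mean_superposition[OF t])
  also have "\<dots> \<le> (\<integral>\<^sup>+ c1. \<integral>\<^sup>+ c2. (\<Sum>A\<in>Pow (points c1). q A (points c1 - A) * ?e A (points c1 - A) (points c2)) \<partial>poisson_config Q s \<partial>poisson_config Q t)"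
  proof (rule nn_integral_mono_AE, use AE_notin_points[OF t(1), of x] in eventually_elim,
      rule nn_integral_mono_AE, use AE_notin_points[OF t(2), of x] AE_disjoint_points[OF t(2) finite_points] in eventually_elim)
    fix c1 c2 assume "x \<notin> points c1" "x \<notin> points c2" "points c1 \<inter> points c2 = {}"
    then show "mean_size (insert x (points c1 \<union> points c2)) x \<le>
        (\<Sum>A\<in>Pow (points c1). q A (points c1 - A) * ?e A (points c1 - A) (points c2))"
      unfolding q_def by (intro mean_size_exploration) auto
  qed
  also have "\<dots> = (\<integral>\<^sup>+ c1. (\<Sum>A\<in>Pow (points c1). f A (points c1 - A)) \<partial>poisson_config Q t)"
  proof (rule nn_integral_cong)
    fix c1 :: "nat \<times> (nat \<Rightarrow> 'x)"
    have fin: "finite A" "finite (points c1 - A)" if "A \<in> Pow (points c1)" for A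
      using that by (auto intro: finite_subset[OF _ finite_points])
    have em: "(\<lambda>c2. ?e A (points c1 - A) (points c2)) \<in> borel_measurable (poisson_config Q s)" if "A \<in> Pow (points c1)" for A
      unfolding borel_measurable_poisson_config
      by (intro borel_measurable_add nn_integral_extension(2)[OF t(2) fin[OF that]]) auto
    have "(\<integral>\<^sup>+ c2. (\<Sum>A\<in>Pow (points c1). q A (points c1 - A) * ?e A (points c1 - A) (points c2)) \<partial>poisson_config Q s) =
        (\<Sum>A\<in>Pow (points c1). \<integral>\<^sup>+ c2. q A (points c1 - A) * ?e A (points c1 - A) (points c2) \<partial>poisson_config Q s)"
      using em by (intro nn_integral_sum borel_measurable_times_ennreal) auto
    also have "\<dots> = (\<Sum>A\<in>Pow (points c1). f A (points c1 - A))"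
      unfolding f_def
    proof (intro sum.cong refl)
      fix A assume A: "A \<in> Pow (points c1)"
      show "(\<integral>\<^sup>+ c2. q A (points c1 - A) * ?e A (points c1 - A) (points c2) \<partial>poisson_config Q s) =
          q A (points c1 - A) * extension_mean s x A (points c1 - A)"
        unfolding nn_integral_extension(1)[OF t(2) fin[OF A], symmetric] by (rule nn_integral_cmult[OF em[OF A]])
    qed
    finally show "(\<integral>\<^sup>+ c2. (\<Sum>A\<in>Pow (points c1). q A (points c1 - A) * ?e A (points c1 - A) (points c2)) \<partial>poisson_config Q s) =
        (\<Sum>A\<in>Pow (points c1). f A (points c1 - A))" .
  qed
  also have "\<dots> = ennreal (exp t) * (\<integral>\<^sup>+ c1. \<integral>\<^sup>+ c2. f (points c1) (points c2) \<partial>poisson_config Q t \<partial>poisson_config Q t)"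
    by (rule nn_integral_split[OF t(1) f])
  also have "\<dots> = (\<integral>\<^sup>+ c1. ennreal (exp t) * (\<integral>\<^sup>+ c2. f (points c1) (points c2) \<partial>poisson_config Q t) \<partial>poisson_config Q t)"
    using borel_measurable_nn_integral_config[OF t(1) f]
    by (intro nn_integral_cmult[symmetric]) (simp add: borel_measurable_poisson_config)
  also have "\<dots> \<le> (\<integral>\<^sup>+ c. cluster_weight t x (points c) *
    (1 + of_nat (card (points c)) + ennreal s *
      (\<integral>\<^sup>+ z. (\<Sum>y\<in>insert x (points c). ennreal (\<phi> y z)) * poisson_mean (t + s) z \<partial>Q)) \<partial>poisson_config Q t)"
  proof (rule nn_integral_mono)
    fix c1 :: "nat \<times> (nat \<Rightarrow> 'x)"
    let ?A = "points c1"
    let ?c = "conn_prob (insert x ?A) x"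
    let ?I = "\<lambda>h. \<integral>\<^sup>+ c2. h (points c2) \<partial>poisson_config Q t"
    have wA: "(\<lambda>c2. ?w ?A (points c2)) \<in> borel_measurable config_space"
      by (intro w random_finite_set_const random_finite_set_points) simp
    have eA: "(\<lambda>c2. extension_mean s x ?A (points c2)) \<in> borel_measurable config_space"
      by (intro measurable_extension_mean t random_finite_set_const random_finite_set_points) simp
    have iso: "isolation (insert x ?A) \<in> borel_measurable borel"
      by (intro measurable_isolation[where f = "\<lambda>z. z"] random_finite_set_const) auto
    have "?I (\<lambda>R. f ?A R) = ?I (\<lambda>R. ?c * (?w ?A R * extension_mean s x ?A R))"
      unfolding f_def q_def by (simp only: mult.assoc)
    also have "\<dots> = ?c * ?I (\<lambda>R. ?w ?A R * extension_mean s x ?A R)"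
      by (intro nn_integral_cmult, unfold borel_measurable_poisson_config)
        (intro borel_measurable_times_ennreal wA eA)
    \<comment> \<open>The weight \<open>?w\<close> thins the remaining points, while
      \<open>extension_mean\<close> increases with them; by \<open>nn_integral_prod_le\<close> the
      two factors may be averaged separately.\<close>
    also have "\<dots> \<le> ?c * (?I (\<lambda>R. ?w ?A R) * ?I (\<lambda>R. extension_mean s x ?A R))"
      by (intro mult_left_mono nn_integral_prod_le[OF t(1) iso isolation_le_1 eA] extension_mean_mono) auto
    also have "?I (\<lambda>R. extension_mean s x ?A R) =
        1 + of_nat (card ?A) + ennreal s * (\<integral>\<^sup>+ z. (\<Sum>y\<in>insert x ?A. ennreal (\<phi> y z)) * poisson_mean (t + s) z \<partial>Q)"
      by (rule nn_integral_extension_mean[OF t finite_points])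
    finally show "ennreal (exp t) * ?I (\<lambda>R. f ?A R) \<le> cluster_weight t x ?A *
       (1 + of_nat (card ?A) + ennreal s * (\<integral>\<^sup>+ z. (\<Sum>y\<in>insert x ?A. ennreal (\<phi> y z)) * poisson_mean (t + s) z \<partial>Q))"
      unfolding cluster_weight_def by (simp only: mult.assoc mult_left_mono zero_le)
  qed
  finally show ?thesis .
qed

text \<open>\<open>\<kappa>\<close> bounds the expected contribution of new points per vertex of the
  explored cluster. The \<open>1 + card A\<close> vertices together give at most the factor
  \<open>1 + \<kappa>\<close>, which leaves the decomposition of the mean at \<open>t\<close>. The
  hypothesis on the points is only almost sure because exceptional marks have no bound.\<close>

lemma poisson_mean_step:
  assumes t: "0 \<le> t" "0 \<le> s"
    and x: "ennreal s * (\<integral>\<^sup>+ z. ennreal (\<phi> x z) * poisson_mean (t + s) z \<partial>Q) \<le> \<kappa>"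
    and pts: "AE c in poisson_config Q t. \<forall>y\<in>points c.
      ennreal s * (\<integral>\<^sup>+ z. ennreal (\<phi> y z) * poisson_mean (t + s) z \<partial>Q) \<le> \<kappa>"
  shows "poisson_mean (t + s) x \<le> (1 + \<kappa>) * poisson_mean t x"
proof -
  note poisson_mean_exploration[OF t, of x]
  also have "(\<integral>\<^sup>+ c. cluster_weight t x (points c) *
    (1 + of_nat (card (points c)) + ennreal s *
      (\<integral>\<^sup>+ z. (\<Sum>y\<in>insert x (points c). ennreal (\<phi> y z)) * poisson_mean (t + s) z \<partial>Q)) \<partial>poisson_config Q t) \<le>
    (\<integral>\<^sup>+ c. (1 + \<kappa>) * (cluster_weight t x (points c) * (1 + of_nat (card (points c)))) \<partial>poisson_config Q t)"
  proof (rule nn_integral_mono_AE, use pts in eventually_elim)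
    fix c assume c: "\<forall>y\<in>points c. ennreal s * (\<integral>\<^sup>+ z. ennreal (\<phi> y z) * poisson_mean (t + s) z \<partial>Q) \<le> \<kappa>"
    have m: "(\<lambda>z. ennreal (\<phi> y z) * poisson_mean (t + s) z) \<in> borel_measurable Q" for y
    proof -
      have "(\<lambda>z. \<phi> y z) \<in> borel_measurable borel" by (intro measurable_kernel_compose) auto
      then have "(\<lambda>z. ennreal (\<phi> y z) * poisson_mean (t + s) z) \<in> borel_measurable borel"
        using t by (intro borel_measurable_times_ennreal measurable_poisson_mean measurable_compose[OF _ measurable_ennreal]) auto
      then show ?thesis by (simp cong: measurable_cong_sets)
    qed
    have "ennreal s * (\<integral>\<^sup>+ z. (\<Sum>y\<in>insert x (points c). ennreal (\<phi> y z)) * poisson_mean (t + s) z \<partial>Q) =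
        (\<Sum>y\<in>insert x (points c). ennreal s * (\<integral>\<^sup>+ z. ennreal (\<phi> y z) * poisson_mean (t + s) z \<partial>Q))"
      unfolding sum_distrib_right using m by (subst nn_integral_sum) (auto simp: sum_distrib_left)
    also have "\<dots> \<le> of_nat (card (insert x (points c))) * \<kappa>"
      using c x by (intro sum_bounded_above) auto
    also have "\<dots> \<le> of_nat (1 + card (points c)) * \<kappa>"
      by (intro mult_right_mono of_nat_mono) (auto simp: card_insert_if)
    finally have "1 + of_nat (card (points c)) +
        ennreal s * (\<integral>\<^sup>+ z. (\<Sum>y\<in>insert x (points c). ennreal (\<phi> y z)) * poisson_mean (t + s) z \<partial>Q) \<le>
        1 + of_nat (card (points c)) + (1 + of_nat (card (points c))) * \<kappa>"
      by (simp add: add_left_mono)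
    also have "\<dots> = (1 + \<kappa>) * (1 + of_nat (card (points c)))"
      by (simp add: distrib_left distrib_right mult.commute add_ac)
    finally show "cluster_weight t x (points c) * (1 + of_nat (card (points c)) +
        ennreal s * (\<integral>\<^sup>+ z. (\<Sum>y\<in>insert x (points c). ennreal (\<phi> y z)) * poisson_mean (t + s) z \<partial>Q)) \<le>
        (1 + \<kappa>) * (cluster_weight t x (points c) * (1 + of_nat (card (points c))))"
      using mult_left_mono[of _ "(1 + \<kappa>) * (1 + of_nat (card (points c)))" "cluster_weight t x (points c)"]
      by (simp add: mult.left_commute)
  qed
  also have "\<dots> = (1 + \<kappa>) * poisson_mean t x"
    unfolding poisson_mean_decomposition[OF t(1)]
  proof (rule nn_integral_cmult)
    have "(\<lambda>c. conn_prob (insert x (points c)) x) \<in> borel_measurable config_space"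
      by (intro measurable_conn_prob random_finite_set_insert random_finite_set_points) auto
    moreover have "(\<lambda>c. \<integral>\<^sup>+ c'. (\<Prod>r\<in>points c'. isolation (insert x (points c)) r) \<partial>poisson_config Q t) \<in> borel_measurable config_space"
      by (intro borel_measurable_nn_integral_config t, unfold split_beta')
        (intro measurable_isolation_prod random_finite_set_insert random_finite_set_points' measurable_fst measurable_snd; simp)
    moreover have "(\<lambda>c. of_nat (card (points c :: 'x set)) :: ennreal) \<in> borel_measurable config_space"
      by (rule random_finite_set_card[OF random_finite_set_points])
    ultimately show "(\<lambda>c. cluster_weight t x (points c) * (1 + of_nat (card (points c)))) \<in> borel_measurable (poisson_config Q t)"
      unfolding borel_measurable_poisson_config cluster_weight_def
      by (intro borel_measurable_times_ennreal borel_measurable_add) auto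
  qed
  finally show ?thesis .
qed

text \<open>The step from parameter 0: almost surely there are no old points, the explored cluster
  is the root alone, and its mean size is at most 1.\<close>

lemma poisson_mean_le_integral:
  assumes "0 \<le> s"
  shows "poisson_mean s x \<le> 1 + ennreal s * (\<integral>\<^sup>+ z. ennreal (\<phi> x z) * poisson_mean s z \<partial>Q)"
proof -
  let ?\<kappa> = "ennreal s * (\<integral>\<^sup>+ z. ennreal (\<phi> x z) * poisson_mean (0 + s) z \<partial>Q)"
  have "poisson_mean (0 + s) x \<le> (1 + ?\<kappa>) * poisson_mean 0 x"
    using assms AE_points_empty by (intro poisson_mean_step) (auto elim: eventually_mono)
  also have "\<dots> \<le> (1 + ?\<kappa>) * 1"
    using poisson_mean_le[of 0 x] by (intro mult_left_mono) auto
  finally show ?thesis by simp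
qed

end

section \<open>Norms\<close>

lemma measurable_ennreal_powr:
  assumes [measurable]: "f \<in> borel_measurable M"
  shows "(\<lambda>x. ennreal_powr (f x) r) \<in> borel_measurable M"
  unfolding ennreal_powr_def by measurable

lemma ennreal_powr_eq_top_iff [simp]: "ennreal_powr x r = top \<longleftrightarrow> x = top"
  by (simp add: ennreal_powr_def)

text \<open>Jensen's inequality, by integrating the tangent bound for the power function at
  \<open>b\<close>: first \<open>b = 1\<close> shows that the mean is finite if the right-hand side
  is, then \<open>b\<close> is taken to be the mean.\<close>

lemma (in prob_space) nn_integral_le_powr:
  assumes f [measurable]: "f \<in> borel_measurable M" and r: "1 \<le> r"
  shows "(\<integral>\<^sup>+ x. f x \<partial>M) \<le> ennreal_powr (\<integral>\<^sup>+ x. ennreal_powr (f x) r \<partial>M) (1 / r)"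
proof (cases "(\<integral>\<^sup>+ x. ennreal_powr (f x) r \<partial>M) = \<infinity>")
  case True
  then show ?thesis by (simp add: ennreal_powr_def)
next
  case False
  define I where "I = (\<integral>\<^sup>+ x. ennreal_powr (f x) r \<partial>M)"
  define N where "N = (\<integral>\<^sup>+ x. f x \<partial>M)"
  note [measurable] = measurable_ennreal_powr[OF f, of r]
  have young: "ennreal (r * b powr (r - 1)) * y \<le> ennreal_powr y r + ennreal ((r - 1) * b powr r)"
    if b: "0 < b" for b :: real and y
  proof (cases y)
    case (real a)
    have "r * b powr (r - 1) * a \<le> a powr r + (r - 1) * b powr r"
    proof (cases "a = 0")
      case True
      then show ?thesis using r by simp
    next
      case False
      then have a: "0 < a" using real by simp
      have "(a powr r) powr (1 / r) * (b powr r) powr (1 - 1 / r) \<le> 1 / r * a powr r + (1 - 1 / r) * b powr r"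
        using a b r by (intro Youngs_inequality_0) auto
      moreover have "(a powr r) powr (1 / r) = a" "(b powr r) powr (1 - 1 / r) = b powr (r - 1)"
        using a b r powr_powr[of a r "1 / r"] powr_powr[of b r "1 - 1 / r"]
        by (simp_all add: right_diff_distrib)
      ultimately have "a * b powr (r - 1) \<le> 1 / r * a powr r + (1 - 1 / r) * b powr r" by simp
      then have "r * (a * b powr (r - 1)) \<le> r * (1 / r * a powr r + (1 - 1 / r) * b powr r)"
        using r by (intro mult_left_mono) auto
      also have "\<dots> = a powr r + (r - 1) * b powr r" using r by (simp add: field_simps)
      finally show ?thesis by (simp add: mult_ac)
    qed
    then show ?thesis
      using real r by (simp add: ennreal_powr_def flip: ennreal_mult ennreal_plus)
  qed (simp add: ennreal_powr_def)
  have int: "ennreal (r * b powr (r - 1)) * N \<le> I + ennreal ((r - 1) * b powr r)" if b: "0 < b" for b :: real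
  proof -
    have "ennreal (r * b powr (r - 1)) * N = (\<integral>\<^sup>+ x. ennreal (r * b powr (r - 1)) * f x \<partial>M)"
      unfolding N_def by (rule nn_integral_cmult[symmetric]) simp
    also have "\<dots> \<le> (\<integral>\<^sup>+ x. ennreal_powr (f x) r + ennreal ((r - 1) * b powr r) \<partial>M)"
      by (intro nn_integral_mono young b)
    also have "\<dots> = I + ennreal ((r - 1) * b powr r)"
      unfolding I_def using emeasure_space_1 by (subst nn_integral_add) auto
    finally show ?thesis .
  qed
  obtain i where i: "I = ennreal i" "0 \<le> i" using False unfolding I_def[symmetric] by (cases I) auto
  have "N \<noteq> \<infinity>"
  proof
    assume "N = \<infinity>"
    then have "I + ennreal ((r - 1) * 1 powr r) = \<infinity>"
      using int[of 1] r by (simp add: ennreal_mult_top top.extremum_unique)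
    then show False using i by simp
  qed
  then obtain n where n: "N = ennreal n" "0 \<le> n" by (cases N) auto
  have "n \<le> i powr (1 / r)"
  proof (cases "n = 0")
    case False
    then have n0: "0 < n" using n by simp
    have "ennreal (r * n powr (r - 1) * n) \<le> ennreal (i + (r - 1) * n powr r)"
      using int[OF n0] n i r by (simp flip: ennreal_mult ennreal_plus)
    then have "r * n powr (r - 1) * n \<le> i + (r - 1) * n powr r"
      using i r by (subst (asm) ennreal_le_iff) auto
    moreover have "r * n powr (r - 1) * n = r * n powr r"
      using n0 by (simp add: powr_diff)
    ultimately have "r * n powr r \<le> i + (r - 1) * n powr r" by simp
    then have "n powr r \<le> i" by (simp add: algebra_simps)
    then have "(n powr r) powr (1 / r) \<le> i powr (1 / r)" using r by (intro powr_mono2) auto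
    then show ?thesis using n0 r by (simp add: powr_powr)
  qed simp
  then have "N \<le> ennreal_powr I (1 / r)"
    unfolding n i using i by (simp add: ennreal_powr_def ennreal_leI)
  then show ?thesis unfolding N_def I_def .
qed

lemma (in prob_space) nn_integral_le_Lp_norm:
  assumes f: "f \<in> borel_measurable M" and p: "1 \<le> p"
  shows "(\<integral>\<^sup>+ x. f x \<partial>M) \<le> Lp_norm M p f"
proof (cases "p = \<infinity>")
  case True
  have "(\<integral>\<^sup>+ x. f x \<partial>M) \<le> (\<integral>\<^sup>+ x. esssup M f \<partial>M)"
    by (intro nn_integral_mono_AE esssup_AE)
  then show ?thesis using True emeasure_space_1 by (simp add: Lp_norm_def)
next
  case False
  then obtain r where r: "p = ennreal r" "0 \<le> r" by (cases p) auto
  then have "1 \<le> r" using p by simp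
  then show ?thesis using False r nn_integral_le_powr[OF f] by (simp add: Lp_norm_def)
qed

text \<open>A negative \<open>Y\<close> means the bound \<open>ennreal Y = 0\<close>, hence the
  constant \<open>max 0 Y\<close> in the proof.\<close>

lemma (in prob_space) Lp_norm_finite:
  assumes f: "f \<in> borel_measurable M" and p: "1 \<le> p" and Y: "AE x in M. f x \<le> ennreal Y"
  shows "Lp_norm M p f \<noteq> \<infinity>"
proof (cases "p = \<infinity>")
  case True
  have "esssup M f \<le> ennreal Y" by (rule esssup_I[OF f Y])
  then show ?thesis using True by (auto simp: Lp_norm_def top_unique)
next
  case False
  then obtain r where r: "p = ennreal r" "0 \<le> r" by (cases p) auto
  then have r1: "1 \<le> r" using p by simp
  have "(\<integral>\<^sup>+ x. ennreal_powr (f x) r \<partial>M) \<le> (\<integral>\<^sup>+ x. ennreal (max 0 Y powr r) \<partial>M)"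
  proof (rule nn_integral_mono_AE, use Y in eventually_elim)
    fix x assume "f x \<le> ennreal Y"
    then obtain a where a: "f x = ennreal a" "0 \<le> a" "a \<le> max 0 Y"
      by (cases "f x") (auto simp: top_unique ennreal_le_iff2)
    then show "ennreal_powr (f x) r \<le> ennreal (max 0 Y powr r)"
      using r1 by (auto simp: ennreal_powr_def intro!: ennreal_leI powr_mono2)
  qed
  also have "\<dots> < \<infinity>" using emeasure_space_1 by simp
  finally show ?thesis using False r r1 by (simp add: Lp_norm_def)
qed

section \<open>Clusters in infinite graphs\<close>

context edge_kernel
begin

text \<open>The hypothesis says that \<open>h\<close> sees only the pairs inside \<open>T\<close>.
  It is thus a finite combination of cylinder indicators, and this connects the product measure,
  over possibly infinitely many pairs, with finite sums.\<close>

lemma nn_integral_edge_law_finite: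
  assumes S: "T \<subseteq> S" "finite T"
    and h: "\<And>c c'. (\<And>e. e \<in> vertex_pairs T \<Longrightarrow> c e = c' e) \<Longrightarrow> h c = h c'"
  shows "h \<in> borel_measurable (edge_law \<phi> S)"
    and "(\<integral>\<^sup>+ c. h c \<partial>edge_law \<phi> S) = edge_expectation pair_prob (vertex_pairs T) (\<lambda>E. h (\<lambda>e. e \<in> E))"
proof -
  let ?F = "vertex_pairs T" and ?M = "\<lambda>e. measure_pmf (bernoulli_pmf (edge_probability \<phi> e))"
  interpret product_prob_space ?M "vertex_pairs S" ..
  have fin: "finite ?F" using S by (intro finite_vertex_pairs)
  have sub: "?F \<subseteq> vertex_pairs S" using S by (intro vertex_pairs_mono)
  \<comment> \<open>The cylinder of all configurations that agree with \<open>E\<close> on the pairs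
    inside \<open>T\<close>.\<close>
  let ?A = "\<lambda>E. {c \<in> space (edge_law \<phi> S). \<forall>e\<in>?F. c e \<in> {e \<in> E}}"
  have A: "?A E \<in> sets (edge_law \<phi> S)" for E
    unfolding edge_law_def using fin sub by (intro sets.sets_Collect_finite_All sets_Collect_single) auto
  have em: "emeasure (edge_law \<phi> S) (?A E) = ennreal (edge_weight pair_prob ?F E)" for E
  proof -
    have "emeasure (edge_law \<phi> S) (?A E) = (\<Prod>e\<in>?F. emeasure (?M e) {e \<in> E})"
      unfolding edge_law_def by (rule emeasure_PiM_Collect[OF sub fin]) simp
    also have "\<dots> = (\<Prod>e\<in>?F. ennreal (if e \<in> E then pair_prob e else 1 - pair_prob e))"
    proof (intro prod.cong refl)
      fix e assume "e \<in> ?F"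
      then obtain x y where "e = {x, y}" unfolding vertex_pairs_def by auto
      then show "emeasure (?M e) {e \<in> E} = ennreal (if e \<in> E then pair_prob e else 1 - pair_prob e)"
        using kernel_nonneg kernel_le_1 by (auto simp: emeasure_pmf_single edge_probability_eq)
    qed
    also have "\<dots> = ennreal (edge_weight pair_prob ?F E)"
      unfolding edge_weight_def using pair_prob_bounds by (intro prod_ennreal) auto
    finally show ?thesis .
  qed
  have eq: "h c = (\<Sum>E\<in>Pow ?F. h (\<lambda>e. e \<in> E) * indicator (?A E) c)" if c: "c \<in> space (edge_law \<phi> S)" for c
  proof -
    have "(\<Sum>E\<in>Pow ?F. h (\<lambda>e. e \<in> E) * indicator (?A E) c) =
        (\<Sum>E\<in>Pow ?F. if E = {e \<in> ?F. c e} then h (\<lambda>e. e \<in> E) else 0)"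
      using c by (intro sum.cong refl) (auto split: split_indicator)
    also have "\<dots> = h (\<lambda>e. e \<in> {e \<in> ?F. c e})" using fin by (subst sum.delta) auto
    also have "\<dots> = h c" by (rule h) auto
    finally show ?thesis ..
  qed
  have "(\<lambda>c. \<Sum>E\<in>Pow ?F. h (\<lambda>e. e \<in> E) * indicator (?A E) c) \<in> borel_measurable (edge_law \<phi> S)"
    by (intro borel_measurable_sum borel_measurable_times_ennreal borel_measurable_indicator A) simp
  then show "h \<in> borel_measurable (edge_law \<phi> S)"
    by (subst measurable_cong[OF eq])
  have "(\<integral>\<^sup>+ c. h c \<partial>edge_law \<phi> S) = (\<integral>\<^sup>+ c. (\<Sum>E\<in>Pow ?F. h (\<lambda>e. e \<in> E) * indicator (?A E) c) \<partial>edge_law \<phi> S)"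
    by (intro nn_integral_cong eq)
  also have "\<dots> = (\<Sum>E\<in>Pow ?F. h (\<lambda>e. e \<in> E) * emeasure (edge_law \<phi> S) (?A E))"
    using A by (subst nn_integral_sum) (auto simp: nn_integral_cmult_indicator intro!: borel_measurable_times_ennreal borel_measurable_indicator)
  also have "\<dots> = edge_expectation pair_prob ?F (\<lambda>E. h (\<lambda>e. e \<in> E))"
    unfolding edge_expectation_def em by (simp only: mult.commute)
  finally show "(\<integral>\<^sup>+ c. h c \<partial>edge_law \<phi> S) = edge_expectation pair_prob ?F (\<lambda>E. h (\<lambda>e. e \<in> E))" .
qed

text \<open>A path uses finitely many vertices, hence lies in some \<open>T n\<close>; so the
  cluster is the increasing union of finite clusters, and monotone convergence applies.\<close>

lemma nn_integral_cluster_size: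
  assumes "incseq T" and fin: "\<And>n. finite (T n)" and S: "(\<Union>n. T n) = S" and x: "\<And>n. x \<in> T n"
  shows "(\<integral>\<^sup>+ c. emeasure (count_space UNIV) (cluster S c x) \<partial>edge_law \<phi> S) = (SUP n. mean_size (T n) x)"
proof -
  have mono: "T m \<subseteq> T n" if "m \<le> n" for m n using assms(1) that by (simp add: incseq_def)
  have sub: "T n \<subseteq> S" for n using S by auto
  have cl: "cluster S c x = (\<Union>n. cluster (T n) c x)" for c
  proof
    show "cluster S c x \<subseteq> (\<Union>n. cluster (T n) c x)"
    proof (rule cluster_least)
      show "x \<in> (\<Union>n. cluster (T n) c x)" using cluster_self[OF x] by auto
      fix u v assume u: "u \<in> (\<Union>n. cluster (T n) c x)" and v: "v \<in> S" "u \<noteq> v" "c {u, v}"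
      obtain m where m: "u \<in> cluster (T m) c x" using u by auto
      obtain n where n: "v \<in> T n" using v S by auto
      have "u \<in> cluster (T (max m n)) c x" using m cluster_mono[OF mono[of m "max m n"]] by auto
      moreover have "v \<in> T (max m n)" using n mono[of n "max m n"] by auto
      ultimately have "v \<in> cluster (T (max m n)) c x" by (rule cluster_step[where c = c, OF _ _ v(2,3)])
      then show "v \<in> (\<Union>n. cluster (T n) c x)" by auto
    qed
    show "(\<Union>n. cluster (T n) c x) \<subseteq> cluster S c x" using cluster_mono[OF sub] by blast
  qed
  have size: "emeasure (count_space UNIV) (cluster (T n) c x) = of_nat (card (cluster (T n) c x))" for n c
    using finite_subset[OF cluster_subset fin] by (intro emeasure_count_space_finite) auto
  have inc: "incseq (\<lambda>n. cluster (T n) c x)" for c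
    using cluster_mono[OF mono] by (intro monoI)
  have SUP: "emeasure (count_space UNIV) (cluster S c x) = (SUP n. of_nat (card (cluster (T n) c x)))" for c
    unfolding cl size[symmetric] by (rule SUP_emeasure_incseq[symmetric]) (use inc in auto)
  have h: "of_nat (card (cluster (T n) c x)) = (of_nat (card (cluster (T n) c' x)) :: ennreal)"
    if "\<And>e. e \<in> vertex_pairs (T n) \<Longrightarrow> c e = c' e" for n c c'
    using cluster_cong[of "T n" c c' x] that by simp
  have "(\<integral>\<^sup>+ c. emeasure (count_space UNIV) (cluster S c x) \<partial>edge_law \<phi> S) =
      (SUP n. \<integral>\<^sup>+ c. of_nat (card (cluster (T n) c x)) \<partial>edge_law \<phi> S)"
    unfolding SUP
  proof (rule nn_integral_monotone_convergence_SUP)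
    show "incseq (\<lambda>n c. of_nat (card (cluster (T n) c x)) :: ennreal)"
      by (intro monoI le_funI of_nat_mono card_mono cluster_mono mono finite_subset[OF cluster_subset fin])
    show "(\<lambda>c. of_nat (card (cluster (T n) c x)) :: ennreal) \<in> borel_measurable (edge_law \<phi> S)" for n
      by (rule nn_integral_edge_law_finite(1)[OF sub fin h])
  qed
  also have "\<dots> = (SUP n. mean_size (T n) x)"
    unfolding mean_size_eq by (intro SUP_cong refl nn_integral_edge_law_finite(2) sub fin h)
  finally show ?thesis .
qed

end

section \<open>The marked random connection model\<close>

locale marked_rcm =
  fixes P :: "'e::polish_space measure"
    and \<phi> :: "(real ^ 'd) \<times> 'e \<Rightarrow> (real ^ 'd) \<times> 'e \<Rightarrow> real"
  assumes prob_P: "prob_space P" and sets_P: "sets P = sets borel"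
    and adjacency: "adjacency_function \<phi>"

sublocale marked_rcm \<subseteq> P: prob_space P
  by (rule prob_P)

sublocale marked_rcm \<subseteq> measurable_kernel \<phi>
proof
  show "\<phi> x y = \<phi> y x" "0 \<le> \<phi> x y" "\<phi> x y \<le> 1" for x y
    using adjacency unfolding adjacency_function_def by blast+
  show "(\<lambda>(x, y). \<phi> x y) \<in> borel_measurable (borel \<Otimes>\<^sub>M borel)"
    using adjacency unfolding adjacency_function_def by (simp only: borel_prod)
qed

context marked_rcm
begin

lemma translation:
  assumes "x - y = x' - y'"
  shows "\<phi> (x, a) (y, b) = \<phi> (x', a) (y', b)"
  using adjacency assms unfolding adjacency_function_def by blast

definition \<nu> :: "((real ^ 'd) \<times> 'e) measure" where
  "\<nu> = lborel \<Otimes>\<^sub>M P"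

sublocale \<nu>: pair_sigma_finite lborel P ..

lemma sets_\<nu>: "sets \<nu> = sets borel"
proof -
  have "sets \<nu> = sets (borel \<Otimes>\<^sub>M borel)"
    unfolding \<nu>_def by (intro sets_pair_measure_cong sets_P) simp
  then show ?thesis by (simp only: borel_prod)
qed

lemma space_P: "space P = UNIV"
  using sets_eq_imp_space_eq[OF sets_P] by simp

lemma emeasure_\<nu>:
  assumes "B \<in> sets borel"
  shows "emeasure \<nu> B = (\<integral>\<^sup>+ b. emeasure lborel ((\<lambda>x. (x, b)) -` B) \<partial>P)"
proof -
  have "B \<in> sets \<nu>" using assms sets_\<nu> by simp
  then show ?thesis unfolding \<nu>_def by (rule \<nu>.emeasure_pair_measure_alt2)
qed

text \<open>Only space is truncated, since the marks already have finite mass. The radius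
  \<open>n + 1\<close> gives every window positive volume, so that the uniform law on it
  exists.\<close>

definition window :: "nat \<Rightarrow> ((real ^ 'd) \<times> 'e) set" where
  "window n = ball 0 (real n + 1) \<times> UNIV"

definition vol :: "nat \<Rightarrow> real" where
  "vol n = measure lborel (ball (0 :: real ^ 'd) (real n + 1))"

definition window_law :: "nat \<Rightarrow> ((real ^ 'd) \<times> 'e) measure" where
  "window_law n = uniform_measure \<nu> (window n)"

lemma vol_pos: "0 < vol n"
  unfolding vol_def by (rule content_ball_pos) simp

lemma window_sets: "window n \<in> sets borel"
  unfolding window_def borel_prod[symmetric] by (intro pair_measureI) auto

lemma emeasure_window: "emeasure \<nu> (window n) = ennreal (vol n)"
proof -
  have "emeasure \<nu> (window n) = emeasure lborel (ball (0 :: real ^ 'd) (real n + 1)) * emeasure P UNIV"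
    unfolding \<nu>_def window_def using space_P sets.top[of P]
    by (intro P.emeasure_pair_measure_Times) auto
  also have "emeasure P UNIV = 1" using P.emeasure_space_1 space_P by simp
  also have "emeasure lborel (ball (0 :: real ^ 'd) (real n + 1)) = ennreal (vol n)"
    unfolding vol_def using emeasure_lborel_ball_finite[of "0 :: real ^ 'd" "real n + 1"]
    by (intro emeasure_eq_ennreal_measure) auto
  finally show ?thesis by simp
qed

lemma window_mono: "m \<le> n \<Longrightarrow> window m \<subseteq> window n"
  unfolding window_def by auto

lemma Union_window: "(\<Union>n. window n) = UNIV"
proof -
  have "\<exists>n. norm x < real n + 1" for x :: "real ^ 'd"
    using reals_Archimedean2[of "norm x"] by (metis less_add_one order_less_trans)
  then show ?thesis unfolding window_def by auto
qed

text \<open>Diffuseness comes from the spatial coordinate; the mark distribution may have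
  atoms.\<close>

lemma window_law_diffuse: "diffuse_prob (window_law n)"
proof -
  have sets: "sets (window_law n) = sets borel" by (simp add: window_law_def sets_\<nu>)
  have "prob_space (window_law n)"
    unfolding window_law_def using emeasure_window[of n] vol_pos[of n]
    by (intro prob_space_uniform_measure) auto
  moreover have "emeasure (window_law n) {x} = 0" for x
  proof -
    have "{fst x} \<times> {snd x} = {x}" by auto
    then have "emeasure \<nu> {x} = emeasure lborel {fst x} * emeasure P {snd x}"
      unfolding \<nu>_def using sets_P P.emeasure_pair_measure_Times[of "{fst x}" lborel "{snd x}"] by simp
    then have "emeasure \<nu> {x} = 0" by simp
    moreover have "emeasure \<nu> (window n \<inter> {x}) \<le> emeasure \<nu> {x}"
      using sets_\<nu> by (intro emeasure_mono) auto
    ultimately show ?thesis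
      unfolding window_law_def using window_sets sets_\<nu> by (subst emeasure_uniform_measure) auto
  qed
  ultimately show ?thesis using sets by (simp add: diffuse_prob_def diffuse_prob_axioms_def)
qed

lemma window_kernel: "poisson_kernel (window_law n) \<phi>"
  using window_law_diffuse measurable_kernel_axioms by (simp add: poisson_kernel_def)

lemma window_law_scale:
  assumes "0 \<le> l" "B \<in> sets borel"
  shows "emeasure (scale_measure (ennreal l) \<nu>) (window n \<inter> B) = ennreal (l * vol n) * emeasure (window_law n) B"
proof -
  have v: "ennreal (vol n) * inverse (ennreal (vol n)) = 1"
    using vol_pos[of n] by (simp add: inverse_ennreal flip: ennreal_mult)
  have "ennreal (l * vol n) * emeasure (window_law n) B =
      ennreal l * (ennreal (vol n) * inverse (ennreal (vol n))) * emeasure \<nu> (window n \<inter> B)"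
    unfolding window_law_def using assms vol_pos[of n] window_sets sets_\<nu> emeasure_window
    by (simp add: ennreal_mult divide_ennreal_def mult_ac)
  then show ?thesis by (simp add: v)
qed

text \<open>Defined through the explicit configuration and not through \<open>M\<close>, so that
  means at different intensities are comparable although the given processes are not
  coupled.\<close>

definition window_mean :: "nat \<Rightarrow> real \<Rightarrow> (real ^ 'd) \<times> 'e \<Rightarrow> ennreal" where
  "window_mean n l = poisson_kernel.poisson_mean (window_law n) \<phi> (l * vol n)"

lemma process_window:
  fixes M :: "'w measure"
  assumes pp: "poisson_process M (scale_measure (ennreal l) \<nu>) \<eta>" and l: "0 \<le> l"
  shows "AE \<omega> in M. finite (\<eta> \<omega> \<inter> window n)"
    and "(\<lambda>\<omega>. if finite (\<eta> \<omega> \<inter> window n) then mean_size (insert x (\<eta> \<omega> \<inter> window n)) x else 0) \<in> borel_measurable M"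
    and "(\<integral>\<^sup>+ \<omega>. (if finite (\<eta> \<omega> \<inter> window n) then mean_size (insert x (\<eta> \<omega> \<inter> window n)) x else 0) \<partial>M) = window_mean n l x"
proof -
  interpret poisson_kernel "window_law n" \<phi> by (rule window_kernel)
  have sets: "sets (scale_measure (ennreal l) \<nu>) = sets borel" using sets_\<nu> by simp
  have t: "0 \<le> l * vol n" using l vol_pos[of n] by simp
  have sc: "\<forall>B\<in>sets borel. emeasure (scale_measure (ennreal l) \<nu>) (window n \<inter> B) = ennreal (l * vol n) * emeasure (window_law n) B"
    using window_law_scale[OF l] by blast
  show "AE \<omega> in M. finite (\<eta> \<omega> \<inter> window n)"
    by (rule AE_poisson_process_finite[OF pp sets t window_sets sc])
  note r = poisson_process_restrict[OF pp sets t window_sets sc, of "\<lambda>S. mean_size (insert x S) x", OF measurable_mean_points]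
  show "(\<lambda>\<omega>. if finite (\<eta> \<omega> \<inter> window n) then mean_size (insert x (\<eta> \<omega> \<inter> window n)) x else 0) \<in> borel_measurable M"
    by (rule r(1))
  show "(\<integral>\<^sup>+ \<omega>. (if finite (\<eta> \<omega> \<inter> window n) then mean_size (insert x (\<eta> \<omega> \<inter> window n)) x else 0) \<partial>M) = window_mean n l x"
    unfolding window_mean_def poisson_mean_def by (rule r(2))
qed

lemma susceptibility_AE:
  fixes M :: "'w measure"
  assumes pp: "poisson_process M (scale_measure (ennreal l) \<nu>) \<eta>" and l: "0 \<le> l"
  shows "susceptibility \<phi> M \<eta> a = (\<integral>\<^sup>+ \<omega>. (SUP n. mean_size (insert (0, a) (\<eta> \<omega> \<inter> window n)) (0, a)) \<partial>M)"
  unfolding susceptibility_def rcm_expectation_def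
proof (rule nn_integral_cong_AE)
  have "AE \<omega> in M. \<forall>n. finite (\<eta> \<omega> \<inter> window n)"
    unfolding AE_all_countable using process_window(1)[OF pp l] by blast
  then show "AE \<omega> in M. (\<integral>\<^sup>+ c. emeasure (count_space UNIV) (cluster (\<eta> \<omega> \<union> {(0, a)}) c (0, a)) \<partial>edge_law \<phi> (\<eta> \<omega> \<union> {(0, a)}))
      = (SUP n. mean_size (insert (0, a) (\<eta> \<omega> \<inter> window n)) (0, a))"
  proof eventually_elim
    fix \<omega> assume fin: "\<forall>n. finite (\<eta> \<omega> \<inter> window n)"
    show "(\<integral>\<^sup>+ c. emeasure (count_space UNIV) (cluster (\<eta> \<omega> \<union> {(0, a)}) c (0, a)) \<partial>edge_law \<phi> (\<eta> \<omega> \<union> {(0, a)}))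
      = (SUP n. mean_size (insert (0, a) (\<eta> \<omega> \<inter> window n)) (0, a))"
    proof (rule nn_integral_cluster_size)
      show "incseq (\<lambda>n. insert (0, a) (\<eta> \<omega> \<inter> window n))"
        using window_mono by (intro monoI) blast
      show "(\<Union>n. insert (0, a) (\<eta> \<omega> \<inter> window n)) = \<eta> \<omega> \<union> {(0, a)}"
        using Union_window by blast
    qed (use fin in auto)
  qed
qed

text \<open>Monotone convergence over the windows, applied to the versions with default 0, which are
  measurable and almost surely increasing. The susceptibility is thereby expressed by quantities
  that depend on \<open>l\<close> alone.\<close>

lemma susceptibility_eq_SUP:
  fixes M :: "'w measure"
  assumes pp: "poisson_process M (scale_measure (ennreal l) \<nu>) \<eta>" and l: "0 \<le> l"
  shows "susceptibility \<phi> M \<eta> a = (SUP n. window_mean n l (0, a))"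
proof -
  let ?g = "\<lambda>n \<omega>. if finite (\<eta> \<omega> \<inter> window n) then mean_size (insert (0, a) (\<eta> \<omega> \<inter> window n)) (0, a) else 0"
  have fin: "AE \<omega> in M. \<forall>n. finite (\<eta> \<omega> \<inter> window n)"
    unfolding AE_all_countable using process_window(1)[OF pp l] by blast
  have "susceptibility \<phi> M \<eta> a = (\<integral>\<^sup>+ \<omega>. (SUP n. ?g n \<omega>) \<partial>M)"
    unfolding susceptibility_AE[OF pp l]
    by (rule nn_integral_cong_AE) (use fin in \<open>eventually_elim, simp\<close>)
  also have "\<dots> = (SUP n. \<integral>\<^sup>+ \<omega>. ?g n \<omega> \<partial>M)"
  proof (rule nn_integral_monotone_convergence_SUP_AE)
    show "AE \<omega> in M. ?g n \<omega> \<le> ?g (Suc n) \<omega>" for n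
      using fin
    proof eventually_elim
      fix \<omega> assume "\<forall>n. finite (\<eta> \<omega> \<inter> window n)"
      then show "?g n \<omega> \<le> ?g (Suc n) \<omega>"
        using window_mono[of n "Suc n"] by (auto intro!: mean_size_mono)
    qed
    show "?g n \<in> borel_measurable M" for n by (rule process_window(2)[OF pp l])
  qed
  finally show ?thesis unfolding process_window(3)[OF pp l] .
qed

section \<open>Translation invariance\<close>

definition shift :: "real ^ 'd \<Rightarrow> (real ^ 'd) \<times> 'e \<Rightarrow> (real ^ 'd) \<times> 'e" where
  "shift u p = (fst p + u, snd p)"

lemma inj_shift: "inj (shift u)"
  by (auto simp: inj_on_def shift_def prod_eq_iff)

lemma shift_vimage_sets: "B \<in> sets borel \<Longrightarrow> shift u -` B \<in> sets borel"
proof -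
  have "continuous_on UNIV (shift u)" unfolding shift_def[abs_def] by (intro continuous_intros)
  then have "shift u \<in> borel_measurable borel" by (rule borel_measurable_continuous_onI)
  then show "B \<in> sets borel \<Longrightarrow> shift u -` B \<in> sets borel" using measurable_sets[of "shift u" borel borel B] by simp
qed

lemma emeasure_shift_vimage:
  assumes B: "B \<in> sets borel"
  shows "emeasure \<nu> (shift u -` B) = emeasure \<nu> B"
  unfolding emeasure_\<nu>[OF shift_vimage_sets[OF B]] emeasure_\<nu>[OF B]
proof (rule nn_integral_cong)
  fix b
  have m: "(\<lambda>x. (x, b)) -` B \<in> sets lborel"
  proof -
    have "(\<lambda>x. (x, b)) \<in> measurable (borel :: (real ^ 'd) measure) (borel \<Otimes>\<^sub>M (borel :: 'e measure))" by simp
    then have "(\<lambda>x. (x, b)) \<in> borel_measurable (borel :: (real ^ 'd) measure)" by (simp only: borel_prod)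
    from measurable_sets[OF this B] show ?thesis by simp
  qed
  have "emeasure lborel ((\<lambda>x. (x, b)) -` B) = emeasure (distr lborel borel ((+) u)) ((\<lambda>x. (x, b)) -` B)"
    by (simp add: lborel_distr_plus)
  also have "\<dots> = emeasure lborel ((+) u -` ((\<lambda>x. (x, b)) -` B))"
    using m by (subst emeasure_distr) auto
  also have "(+) u -` ((\<lambda>x. (x, b)) -` B) = (\<lambda>x. (x, b)) -` (shift u -` B)"
    by (auto simp: shift_def add.commute)
  finally show "emeasure lborel ((\<lambda>x. (x, b)) -` (shift u -` B)) = emeasure lborel ((\<lambda>x. (x, b)) -` B)" ..
qed

lemma num_points_shift: "num_points (shift u ` S) B = num_points S (shift u -` B)"
proof -
  have "shift u ` S \<inter> B = shift u ` (S \<inter> shift u -` B)" by auto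
  moreover have inj: "inj_on (shift u) A" for A using inj_shift by (rule inj_on_subset) simp
  moreover have "emeasure (count_space UNIV) (f ` A) = emeasure (count_space UNIV) A"
    if "inj_on f A" for f :: "(real ^ 'd) \<times> 'e \<Rightarrow> (real ^ 'd) \<times> 'e" and A
    using that finite_imageD[OF _ that] by (auto simp: emeasure_count_space card_image)
  ultimately show ?thesis unfolding num_points_def by simp
qed

lemma poisson_process_shift:
  fixes M :: "'w measure"
  assumes pp: "poisson_process M (scale_measure (ennreal l) \<nu>) \<eta>"
  shows "poisson_process M (scale_measure (ennreal l) \<nu>) (\<lambda>\<omega>. shift u ` \<eta> \<omega>)"
proof -
  let ?\<mu> = "scale_measure (ennreal l) \<nu>"
  have sets: "sets ?\<mu> = sets borel" using sets_\<nu> by simp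
  have B': "shift u -` B \<in> sets ?\<mu>" if "B \<in> sets ?\<mu>" for B
    using that shift_vimage_sets unfolding sets by blast
  have em: "emeasure ?\<mu> (shift u -` B) = emeasure ?\<mu> B" if "B \<in> sets ?\<mu>" for B
    using that emeasure_shift_vimage unfolding sets by simp
  then have me: "measure ?\<mu> (shift u -` B) = measure ?\<mu> B" if "B \<in> sets ?\<mu>" for B
    using that by (simp add: measure_def)
  show ?thesis
    unfolding poisson_process_def num_points_shift
  proof (intro conjI allI ballI impI)
    show "prob_space M" using pp by (simp add: poisson_process_def)
    fix B assume B: "B \<in> sets ?\<mu>"
    show "(\<lambda>\<omega>. num_points (\<eta> \<omega>) (shift u -` B)) \<in> borel_measurable M"
      using pp B'[OF B] by (simp add: poisson_process_def)
    show "measure M {\<omega> \<in> space M. num_points (\<eta> \<omega>) (shift u -` B) = of_nat k} =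
        measure ?\<mu> B ^ k / fact k * exp (- measure ?\<mu> B)" if "emeasure ?\<mu> B < \<infinity>" for k
      using poisson_process_count[OF pp B'[OF B], of k] that em[OF B] me[OF B] by simp
    show "AE \<omega> in M. num_points (\<eta> \<omega>) (shift u -` B) = \<infinity>" if "emeasure ?\<mu> B = \<infinity>"
      using pp B'[OF B] that em[OF B] by (simp add: poisson_process_def)
  next
    fix B :: "nat \<Rightarrow> ((real ^ 'd) \<times> 'e) set" and n
    assume B: "(\<forall>i<n. B i \<in> sets ?\<mu>) \<and> disjoint_family_on B {..<n}"
    then have "disjoint_family_on (\<lambda>i. shift u -` B i) {..<n}"
      unfolding disjoint_family_on_def by blast
    then show "prob_space.indep_vars M (\<lambda>_. borel) (\<lambda>i \<omega>. num_points (\<eta> \<omega>) (shift u -` B i)) {..<n}"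
      using B B' by (intro poisson_process_indep[OF pp]) blast+
  qed
qed

lemma mean_size_shift:
  "x \<in> S \<Longrightarrow> mean_size (shift u ` S) (shift u x) = mean_size S x"
proof -
  assume x: "x \<in> S"
  have "(\<lambda>p q. \<phi> (shift u p) (shift u q)) = \<phi>"
  proof (intro ext)
    fix p q show "\<phi> (shift u p) (shift u q) = \<phi> p q"
      by (cases p; cases q) (auto simp: shift_def intro: translation)
  qed
  then show ?thesis
    unfolding mean_size_def
    using cluster_mean_image[OF inj_on_subset[OF inj_shift subset_UNIV] x, of "\<lambda>n k. of_nat k" u] by simp
qed

text \<open>The shifted process is Poisson with the same intensity, so it may be used to compute the
  window mean. Moving the root back to the origin moves the window too, but the moved window lies in
  a larger centred one, whose mean the susceptibility dominates.\<close>

lemma window_mean_le_susceptibility: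
  fixes M :: "'w measure"
  assumes pp: "poisson_process M (scale_measure (ennreal l) \<nu>) \<eta>" and l: "0 \<le> l"
  shows "window_mean n l (u, a) \<le> susceptibility \<phi> M \<eta> a"
proof -
  let ?\<eta> = "\<lambda>\<omega>. shift u ` \<eta> \<omega>"
  \<comment> \<open>Large enough for \<open>window m\<close> to contain the window shifted back, a
    ball of radius \<open>n + 1\<close> around \<open>- u\<close> in space.\<close>
  obtain m :: nat where m: "real n + 1 + norm u \<le> real m" using real_arch_simple by blast
  have "shift u p \<in> window n \<Longrightarrow> p \<in> window m" for p
  proof -
    assume "shift u p \<in> window n"
    then have "norm (fst p + u) < real n + 1" by (cases p) (auto simp: window_def shift_def)
    moreover have "norm (fst p) \<le> norm (fst p + u) + norm u"
      using norm_triangle_ineq4[of "fst p + u" u] by simp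
    ultimately show "p \<in> window m" using m by (cases p) (auto simp: window_def)
  qed
  then have sub: "\<eta> \<omega> \<inter> shift u -` window n \<subseteq> \<eta> \<omega> \<inter> window m" for \<omega> by auto
  have eq: "?\<eta> \<omega> \<inter> window n = shift u ` (\<eta> \<omega> \<inter> shift u -` window n)" for \<omega> by auto
  have ua: "(u, a) = shift u (0, a)" by (simp add: shift_def)
  have "window_mean n l (u, a) =
      (\<integral>\<^sup>+ \<omega>. (if finite (?\<eta> \<omega> \<inter> window n) then mean_size (insert (u, a) (?\<eta> \<omega> \<inter> window n)) (u, a) else 0) \<partial>M)"
    by (rule process_window(3)[OF poisson_process_shift[OF pp] l, symmetric])
  also have "\<dots> \<le> (\<integral>\<^sup>+ \<omega>. (SUP n. mean_size (insert (0, a) (\<eta> \<omega> \<inter> window n)) (0, a)) \<partial>M)"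
  proof (rule nn_integral_mono_AE, use process_window(1)[OF pp l, of m] in eventually_elim)
    fix \<omega> assume fin: "finite (\<eta> \<omega> \<inter> window m)"
    have "mean_size (insert (u, a) (?\<eta> \<omega> \<inter> window n)) (u, a) =
        mean_size (shift u ` insert (0, a) (\<eta> \<omega> \<inter> shift u -` window n)) (shift u (0, a))"
      unfolding eq ua by simp
    also have "\<dots> = mean_size (insert (0, a) (\<eta> \<omega> \<inter> shift u -` window n)) (0, a)"
      by (rule mean_size_shift) simp
    also have "\<dots> \<le> mean_size (insert (0, a) (\<eta> \<omega> \<inter> window m)) (0, a)"
      using fin sub[of \<omega>] by (intro mean_size_mono) auto
    also have "\<dots> \<le> (SUP n. mean_size (insert (0, a) (\<eta> \<omega> \<inter> window n)) (0, a))"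
      by (rule SUP_upper) simp
    finally show "(if finite (?\<eta> \<omega> \<inter> window n) then mean_size (insert (u, a) (?\<eta> \<omega> \<inter> window n)) (u, a) else 0) \<le>
        (SUP n. mean_size (insert (0, a) (\<eta> \<omega> \<inter> window n)) (0, a))" by simp
  qed
  finally show ?thesis unfolding susceptibility_AE[OF pp l] .
qed

section \<open>Window means and integrals against the kernel\<close>

lemma measurable_window_mean: "0 \<le> l \<Longrightarrow> window_mean n l \<in> borel_measurable borel"
  unfolding window_mean_def using vol_pos[of n]
  by (intro poisson_kernel.measurable_poisson_mean window_kernel) simp

lemma window_mean_ge_1: "0 \<le> l \<Longrightarrow> 1 \<le> window_mean n l x"
  unfolding window_mean_def using vol_pos[of n]
  by (intro poisson_kernel.poisson_mean_ge_1 window_kernel) simp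

lemma window_mean_bound: "0 \<le> l \<Longrightarrow> window_mean n l x \<le> 1 + ennreal (l * vol n)"
  unfolding window_mean_def using vol_pos[of n]
  by (intro poisson_kernel.poisson_mean_le window_kernel) simp

text \<open>The essential bound on \<open>P \<Otimes>\<^sub>M P\<close> gives, for almost every
  \<open>b\<close>, a bound for almost every \<open>c\<close>. Fixing the good \<open>b\<close>
  allows bounds to be asserted for every root with such a mark.\<close>

definition good_marks :: "real \<Rightarrow> 'e set" where
  "good_marks K = {b. AE c in P. integrated_adjacency \<phi> c b \<le> ennreal K}"

text \<open>Sections are taken in the first coordinate of a product, whereas good marks fix the
  second argument; hence the swap.\<close>

lemma AE_good_marks:
  assumes "AE (a, b) in P \<Otimes>\<^sub>M P. integrated_adjacency \<phi> a b \<le> ennreal K"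
  shows "AE b in P. b \<in> good_marks K"
proof -
  interpret PP: pair_sigma_finite P P ..
  have "AE (a, b) in distr (P \<Otimes>\<^sub>M P) (P \<Otimes>\<^sub>M P) (\<lambda>(x, y). (y, x)). integrated_adjacency \<phi> a b \<le> ennreal K"
    using assms by (subst (asm) PP.distr_pair_swap)
  from AE_distrD[OF measurable_pair_swap' this]
  have "AE x in P \<Otimes>\<^sub>M P. (case x of (a, b) \<Rightarrow> integrated_adjacency \<phi> b a \<le> ennreal K)"
    by (simp add: split_beta')
  from PP.AE_pair[OF this] show ?thesis
    unfolding good_marks_def by eventually_elim simp
qed

text \<open>Since \<open>u\<close> depends only on the mark, the spatial integral can be done first.
  After symmetry and translation by \<open>y\<close> it is
  \<open>integrated_adjacency \<phi> c b\<close>, at most \<open>K\<close> for almost every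
  \<open>c\<close>.\<close>

lemma nn_integral_kernel_\<nu>:
  assumes f: "f \<in> borel_measurable borel" and u: "u \<in> borel_measurable P"
    and le: "AE c in P. \<forall>x. f (x, c) \<le> u c" and b: "b \<in> good_marks K"
  shows "(\<integral>\<^sup>+ z. ennreal (\<phi> (y, b) z) * f z \<partial>\<nu>) \<le> ennreal K * (\<integral>\<^sup>+ c. u c \<partial>P)"
proof -
  have m: "(\<lambda>z. ennreal (\<phi> (y, b) z)) \<in> borel_measurable borel"
    by (intro measurable_compose[OF _ measurable_ennreal] measurable_kernel_compose) auto
  then have "(\<lambda>z. ennreal (\<phi> (y, b) z) * f z) \<in> borel_measurable borel"
    using f by (intro borel_measurable_times_ennreal)
  then have "(\<lambda>z. ennreal (\<phi> (y, b) z) * f z) \<in> borel_measurable (lborel \<Otimes>\<^sub>M P)"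
    using sets_\<nu> unfolding \<nu>_def by (simp cong: measurable_cong_sets)
  then have "(\<integral>\<^sup>+ z. ennreal (\<phi> (y, b) z) * f z \<partial>\<nu>) = (\<integral>\<^sup>+ c. \<integral>\<^sup>+ x. ennreal (\<phi> (y, b) (x, c)) * f (x, c) \<partial>lborel \<partial>P)"
    unfolding \<nu>_def by (subst \<nu>.nn_integral_snd[symmetric]) auto
  also have "\<dots> \<le> (\<integral>\<^sup>+ c. ennreal K * u c \<partial>P)"
  proof (rule nn_integral_mono_AE)
    have "AE c in P. integrated_adjacency \<phi> c b \<le> ennreal K" using b by (simp add: good_marks_def)
    then show "AE c in P. (\<integral>\<^sup>+ x. ennreal (\<phi> (y, b) (x, c)) * f (x, c) \<partial>lborel) \<le> ennreal K * u c"
      using le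
    proof eventually_elim
      fix c assume D: "integrated_adjacency \<phi> c b \<le> ennreal K" and fu: "\<forall>x. f (x, c) \<le> u c"
      have m1: "(\<lambda>x. ennreal (\<phi> (x, c) (v, b))) \<in> borel_measurable borel" for v
      proof -
        have "(\<lambda>x. (x, c)) \<in> measurable (borel :: (real ^ 'd) measure) (borel \<Otimes>\<^sub>M (borel :: 'e measure))" by simp
        then have "(\<lambda>x. (x, c)) \<in> borel_measurable (borel :: (real ^ 'd) measure)" by (simp only: borel_prod)
        then show ?thesis
          by (intro measurable_compose[OF _ measurable_ennreal] measurable_kernel_compose) auto
      qed
      have "(\<integral>\<^sup>+ x. ennreal (\<phi> (y, b) (x, c)) * f (x, c) \<partial>lborel) \<le> (\<integral>\<^sup>+ x. ennreal (\<phi> (x, c) (y, b)) * u c \<partial>lborel)"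
        using fu kernel_sym[of "(y, b)"] by (intro nn_integral_mono) (simp add: mult_left_mono)
      also have "\<dots> = (\<integral>\<^sup>+ x. ennreal (\<phi> (x, c) (y, b)) \<partial>lborel) * u c"
        using m1 by (intro nn_integral_multc) simp
      also have "(\<integral>\<^sup>+ x. ennreal (\<phi> (x, c) (y, b)) \<partial>lborel) = (\<integral>\<^sup>+ x. ennreal (\<phi> (x, c) (y, b)) \<partial>distr lborel borel ((+) y))"
        by (simp add: lborel_distr_plus)
      also have "\<dots> = (\<integral>\<^sup>+ x. ennreal (\<phi> (y + x, c) (y, b)) \<partial>lborel)"
        using m1 by (subst nn_integral_distr) auto
      also have "\<dots> = integrated_adjacency \<phi> c b"
        unfolding integrated_adjacency_def by (intro nn_integral_cong arg_cong[where f = ennreal] translation) simp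
      also have "integrated_adjacency \<phi> c b * u c \<le> ennreal K * u c"
        using D by (rule mult_right_mono) simp
      finally show "(\<integral>\<^sup>+ x. ennreal (\<phi> (y, b) (x, c)) * f (x, c) \<partial>lborel) \<le> ennreal K * u c" .
    qed
  qed
  also have "\<dots> = ennreal K * (\<integral>\<^sup>+ c. u c \<partial>P)" using u by (rule nn_integral_cmult)
  finally show ?thesis .
qed

text \<open>The volume in the Poisson parameter cancels the normalisation of the uniform law, so the
  bound is the same for all windows.\<close>

lemma nn_integral_kernel_window:
  assumes f: "f \<in> borel_measurable borel" and u: "u \<in> borel_measurable P"
    and le: "AE c in P. \<forall>x. f (x, c) \<le> u c" and b: "b \<in> good_marks K" and s: "0 \<le> s"
  shows "ennreal (s * vol n) * (\<integral>\<^sup>+ z. ennreal (\<phi> (y, b) z) * f z \<partial>window_law n) \<le>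
    ennreal s * (ennreal K * (\<integral>\<^sup>+ c. u c \<partial>P))"
proof -
  have v: "ennreal (vol n) * inverse (ennreal (vol n)) = 1"
    using vol_pos[of n] by (simp add: inverse_ennreal flip: ennreal_mult)
  have "(\<lambda>z. ennreal (\<phi> (y, b) z)) \<in> borel_measurable borel"
    by (intro measurable_compose[OF _ measurable_ennreal] measurable_kernel_compose) auto
  then have "(\<lambda>z. ennreal (\<phi> (y, b) z) * f z) \<in> borel_measurable borel"
    using f by (intro borel_measurable_times_ennreal)
  then have m: "(\<lambda>z. ennreal (\<phi> (y, b) z) * f z) \<in> borel_measurable \<nu>"
    using sets_\<nu> by (simp cong: measurable_cong_sets)
  let ?I = "\<integral>\<^sup>+ z. ennreal (\<phi> (y, b) z) * f z * indicator (window n) z \<partial>\<nu>"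
  have "(\<integral>\<^sup>+ z. ennreal (\<phi> (y, b) z) * f z \<partial>window_law n) = ?I / ennreal (vol n)"
    unfolding window_law_def emeasure_window[symmetric]
    using m window_sets sets_\<nu> by (intro nn_integral_uniform_measure) auto
  then have "ennreal (s * vol n) * (\<integral>\<^sup>+ z. ennreal (\<phi> (y, b) z) * f z \<partial>window_law n) =
      ennreal s * (ennreal (vol n) * inverse (ennreal (vol n))) * ?I"
    using s vol_pos[of n] by (simp add: ennreal_mult divide_ennreal_def mult_ac)
  also have "\<dots> = ennreal s * ?I" by (simp add: v)
  also have "?I \<le> (\<integral>\<^sup>+ z. ennreal (\<phi> (y, b) z) * f z \<partial>\<nu>)"
    by (intro nn_integral_mono) (simp split: split_indicator)
  also have "\<dots> \<le> ennreal K * (\<integral>\<^sup>+ c. u c \<partial>P)"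
    by (rule nn_integral_kernel_\<nu>[OF f u le b])
  finally show ?thesis by (simp add: mult_left_mono)
qed

lemma AE_window_law_good:
  assumes "AE b in P. b \<in> good_marks K"
  shows "AE z in window_law n. snd z \<in> good_marks K"
proof -
  obtain N where N: "{b\<in>space P. b \<notin> good_marks K} \<subseteq> N" "N \<in> sets P" "emeasure P N = 0"
    using assms by (rule AE_E)
  have "emeasure \<nu> (UNIV \<times> N) = 0"
    unfolding \<nu>_def using N by (subst P.emeasure_pair_measure_Times) auto
  moreover have "UNIV \<times> N \<in> sets \<nu>" unfolding \<nu>_def using N by (intro pair_measureI) auto
  moreover have "emeasure (window_law n) (UNIV \<times> N) \<le> emeasure \<nu> (UNIV \<times> N) / emeasure \<nu> (window n)"
    unfolding window_law_def using window_sets sets_\<nu> \<open>UNIV \<times> N \<in> sets \<nu>\<close>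
    by (subst emeasure_uniform_measure) (auto intro!: divide_right_mono_ennreal emeasure_mono)
  ultimately have "emeasure (window_law n) (UNIV \<times> N) = 0" "UNIV \<times> N \<in> sets (window_law n)"
    by (simp_all add: window_law_def)
  then show ?thesis using N(1) space_P by (intro AE_I[of _ _ "UNIV \<times> N"]) auto
qed

end

section \<open>Susceptibility at all intensities and the critical intensity\<close>

locale rcm_processes = marked_rcm P \<phi>
  for P :: "'e::polish_space measure"
    and \<phi> :: "(real ^ 'd) \<times> 'e \<Rightarrow> (real ^ 'd) \<times> 'e \<Rightarrow> real" +
  fixes M :: "real \<Rightarrow> 'w measure"
    and \<eta> :: "real \<Rightarrow> 'w \<Rightarrow> ((real ^ 'd) \<times> 'e) set"
    and K :: real
  assumes process: "\<And>l. 0 \<le> l \<Longrightarrow> poisson_process (M l) (scale_measure (ennreal l) (lborel \<Otimes>\<^sub>M P)) (\<eta> l)"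
    and K_pos: "0 < K"
    and K_bound: "AE (a, b) in P \<Otimes>\<^sub>M P. integrated_adjacency \<phi> a b \<le> ennreal K"
begin

lemmas process_\<nu> = process[folded \<nu>_def]

abbreviation susc :: "real \<Rightarrow> 'e \<Rightarrow> ennreal" where
  "susc l \<equiv> susceptibility \<phi> (M l) (\<eta> l)"

definition mean_susc :: "real \<Rightarrow> ennreal" where
  "mean_susc l = (\<integral>\<^sup>+ a. susc l a \<partial>P)"

abbreviation good :: "'e set" where
  "good \<equiv> good_marks K"

lemma AE_good: "AE b in P. b \<in> good"
  by (rule AE_good_marks[OF K_bound])

lemma measurable_susc:
  assumes l: "0 \<le> l"
  shows "susc l \<in> borel_measurable P"
proof -
  have "(\<lambda>a. (0, a)) \<in> measurable (borel :: 'e measure) ((borel :: (real ^ 'd) measure) \<Otimes>\<^sub>M borel)" by simp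
  then have "(\<lambda>a. (0, a)) \<in> measurable (borel :: 'e measure) (borel :: ((real ^ 'd) \<times> 'e) measure)"
    by (simp only: borel_prod)
  then have "(\<lambda>a. SUP n. window_mean n l (0, a)) \<in> borel_measurable borel"
    by (intro borel_measurable_SUP measurable_compose[OF _ measurable_window_mean[OF l]]) auto
  then show ?thesis
    unfolding susceptibility_eq_SUP[OF process_\<nu>[OF l] l, abs_def] using sets_P
    by (simp cong: measurable_cong_sets)
qed

lemma mean_susc_ge_1:
  assumes l: "0 \<le> l"
  shows "1 \<le> mean_susc l"
proof -
  have "1 \<le> susc l a" for a
    using window_mean_ge_1[OF l, of 0 "(0, a)"] window_mean_le_susceptibility[OF process_\<nu>[OF l] l, of 0 0 a]
    by (rule order_trans)
  then have "(\<integral>\<^sup>+ a. 1 \<partial>P) \<le> mean_susc l" unfolding mean_susc_def by (intro nn_integral_mono)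
  then show ?thesis using P.emeasure_space_1 by simp
qed

text \<open>The exploration from intensity 0, with the window mean under the integral replaced by
  the susceptibility of the mark. It turns control in mean into a bound for every good mark, and
  this is why all norms become infinite together.\<close>

lemma susc_le_mean:
  assumes l: "0 \<le> l" and a: "a \<in> good"
  shows "susc l a \<le> 1 + ennreal l * (ennreal K * mean_susc l)"
  unfolding susceptibility_eq_SUP[OF process_\<nu>[OF l] l]
proof (rule SUP_least)
  fix n
  interpret poisson_kernel "window_law n" \<phi> by (rule window_kernel)
  have "window_mean n l (0, a) \<le> 1 + ennreal (l * vol n) * (\<integral>\<^sup>+ z. ennreal (\<phi> (0, a) z) * window_mean n l z \<partial>window_law n)"
    unfolding window_mean_def using l vol_pos[of n] by (intro poisson_mean_le_integral) simp
  also have "ennreal (l * vol n) * (\<integral>\<^sup>+ z. ennreal (\<phi> (0, a) z) * window_mean n l z \<partial>window_law n) \<le>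
      ennreal l * (ennreal K * (\<integral>\<^sup>+ c. susc l c \<partial>P))"
    using window_mean_le_susceptibility[OF process_\<nu>[OF l] l]
    by (intro nn_integral_kernel_window measurable_window_mean measurable_susc l a) simp
  finally show "window_mean n l (0, a) \<le> 1 + ennreal l * (ennreal K * mean_susc l)"
    unfolding mean_susc_def by (simp add: add_left_mono)
qed

text \<open>The self-referential bound for the supremum of the window means at intensity
  \<open>l + \<epsilon>\<close>. It is solved in each window, and the supremum over windows is taken
  only afterwards.\<close>

lemma susc_bounded:
  assumes l: "0 \<le> l" and \<epsilon>: "0 \<le> \<epsilon>" and n: "mean_susc l = ennreal n" "0 \<le> n"
    and less: "\<epsilon> * (K * (1 + l * K * n)) < 1"
  obtains Y where "\<And>a. a \<in> good \<Longrightarrow> susc (l + \<epsilon>) a \<le> ennreal Y"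
proof -
  define X where "X = 1 + l * K * n"
  have X: "0 \<le> X" using l n K_pos by (simp add: X_def)
  have \<epsilon>X: "\<epsilon> * K * X < 1" using less by (simp add: X_def mult.assoc)
  have suscX: "susc l a \<le> ennreal X" if "a \<in> good" for a
  proof -
    have "1 + ennreal l * (ennreal K * ennreal n) = ennreal X"
      unfolding X_def using l n K_pos by (simp add: ennreal_mult mult.assoc)
    then show ?thesis using susc_le_mean[OF l that] n by simp
  qed
  have bound: "window_mean m (l + \<epsilon>) (y, a) \<le> ennreal (X / (1 - \<epsilon> * K * X))" if "a \<in> good" for m y a
  proof -
    interpret poisson_kernel "window_law m" \<phi> by (rule window_kernel)
    \<comment> \<open>All positions but only good marks: the kernel estimate needs a bound in the
      mark alone, and exceptional marks carry no bound on \<open>D\<close>.\<close>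
    define B where "B = (SUP z\<in>UNIV \<times> good. window_mean m (l + \<epsilon>) z)"
    have v: "0 \<le> l * vol m" "0 \<le> \<epsilon> * vol m" using l \<epsilon> vol_pos[of m] by simp_all
    have wm: "window_mean m (l + \<epsilon>) = poisson_mean (l * vol m + \<epsilon> * vol m)" "window_mean m l = poisson_mean (l * vol m)"
      unfolding window_mean_def by (simp_all add: distrib_right)
    have le_B: "window_mean m (l + \<epsilon>) z \<le> B" if "snd z \<in> good" for z
      unfolding B_def by (rule SUP_upper) (use that in \<open>cases z, simp\<close>)
    have "AE c in P. \<forall>x. window_mean m (l + \<epsilon>) (x, c) \<le> B"
      using AE_good by eventually_elim (simp add: le_B)
    then have kernel: "ennreal (\<epsilon> * vol m) * (\<integral>\<^sup>+ z. ennreal (\<phi> x z) * window_mean m (l + \<epsilon>) z \<partial>window_law m) \<le>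
        ennreal \<epsilon> * (ennreal K * B)" if "snd x \<in> good" for x
      using nn_integral_kernel_window[of "window_mean m (l + \<epsilon>)" "\<lambda>_. B" "snd x" K \<epsilon> m "fst x"]
        measurable_window_mean[of "l + \<epsilon>" m] l \<epsilon> that P.emeasure_space_1 by simp
    have step: "window_mean m (l + \<epsilon>) x \<le> (1 + ennreal \<epsilon> * (ennreal K * B)) * ennreal X" if x: "snd x \<in> good" for x
    proof -
      have "window_mean m (l + \<epsilon>) x \<le> (1 + ennreal \<epsilon> * (ennreal K * B)) * window_mean m l x"
        unfolding wm
      proof (rule poisson_mean_step[OF v])
        show "ennreal (\<epsilon> * vol m) * (\<integral>\<^sup>+ z. ennreal (\<phi> x z) * poisson_mean (l * vol m + \<epsilon> * vol m) z \<partial>window_law m) \<le>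
            ennreal \<epsilon> * (ennreal K * B)"
          using kernel[OF x] unfolding wm .
        show "AE c in poisson_config (window_law m) (l * vol m). \<forall>y\<in>points c.
            ennreal (\<epsilon> * vol m) * (\<integral>\<^sup>+ z. ennreal (\<phi> y z) * poisson_mean (l * vol m + \<epsilon> * vol m) z \<partial>window_law m) \<le>
            ennreal \<epsilon> * (ennreal K * B)"
          using AE_points[OF v(1) AE_window_law_good[OF AE_good]]
          by eventually_elim (use kernel[unfolded wm] in blast)
      qed
      also have "window_mean m l x \<le> ennreal X"
        using window_mean_le_susceptibility[OF process_\<nu>[OF l] l, of m "fst x" "snd x"] suscX[OF x] by simp
      finally show ?thesis by (simp add: mult_left_mono)
    qed
    have "(SUP z\<in>UNIV \<times> good. window_mean m (l + \<epsilon>) z) \<le> (1 + ennreal \<epsilon> * (ennreal K * B)) * ennreal X"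
      using step by (intro SUP_least) auto
    then have B_le: "B \<le> (1 + ennreal \<epsilon> * (ennreal K * B)) * ennreal X" by (simp only: B_def[symmetric])
    \<comment> \<open>The only use of the finite volume: \<open>B\<close> is finite, so the
      inequality can be rearranged in the reals.\<close>
    have "B \<le> 1 + ennreal ((l + \<epsilon>) * vol m)"
      unfolding B_def using l \<epsilon> by (intro SUP_least window_mean_bound) simp
    then have "B \<noteq> top" by (auto simp: top_unique)
    then obtain b where b: "B = ennreal b" "0 \<le> b" by (cases B) auto
    have "(1 + ennreal \<epsilon> * (ennreal K * ennreal b)) * ennreal X = ennreal ((1 + \<epsilon> * (K * b)) * X)"
      using \<epsilon> K_pos b X by (simp add: ennreal_mult)
    then have "b \<le> (1 + \<epsilon> * (K * b)) * X"
      using B_le b \<epsilon> K_pos X by (simp add: ennreal_le_iff)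
    then have "b * (1 - \<epsilon> * K * X) \<le> X" by (simp add: algebra_simps)
    \<comment> \<open>Here the assumption that \<open>\<epsilon>\<close> is small enters. The bound
      does not depend on the window \<open>m\<close>.\<close>
    then have "b \<le> X / (1 - \<epsilon> * K * X)" using \<epsilon>X by (simp add: pos_le_divide_eq)
    then show ?thesis using le_B[of "(y, a)"] that b by (auto intro: order_trans ennreal_leI)
  qed
  show ?thesis
  proof (rule that)
    fix a assume "a \<in> good"
    then show "susc (l + \<epsilon>) a \<le> ennreal (X / (1 - \<epsilon> * K * X))"
      unfolding susceptibility_eq_SUP[OF process_\<nu>[OF add_nonneg_nonneg[OF l \<epsilon>]] add_nonneg_nonneg[OF l \<epsilon>]]
      by (intro SUP_least bound)
  qed
qed

lemma mean_susc_finite_step: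
  assumes l: "0 \<le> l" and \<epsilon>: "0 \<le> \<epsilon>" and n: "mean_susc l = ennreal n" "0 \<le> n"
    and less: "\<epsilon> * (K * (1 + l * K * n)) < 1"
  shows "mean_susc (l + \<epsilon>) \<noteq> \<infinity>"
proof -
  obtain Y where Y: "\<And>a. a \<in> good \<Longrightarrow> susc (l + \<epsilon>) a \<le> ennreal Y"
    using susc_bounded[OF assms] by blast
  have "AE a in P. susc (l + \<epsilon>) a \<le> ennreal Y"
    using AE_good by eventually_elim (rule Y)
  then have "mean_susc (l + \<epsilon>) \<le> (\<integral>\<^sup>+ a. ennreal Y \<partial>P)"
    unfolding mean_susc_def by (rule nn_integral_mono_AE)
  then show ?thesis using P.emeasure_space_1 by (auto simp: top_unique)
qed

text \<open>On a probability space every norm dominates the mean. Conversely, a finite mean bounds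
  the susceptibility at almost every mark by \<open>susc_le_mean\<close>, which makes every norm
  finite.\<close>

lemma Lp_norm_susc_infinite_iff:
  assumes l: "0 \<le> l" and p: "1 \<le> p"
  shows "Lp_norm P p (susc l) = \<infinity> \<longleftrightarrow> mean_susc l = \<infinity>"
proof
  assume "mean_susc l = \<infinity>"
  then show "Lp_norm P p (susc l) = \<infinity>"
    using P.nn_integral_le_Lp_norm[OF measurable_susc[OF l] p] by (simp add: mean_susc_def top_unique)
next
  assume top: "Lp_norm P p (susc l) = \<infinity>"
  show "mean_susc l = \<infinity>"
  proof (rule ccontr)
    assume "mean_susc l \<noteq> \<infinity>"
    then obtain n where n: "mean_susc l = ennreal n" "0 \<le> n" by (cases "mean_susc l") auto
    have "AE a in P. susc l a \<le> ennreal (1 + l * (K * n))"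
      using AE_good
    proof eventually_elim
      fix a assume "a \<in> good"
      then have "susc l a \<le> 1 + ennreal l * (ennreal K * ennreal n)" using susc_le_mean[OF l] n by simp
      also have "\<dots> = ennreal (1 + l * (K * n))" using l n K_pos by (simp add: ennreal_mult)
      finally show "susc l a \<le> ennreal (1 + l * (K * n))" .
    qed
    from P.Lp_norm_finite[OF measurable_susc[OF l] p this] show False using top by simp
  qed
qed

text \<open>The infimum is over the same set of intensities for every \<open>p\<close>, so a common
  value exists; the instance \<open>p = 1\<close> makes it unique and justifies
  \<open>THE\<close>.\<close>

lemma critical_intensity_eq:
  "critical_intensity P susc = Inf {ennreal l | l. 0 \<le> l \<and> mean_susc l = \<infinity>}"
proof -
  have p: "critical_intensity_p P susc p = Inf {ennreal l | l. 0 \<le> l \<and> mean_susc l = \<infinity>}" if "1 \<le> p" for p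
  proof -
    have "{ennreal l | l. 0 \<le> l \<and> Lp_norm P p (susc l) = \<infinity>} = {ennreal l | l. 0 \<le> l \<and> mean_susc l = \<infinity>}"
      using Lp_norm_susc_infinite_iff[OF _ that] by auto
    then show ?thesis by (simp add: critical_intensity_p_def)
  qed
  show ?thesis
    unfolding critical_intensity_def
  proof (rule the_equality)
    show "\<forall>p\<ge>1. critical_intensity_p P susc p = Inf {ennreal l | l. 0 \<le> l \<and> mean_susc l = \<infinity>}"
      using p by blast
    show "L = Inf {ennreal l | l. 0 \<le> l \<and> mean_susc l = \<infinity>}" if "\<forall>p\<ge>1. critical_intensity_p P susc p = L" for L
      using that p[of 1] by auto
  qed
qed

text \<open>An intensity with infinite mean lies above \<open>l\<close>, and if it were closer than
  the stated distance, \<open>mean_susc_finite_step\<close> would make its mean finite. The infimum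
  of such intensities keeps the same distance.\<close>

lemma critical_intensity_gap:
  assumes l: "0 \<le> l" and sub: "ennreal l < critical_intensity P susc"
    and n: "mean_susc l = ennreal n" "0 \<le> n"
  shows "ennreal (l + 1 / (K * (1 + l * K * n))) \<le> critical_intensity P susc"
  unfolding critical_intensity_eq
proof (rule Inf_greatest)
  fix x assume "x \<in> {ennreal l | l. 0 \<le> l \<and> mean_susc l = \<infinity>}"
  then obtain l' where l': "x = ennreal l'" "0 \<le> l'" "mean_susc l' = \<infinity>" by auto
  have "critical_intensity P susc \<le> ennreal l'"
    unfolding critical_intensity_eq using l' by (intro Inf_lower) auto
  then have "ennreal l < ennreal l'" using sub by (rule order_less_le_trans[rotated])
  then have "l < l'" using l by (simp add: ennreal_less_iff)
  have "0 < K * (1 + l * K * n)"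
    using l n K_pos by (intro mult_pos_pos add_pos_nonneg) auto
  moreover have "\<not> (l' - l) * (K * (1 + l * K * n)) < 1"
    using mean_susc_finite_step[OF l _ n, of "l' - l"] \<open>l < l'\<close> l'(3) by auto
  ultimately have "1 / (K * (1 + l * K * n)) \<le> l' - l"
    by (simp add: pos_divide_le_eq)
  then show "ennreal (l + 1 / (K * (1 + l * K * n))) \<le> x"
    unfolding l'(1) by (intro ennreal_leI) simp
qed

theorem mean_susc_lower_bound:
  "\<exists>C>0. \<forall>l\<ge>0. ennreal l < critical_intensity P susc \<longrightarrow>
     ennreal C * inverse (critical_intensity P susc - ennreal l) \<le> mean_susc l"
proof (cases "critical_intensity P susc")
  case top
  \<comment> \<open>The inverse of the infinite difference is 0, so any constant works.\<close>
  then show ?thesis by (intro exI[of _ 1]) auto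
next
  case (real L)
  \<comment> \<open>Chosen to remove \<open>l\<close> from the gap: for \<open>l < L\<close> and
    \<open>1 \<le> n\<close> one has \<open>1 + l * K * n \<le> (1 + L * K) * n\<close>, so the gap
    is at least \<open>C / n\<close>.\<close>
  define C where "C = 1 / (K * (1 + L * K))"
  have C: "0 < C" using K_pos real by (simp add: C_def add_pos_nonneg)
  show ?thesis
  proof (intro exI[of _ C] conjI C allI impI)
    fix l :: real assume l: "0 \<le> l" and sub: "ennreal l < critical_intensity P susc"
    then have "l < L" using real by (simp add: ennreal_less_iff)
    show "ennreal C * inverse (critical_intensity P susc - ennreal l) \<le> mean_susc l"
    proof (cases "mean_susc l")
      case top
      then show ?thesis by simp
    next
      case n: (real n)
      have "1 \<le> n" using mean_susc_ge_1[OF l] n by (simp flip: ennreal_1)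
      have "ennreal (l + 1 / (K * (1 + l * K * n))) \<le> ennreal L"
        using critical_intensity_gap[OF l sub n(2,1)] real by simp
      then have "l + 1 / (K * (1 + l * K * n)) \<le> L" using real by (simp add: ennreal_le_iff)
      moreover have "C / n \<le> 1 / (K * (1 + l * K * n))"
      proof -
        have "1 + l * K * n \<le> n + L * K * n"
          using \<open>1 \<le> n\<close> \<open>l < L\<close> K_pos by (intro add_mono mult_right_mono) auto
        also have "\<dots> = (1 + L * K) * n" by (simp add: distrib_right)
        finally have "K * (1 + l * K * n) \<le> K * (1 + L * K) * n"
          using K_pos by (simp add: mult.assoc)
        moreover have "0 < K * (1 + l * K * n)"
          using l K_pos \<open>1 \<le> n\<close> by (intro mult_pos_pos add_pos_nonneg) auto
        ultimately have "1 / (K * (1 + L * K) * n) \<le> 1 / (K * (1 + l * K * n))"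
          by (intro divide_left_mono) auto
        then show ?thesis by (simp add: C_def)
      qed
      ultimately have "C / n \<le> L - l" by simp
      then have "C / (L - l) \<le> n"
        using \<open>l < L\<close> \<open>1 \<le> n\<close> by (simp add: field_simps)
      moreover have "ennreal C * inverse (critical_intensity P susc - ennreal l) = ennreal (C / (L - l))"
        using real l \<open>l < L\<close> C by (simp add: ennreal_minus inverse_ennreal divide_inverse flip: ennreal_mult)
      ultimately show ?thesis using n by (simp add: ennreal_leI)
    qed
  qed
qed

end

theorem theorem1p7:
  fixes P :: "'e::polish_space measure"
    and \<phi> :: "(real ^ 'd) \<times> 'e \<Rightarrow> (real ^ 'd) \<times> 'e \<Rightarrow> real"
    and M :: "real \<Rightarrow> 'w measure"
    and \<eta> :: "real \<Rightarrow> 'w \<Rightarrow> ((real ^ 'd) \<times> 'e) set"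
    and chi :: "real \<Rightarrow> 'e \<Rightarrow> ennreal"
  assumes "prob_space P" and "sets P = sets borel"
    and "adjacency_function \<phi>"
    and "\<And>l. 0 \<le> l \<Longrightarrow>
           poisson_process (M l) (scale_measure (ennreal l) (lborel \<Otimes>\<^sub>M P)) (\<eta> l)"
    and "\<And>l. chi l = susceptibility \<phi> (M l) (\<eta> l)"
    and "esssup (P \<Otimes>\<^sub>M P) (\<lambda>(a, b). integrated_adjacency \<phi> a b) < \<infinity>"
  shows "\<exists>C::real. 0 < C \<and>
           (\<forall>l\<ge>0. ennreal l < critical_intensity P chi \<longrightarrow>
             (\<forall>p\<ge>1. Lp_norm P p (chi l)
                \<ge> ennreal C * inverse (critical_intensity P chi - ennreal l)))"
proof -
  \<comment> \<open>The summand 1 keeps \<open>K\<close> positive even if the adjacency vanishes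
    almost everywhere.\<close>
  define K where "K = enn2real (esssup (P \<Otimes>\<^sub>M P) (\<lambda>(a, b). integrated_adjacency \<phi> a b)) + 1"
  have "esssup (P \<Otimes>\<^sub>M P) (\<lambda>(a, b). integrated_adjacency \<phi> a b) \<le> ennreal K"
    using assms(6) unfolding K_def
    by (cases "esssup (P \<Otimes>\<^sub>M P) (\<lambda>(a, b). integrated_adjacency \<phi> a b)") (auto intro!: ennreal_leI)
  then have K: "AE (a, b) in P \<Otimes>\<^sub>M P. integrated_adjacency \<phi> a b \<le> ennreal K"
    using esssup_AE[of "\<lambda>(a, b). integrated_adjacency \<phi> a b" "P \<Otimes>\<^sub>M P"]
    by (auto elim!: eventually_mono)
  have "0 < K" unfolding K_def by (simp add: add_nonneg_pos)
  then interpret rcm_processes P \<phi> M \<eta> K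
    by (intro rcm_processes.intro marked_rcm.intro rcm_processes_axioms.intro assms K)
  have chi: "chi = susc" using assms(5) by auto
  obtain C where C: "0 < C" "\<And>l. 0 \<le> l \<Longrightarrow> ennreal l < critical_intensity P susc \<Longrightarrow>
      ennreal C * inverse (critical_intensity P susc - ennreal l) \<le> mean_susc l"
    using mean_susc_lower_bound by blast
  \<comment> \<open>The mean is the smallest of the norms, so one constant serves all
    \<open>p\<close>.\<close>
  have "ennreal C * inverse (critical_intensity P susc - ennreal l) \<le> Lp_norm P p (susc l)"
    if "0 \<le> l" "ennreal l < critical_intensity P susc" "1 \<le> p" for l p
    using C(2)[OF that(1,2)] P.nn_integral_le_Lp_norm[OF measurable_susc[OF that(1)] that(3)]
    unfolding mean_susc_def by (rule order_trans)
  then show ?thesis unfolding chi using C(1) by blast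
qed

end
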